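(* Let $d\ge2$ and let $\Phi,\Psi\in\mathcal T_E(\Sigma_d)$ be two non-degenerate essentially affine iterated function systems. Then the following statements are equivalent: (i) $\mu_{\Phi,u}\cong\mu_{\Psi,u}$ and $P_\Phi(u)=P_\Psi(u)$, for some $u\in\mathbb R\setminus\{0\}$; (ii) $\Phi\sim\Psi$; (iii) $I_\Phi\simeq I_\Psi$; (iv) $P_\Phi=P_\Psi$ (as functions on $\mathbb R$); (v) $\ell_\Phi=\ell_\Psi$ (as functions on $\mathbb R$).
   Context: Let $I=\{1,\dots,d\}$, $d\ge2$, $\Sigma_d=I^{\mathbb N}$ with left shift $\sigma$, $[x_1\dots x_n]$ the cylinder of all $y\in\Sigma_d$ with $y_i=x_i$ for $i\le n$, and $S_nf=\sum_{k=0}^{n-1}f\circ\sigma^k$. Conformal iterated function system (CS). An ordered family $\Phi=(\phi_i:X\to\operatorname{Int}X\mid i\in I)$ of injective contractions of a connected compact set $X\subset\mathbb R$, such that, writing $\phi_\omega=\phi_{x_1}\circ\dots\circ\phi_{x_n}$ for $\omega=x_1\dots x_n\in I^n$: - (open set condition) $\phi_i(\operatorname{Int}X)\subset\operatorname{Int}X$ for all $i$, and $\phi_i(\operatorname{Int}X)\cap\phi_j(\operatorname{Int}X)=\emptyset$ for $i\ne j$; - (conformality) there is an open connected set $U\subset\mathbb C$ containing $X$ such that each $\phi_i$ extends to a conformal map on $U$ (into $U$, so that the $\phi_\omega$ are defined on $U$); - (bounded distortion) there is $C\ge1$ with $|\phi_\omega'(y)|\le C|\phi_\omega'(x)|$ for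 all $n\in\mathbb N$, $\omega\in I^n$, $x,y\in U$. The limit set is $\Lambda(\Phi)=\bigcap_n\bigcup_{\omega\in I^n}\phi_\omega(X)$, and $\pi_\Phi:\Sigma_d\to\Lambda(\Phi)$, $\pi_\Phi(x_1x_2\dots)=\lim_n\phi_{x_1\dots x_n}(X)$, is the canonical bijection. $\mathcal T(\Sigma_d)$ is the set of all CS with index set $I$. For $\Phi=(\phi_i)_{i\in I},\Psi=(\psi_i)_{i\in I}\in\mathcal T(\Sigma_d)$, $\Phi\sim\Psi$ (the systems are equivalent) means that there is a bi-Lipschitz map $h:\Lambda(\Phi)\to\Lambda(\Psi)$ such that $\psi_i=h\circ\phi_i\circ h^{-1}$ (on $\Lambda(\Psi)$) for each $i\in I$. A CS is an affine system (AS) if all $\phi_i$ are affine. A CS $\Psi$ is an essentially affine system (EAS) if $\Phi\sim\Psi$ for some AS $\Phi$. $\mathcal T_E(\Sigma_d)$ is the set of all EAS in $\mathcal T(\Sigma_d)$. A CS is degenerate if it is equivalent to an AS $(\psi_i)_{i\in I}$ with $\psi_i'=\psi_j'$ for all $i,j\in I$. The canonical geometric potential is $I_\Phi:\Sigma_d\to\mathbb R$, $I_\Phi(x)=\log|\phi_{x_1}'(\pi_\Phi(\sigma x))|$. The pressure of $f:\Sigma_d\to\mathbb R$ is $\mathcal P(f)=\lim_n\frac1n\log\sum_{\omega\in I^n}\exp(\sup_{x\in[\omega]}S_nf(x))$, and $P_\Phi(u):=\mathcal P(u I_\Phi)$ for $u\in\mathbb R$. $\mu_{\Phi,u}$ is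 the $\sigma$-invariant Gibbs probability measure on $\Sigma_d$ for $uI_\Phi-P_\Phi(u)$, i.e. the $\sigma$-invariant probability measure with $\mu_{\Phi,u}([x_1\dots x_n])\asymp e^{uS_nI_\Phi(x)-nP_\Phi(u)}$ uniformly in $n$, $(x_1,\dots,x_n)\in I^n$ and $x\in[x_1\dots x_n]$. The Lyapunov spectrum is $\ell_\Phi(\alpha)=\dim_H\big(\pi_\Phi(\{x\in\Sigma_d:\lim_n\frac{S_nI_\Phi(x)}{-n}=\alpha\})\big)$, $\alpha\in\mathbb R$ (with $\dim_H\emptyset=0$). $\mu_{\Phi,u}\cong\mu_{\Psi,v}$ means $\mu_{\Phi,u}=\mu_{\Psi_0,v}$ for some system $\Psi_0$ obtained from $\Psi$ by a permutation of its generators. $I_\Phi\simeq I_\Psi$ means that $I_\Phi$ is cohomologous to $I_{\Psi_0}$ for some system $\Psi_0$ obtained from $\Psi$ by a permutation of its generators, where $f,g:\Sigma_d\to\mathbb R$ are cohomologous if $f-g=e-e\circ\sigma$ for some continuous $e:\Sigma_d\to\mathbb R$.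
   Formalization: In (ii), Φ∼Ψ is read up to a permutation of generators: Φ∼Ψ₀ for some Ψ₀ obtained from Ψ by permuting its generators. With index-preserving ∼ the claim fails, e.g. for affine systems with ratios (1/3,1/4) and the same maps in reverse order. *)

theory Defs
  imports "HOL-Probability.Probability" "HOL-Combinatorics.Permutations"
begin

text \<open>Sequences are indexed from 0, so the letter \<open>x\<^sub>k\<close> of the mathematical
  notation is \<open>x (k - 1)\<close>.\<close>

definition alphabet :: "nat \<Rightarrow> nat set" where
  "alphabet d = {1..d}"

definition shift_space :: "nat \<Rightarrow> (nat \<Rightarrow> nat) set" where
  "shift_space d = {x. \<forall>k. x k \<in> alphabet d}"

definition shift :: "(nat \<Rightarrow> nat) \<Rightarrow> (nat \<Rightarrow> nat)" where
  "shift x = (\<lambda>k. x (Suc k))"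

definition words :: "nat \<Rightarrow> nat \<Rightarrow> nat list set" where
  "words d n = {\<omega>. length \<omega> = n \<and> set \<omega> \<subseteq> alphabet d}"

definition cylinder :: "nat \<Rightarrow> nat list \<Rightarrow> (nat \<Rightarrow> nat) set" where
  "cylinder d \<omega> = {y \<in> shift_space d. \<forall>k<length \<omega>. y k = \<omega> ! k}"

definition birkhoff :: "nat \<Rightarrow> ((nat \<Rightarrow> nat) \<Rightarrow> real) \<Rightarrow> (nat \<Rightarrow> nat) \<Rightarrow> real" where
  "birkhoff n f x = (\<Sum>k<n. f ((shift ^^ k) x))"

definition pressure :: "nat \<Rightarrow> ((nat \<Rightarrow> nat) \<Rightarrow> real) \<Rightarrow> real" where
  "pressure d f =
     lim (\<lambda>n. ln (\<Sum>\<omega>\<in>words d n. exp (SUP x\<in>cylinder d \<omega>. birkhoff n f x)) / real n)"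

text \<open>On \<^typ>\<open>nat \<Rightarrow> nat\<close> the topology is the product of the discrete topologies.\<close>

definition cohomologous ::
  "nat \<Rightarrow> ((nat \<Rightarrow> nat) \<Rightarrow> real) \<Rightarrow> ((nat \<Rightarrow> nat) \<Rightarrow> real) \<Rightarrow> bool" where
  "cohomologous d f g \<longleftrightarrow>
     (\<exists>e :: (nat \<Rightarrow> nat) \<Rightarrow> real. continuous_on (shift_space d) e \<and>
        (\<forall>x\<in>shift_space d. f x - g x = e x - e (shift x)))"

text \<open>Only the values of the generators on \<open>base\<close> are relevant; the values
  outside \<open>base\<close> are arbitrary and never enter the definitions below.\<close>

record ifs =
  base :: "real set"
  gens :: "nat \<Rightarrow> real \<Rightarrow> real"

text \<open>\<open>foldr \<phi> [x\<^sub>1, \<dots>, x\<^sub>n]\<close> is the composition \<open>\<phi> x\<^sub>1 \<circ> \<dots> \<circ> \<phi> x\<^sub>n\<close>.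

  A conformal map on \<open>U\<close> is a holomorphic map with nowhere vanishing derivative.
  The set \<open>U\<close> of the conformality condition is also the one in the bounded
  distortion condition.\<close>

definition conformal_extension ::
  "nat \<Rightarrow> ifs \<Rightarrow> complex set \<Rightarrow> (nat \<Rightarrow> complex \<Rightarrow> complex) \<Rightarrow> bool" where
  "conformal_extension d \<Phi> U F \<longleftrightarrow>
     open U \<and> connected U \<and> complex_of_real ` base \<Phi> \<subseteq> U \<and>
     (\<forall>i\<in>alphabet d.
        F i holomorphic_on U \<and> (\<forall>z\<in>U. deriv (F i) z \<noteq> 0) \<and> F i ` U \<subseteq> U \<and>
        (\<forall>x\<in>base \<Phi>. F i (complex_of_real x) = complex_of_real (gens \<Phi> i x)))"

definition bounded_distortion ::
  "nat \<Rightarrow> complex set \<Rightarrow> (nat \<Rightarrow> complex \<Rightarrow> complex) \<Rightarrow> bool" where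
  "bounded_distortion d U F \<longleftrightarrow>
     (\<exists>C\<ge>1. \<forall>n. \<forall>\<omega>\<in>words d n. \<forall>x\<in>U. \<forall>y\<in>U.
        cmod (deriv (foldr F \<omega>) y) \<le> C * cmod (deriv (foldr F \<omega>) x))"

definition CS :: "nat \<Rightarrow> ifs set" where
  "CS d = {\<Phi>.
     base \<Phi> \<noteq> {} \<and> connected (base \<Phi>) \<and> compact (base \<Phi>) \<and>
     (\<forall>i\<in>alphabet d.
        gens \<Phi> i ` base \<Phi> \<subseteq> interior (base \<Phi>) \<and>
        inj_on (gens \<Phi> i) (base \<Phi>) \<and>
        (\<exists>c<1. c-lipschitz_on (base \<Phi>) (gens \<Phi> i))) \<and>
     (\<forall>i\<in>alphabet d. gens \<Phi> i ` interior (base \<Phi>) \<subseteq> interior (base \<Phi>)) \<and>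
     (\<forall>i\<in>alphabet d. \<forall>j\<in>alphabet d. i \<noteq> j \<longrightarrow>
        gens \<Phi> i ` interior (base \<Phi>) \<inter> gens \<Phi> j ` interior (base \<Phi>) = {}) \<and>
     (\<exists>U F. conformal_extension d \<Phi> U F \<and> bounded_distortion d U F)}"

definition limit_set :: "nat \<Rightarrow> ifs \<Rightarrow> real set" where
  "limit_set d \<Phi> = (\<Inter>n. \<Union>\<omega>\<in>words d n. foldr (gens \<Phi>) \<omega> ` base \<Phi>)"

text \<open>The sets \<open>\<phi>\<^bsub>x\<^sub>1\<dots>x\<^sub>n\<^esub>(X)\<close> are compact, decreasing and shrink to a point: their limit
  is the single element of their intersection.\<close>

definition coding :: "ifs \<Rightarrow> (nat \<Rightarrow> nat) \<Rightarrow> real" where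
  "coding \<Phi> x = the_elem (\<Inter>n. foldr (gens \<Phi>) (map x [0..<n]) ` base \<Phi>)"

definition equivalent :: "nat \<Rightarrow> ifs \<Rightarrow> ifs \<Rightarrow> bool" where
  "equivalent d \<Phi> \<Psi> \<longleftrightarrow>
     (\<exists>h. bij_betw h (limit_set d \<Phi>) (limit_set d \<Psi>) \<and>
        (\<exists>L. L-lipschitz_on (limit_set d \<Phi>) h) \<and>
        (\<exists>L. L-lipschitz_on (limit_set d \<Psi>) (inv_into (limit_set d \<Phi>) h)) \<and>
        (\<forall>i\<in>alphabet d. \<forall>y\<in>limit_set d \<Psi>.
           gens \<Psi> i y = h (gens \<Phi> i (inv_into (limit_set d \<Phi>) h y))))"

definition AS :: "nat \<Rightarrow> ifs set" where
  "AS d = {\<Phi> \<in> CS d. \<forall>i\<in>alphabet d. \<exists>a b. \<forall>x\<in>base \<Phi>. gens \<Phi> i x = a * x + b}"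

definition EAS :: "nat \<Rightarrow> ifs set" where
  "EAS d = {\<Psi> \<in> CS d. \<exists>\<Phi>\<in>AS d. equivalent d \<Phi> \<Psi>}"

text \<open>Derivatives are compared on the interior of \<open>base\<close>, where \<^const>\<open>deriv\<close> does not see
  the values outside \<open>base\<close>.\<close>

definition degenerate :: "nat \<Rightarrow> ifs \<Rightarrow> bool" where
  "degenerate d \<Phi> \<longleftrightarrow>
     (\<exists>\<Psi>\<in>AS d. equivalent d \<Phi> \<Psi> \<and>
        (\<forall>i\<in>alphabet d. \<forall>j\<in>alphabet d. \<forall>x\<in>interior (base \<Psi>).
           deriv (gens \<Psi> i) x = deriv (gens \<Psi> j) x))"

definition permute_gens :: "(nat \<Rightarrow> nat) \<Rightarrow> ifs \<Rightarrow> ifs" where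
  "permute_gens p \<Psi> = \<Psi>\<lparr>gens := \<lambda>i. gens \<Psi> (p i)\<rparr>"

text \<open>The point \<open>coding \<Phi> (shift x)\<close> lies in the interior of \<open>base \<Phi>\<close>, so the real
  derivative is that of the restriction of the conformal extension.\<close>

definition geom_potential :: "ifs \<Rightarrow> (nat \<Rightarrow> nat) \<Rightarrow> real" where
  "geom_potential \<Phi> x = ln \<bar>deriv (gens \<Phi> (x 0)) (coding \<Phi> (shift x))\<bar>"

definition pressure_fun :: "nat \<Rightarrow> ifs \<Rightarrow> real \<Rightarrow> real" where
  "pressure_fun d \<Phi> u = pressure d (\<lambda>x. u * geom_potential \<Phi> x)"

definition is_gibbs_measure :: "nat \<Rightarrow> ifs \<Rightarrow> real \<Rightarrow> (nat \<Rightarrow> nat) measure \<Rightarrow> bool" where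
  "is_gibbs_measure d \<Phi> u \<mu> \<longleftrightarrow>
     sets \<mu> = sets (restrict_space borel (shift_space d)) \<and>
     prob_space \<mu> \<and>
     distr \<mu> \<mu> shift = \<mu> \<and>
     (\<exists>c\<ge>1. \<forall>n. \<forall>\<omega>\<in>words d n. \<forall>x\<in>cylinder d \<omega>.
        let w = exp (u * birkhoff n (geom_potential \<Phi>) x - real n * pressure_fun d \<Phi> u)
        in w / c \<le> measure \<mu> (cylinder d \<omega>) \<and> measure \<mu> (cylinder d \<omega>) \<le> c * w)"

definition gibbs_measure :: "nat \<Rightarrow> ifs \<Rightarrow> real \<Rightarrow> (nat \<Rightarrow> nat) measure" where
  "gibbs_measure d \<Phi> u = (THE \<mu>. is_gibbs_measure d \<Phi> u \<mu>)"

text \<open>Sums over countable covers by bounded sets. Only exponents \<open>s > 0\<close> are used, so the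
  convention \<open>0 powr 0 = 0\<close> plays no role; the infimum defining the dimension is not
  affected by leaving out \<open>s = 0\<close>.\<close>

definition hausdorff_premeasure :: "real \<Rightarrow> real \<Rightarrow> 'a::metric_space set \<Rightarrow> ennreal" where
  "hausdorff_premeasure s \<delta> A =
     Inf {\<Sum>k. ennreal (diameter (V k) powr s) | V :: nat \<Rightarrow> 'a set.
       A \<subseteq> (\<Union>k. V k) \<and> (\<forall>k. bounded (V k) \<and> diameter (V k) \<le> \<delta>)}"

definition hausdorff_measure :: "real \<Rightarrow> 'a::metric_space set \<Rightarrow> ennreal" where
  "hausdorff_measure s A = (SUP \<delta>\<in>{0<..}. hausdorff_premeasure s \<delta> A)"

definition hausdorff_dim :: "'a::metric_space set \<Rightarrow> ennreal" where
  "hausdorff_dim A = Inf {ennreal s | s. s > 0 \<and> hausdorff_measure s A = 0}"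

definition lyapunov_spectrum :: "nat \<Rightarrow> ifs \<Rightarrow> real \<Rightarrow> ennreal" where
  "lyapunov_spectrum d \<Phi> \<alpha> =
     hausdorff_dim (coding \<Phi> ` {x \<in> shift_space d.
       (\<lambda>n. birkhoff n (geom_potential \<Phi>) x / (- real n)) \<longlonglongrightarrow> \<alpha>})"

definition gibbs_equal_upto_perm :: "nat \<Rightarrow> ifs \<Rightarrow> real \<Rightarrow> ifs \<Rightarrow> real \<Rightarrow> bool" where
  "gibbs_equal_upto_perm d \<Phi> u \<Psi> v \<longleftrightarrow>
     (\<exists>p. p permutes alphabet d \<and>
        gibbs_measure d \<Phi> u = gibbs_measure d (permute_gens p \<Psi>) v)"

definition potentials_cohomologous_upto_perm :: "nat \<Rightarrow> ifs \<Rightarrow> ifs \<Rightarrow> bool" where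
  "potentials_cohomologous_upto_perm d \<Phi> \<Psi> \<longleftrightarrow>
     (\<exists>p. p permutes alphabet d \<and>
        cohomologous d (geom_potential \<Phi>) (geom_potential (permute_gens p \<Psi>)))"

text \<open>Pressure and Lyapunov spectrum do not change when the generators are permuted, whereas
  a conjugacy that respects the indices preserves the contraction ratio of each single
  generator. Equivalence can therefore be characterised by them only up to a permutation,
  as for the two relations above: affine systems with ratios \<open>(1/3, 1/4)\<close> and
  \<open>(1/4, 1/3)\<close> have the same pressure, but no index-preserving conjugacy is bi-Lipschitz.\<close>

definition equivalent_upto_perm :: "nat \<Rightarrow> ifs \<Rightarrow> ifs \<Rightarrow> bool" where
  "equivalent_upto_perm d \<Phi> \<Psi> \<longleftrightarrow>
     (\<exists>p. p permutes alphabet d \<and> equivalent d \<Phi> (permute_gens p \<Psi>))"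

end

theory Submission
  imports Defs "HOL-Complex_Analysis.Cauchy_Integral_Formula" "HOL-Computational_Algebra.Polynomial"
begin

text \<open>An essentially affine system \<open>\<Phi>\<close> is bi-Lipschitz conjugate to an affine one with contraction
  ratios \<open>r\<^sub>i\<close>. Every item of the theorem turns out to express that the ratios of \<open>\<Phi>\<close> and \<open>\<Psi>\<close> agree
  up to a permutation of the generators, so each item is shown to be equivalent to this condition.
  With \<open>\<rho>\<^sub>i = ln r\<^sub>i\<close>, write \<open>\<rho>(w)\<close> for the sum of \<open>\<rho>\<close> over the letters of a word \<open>w\<close>.

  The link between \<open>\<Phi>\<close> and its ratios is metric: if two codes have the longest common prefix \<open>w\<close>,
  the coded points lie at a distance comparable to \<open>exp (\<rho>(w))\<close>. For the affine system this holds
  because pieces of the limit set with different first letters are a positive distance apart, and a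
  bi-Lipschitz conjugacy preserves it. Bounded distortion gives the same with the Birkhoff sum of the geometric potential in place of
  \<open>\<rho>(w)\<close>; hence the Birkhoff sums differ from \<open>\<rho>(w)\<close> by a bounded amount
  (\<open>birkhoff_letter_sum\<close>).

  \<^item> Equivalence: equal ratios give comparable metrics on the shift space. Conversely, the metric
  determines \<open>\<rho>\<^sub>i\<close> through the constant codes (\<open>equivalent_iff_ratios_eq\<close>).
  \<^item> Cohomology: the values at fixed points give the ratios. If the ratios agree, the difference of
  the potentials is Hoelder continuous with bounded Birkhoff sums, hence a coboundary (\<open>livsic\<close>).
  \<^item> Pressure: \<open>P(u) = ln (\<Sum>i. exp (u \<rho>\<^sub>i))\<close>, so \<open>exp (P(u))\<close> for \<open>u = 0, 1, 2, \<dots>\<close> are the power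
  sums of the ratios, which determine them up to order (\<open>power_sums_determine_multiset\<close>).
  \<^item> Gibbs measures: the Gibbs measure at \<open>u\<close> is the Bernoulli measure with weights
  \<open>exp (u \<rho>\<^sub>i - P(u))\<close>. Uniqueness rests on the superadditivity of relative entropy with respect to
  a product measure (\<open>invariant_weights_eq_bernoulli\<close>).
  \<^item> Lyapunov spectrum: it is invariant under bi-Lipschitz maps. To recover the pressure from it,
  two bounds are enough: \<open>\<alpha> l(\<alpha>) \<le> P(u) + u \<alpha>\<close> whenever the right-hand side is positive, from
  covering by cylinders (\<open>level_set_null\<close>), and the reverse inequality at \<open>\<alpha> = - P'(u)\<close>, from the law
  of large numbers and the mass distribution principle (\<open>level_set_not_null\<close>). At \<open>\<alpha> = - P'(u)\<close>
  the right-hand side is the entropy of the weights, which is positive.\<close>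

section \<open>Sequences and words\<close>

definition prepend :: "nat list \<Rightarrow> (nat \<Rightarrow> nat) \<Rightarrow> nat \<Rightarrow> nat" where
  "prepend w x = (\<lambda>k. if k < length w then w ! k else x (k - length w))"

abbreviation prefix :: "(nat \<Rightarrow> nat) \<Rightarrow> nat \<Rightarrow> nat list" where
  "prefix x n \<equiv> map x [0..<n]"

lemma funpow_shift: "(shift ^^ n) x = (\<lambda>k. x (k + n))"
  by (induction n) (auto simp: shift_def)

lemma shift_in_shift_space: "x \<in> shift_space d \<Longrightarrow> shift x \<in> shift_space d"
  by (auto simp: shift_space_def shift_def)

lemma funpow_shift_in_shift_space: "x \<in> shift_space d \<Longrightarrow> (shift ^^ n) x \<in> shift_space d"
  by (auto simp: shift_space_def funpow_shift)

lemma letter_in_alphabet: "x \<in> shift_space d \<Longrightarrow> x k \<in> alphabet d"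
  by (auto simp: shift_space_def)

lemma prepend_in_shift_space:
  "set w \<subseteq> alphabet d \<Longrightarrow> x \<in> shift_space d \<Longrightarrow> prepend w x \<in> shift_space d"
  by (auto simp: shift_space_def prepend_def)

lemma prepend_prefix: "prepend (prefix x n) ((shift ^^ n) x) = x"
  by (auto simp: prepend_def funpow_shift)

lemma prepend_hd: "prepend [x 0] (shift x) = x"
  using prepend_prefix[of x 1] by simp

lemma funpow_shift_prepend: "(shift ^^ length w) (prepend w x) = x"
  by (auto simp: prepend_def funpow_shift)

lemma shift_prepend_Cons: "shift (prepend (i # w) x) = prepend w x"
  by (auto simp: prepend_def shift_def)

lemma prepend_append: "prepend (u @ v) x = prepend u (prepend v x)"
  by (auto simp: prepend_def nth_append fun_eq_iff)

lemma prefix_prepend_append: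
  "prefix (prepend w x) (length w + n) = w @ prefix x n"
  by (rule nth_equalityI) (auto simp: prepend_def nth_append)

lemma prefix_prepend: "prefix (prepend w x) (length w) = w"
  using prefix_prepend_append[of w x 0] by simp

lemma prefix_append: "prefix x (n + m) = prefix x n @ prefix ((shift ^^ n) x) m"
  by (rule nth_equalityI) (auto simp: nth_append funpow_shift)

lemma set_prefix_subset: "x \<in> shift_space d \<Longrightarrow> set (prefix x n) \<subseteq> alphabet d"
  by (auto simp: shift_space_def)

lemma prefix_in_words: "x \<in> shift_space d \<Longrightarrow> prefix x n \<in> words d n"
  using set_prefix_subset by (simp add: words_def)

lemma prefix_eq_iff: "prefix x n = prefix y n \<longleftrightarrow> (\<forall>k<n. x k = y k)"
  by auto

lemma mem_cylinder_iff:
  "x \<in> cylinder d w \<longleftrightarrow> x \<in> shift_space d \<and> prefix x (length w) = w"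
  by (simp add: cylinder_def list_eq_iff_nth_eq[where xs = "map x [0..<length w]"])

lemma prepend_in_cylinder:
  "set w \<subseteq> alphabet d \<Longrightarrow> x \<in> shift_space d \<Longrightarrow> prepend w x \<in> cylinder d w"
  by (simp add: mem_cylinder_iff prepend_in_shift_space prefix_prepend)

lemma cylinder_Nil: "cylinder d [] = shift_space d"
  by (auto simp: cylinder_def)

lemma finite_words: "finite (words d n)"
  using finite_lists_length_eq[of "alphabet d" n]
  unfolding words_def by (rule rev_finite_subset) (auto simp: alphabet_def)

lemma finite_alphabet [simp]: "finite (alphabet d)"
  by (simp add: alphabet_def)

lemma const_in_shift_space: "i \<in> alphabet d \<Longrightarrow> (\<lambda>_. i) \<in> shift_space d"
  by (simp add: shift_space_def)

lemma first_difference: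
  fixes x y :: "nat \<Rightarrow> nat"
  assumes "x \<noteq> y"
  obtains n where "\<forall>k<n. x k = y k" "x n \<noteq> y n"
proof -
  define n where "n = (LEAST n. x n \<noteq> y n)"
  have "\<exists>n. x n \<noteq> y n" using assms by (simp add: fun_eq_iff)
  then have "x n \<noteq> y n" unfolding n_def by (rule LeastI_ex)
  moreover have "\<forall>k<n. x k = y k" unfolding n_def using not_less_Least by blast
  ultimately show ?thesis using that by blast
qed

lemma birkhoff_add:
  "birkhoff (n + m) f x = birkhoff n f x + birkhoff m f ((shift ^^ n) x)"
proof (induction m)
  case (Suc m)
  have "(shift ^^ (n + m)) x = (shift ^^ m) ((shift ^^ n) x)"
    by (metis add.commute comp_apply funpow_add)
  then show ?case using Suc by (simp add: birkhoff_def)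
qed (simp add: birkhoff_def)

lemma birkhoff_1: "birkhoff 1 f x = f x"
  by (simp add: birkhoff_def)

lemma birkhoff_Suc: "birkhoff (Suc n) f x = f x + birkhoff n f (shift x)"
  using birkhoff_add[of 1 n f x] by (simp add: birkhoff_def)

section \<open>The coding map\<close>

abbreviation code_dist :: "ifs \<Rightarrow> (nat \<Rightarrow> nat) \<Rightarrow> (nat \<Rightarrow> nat) \<Rightarrow> real" where
  "code_dist \<Phi> x y \<equiv> \<bar>coding \<Phi> x - coding \<Phi> y\<bar>"

abbreviation comparable :: "real \<Rightarrow> real \<Rightarrow> real \<Rightarrow> bool" where
  "comparable K a b \<equiv> a \<le> K * b \<and> b \<le> K * a"

locale cifs =
  fixes d :: nat and \<Phi> :: ifs
  assumes d2: "d \<ge> 2" and CS: "\<Phi> \<in> CS d"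
begin

abbreviation \<phi> :: "nat list \<Rightarrow> real \<Rightarrow> real" where "\<phi> w \<equiv> foldr (gens \<Phi>) w"

lemma one_two_in_alphabet: "1 \<in> alphabet d" "2 \<in> alphabet d"
  using d2 by (auto simp: alphabet_def)

lemma compact_base: "compact (base \<Phi>)" and connected_base: "connected (base \<Phi>)"
  and base_nonempty: "base \<Phi> \<noteq> {}"
  using CS by (auto simp: CS_def)

lemma gen_interior: "i \<in> alphabet d \<Longrightarrow> gens \<Phi> i ` base \<Phi> \<subseteq> interior (base \<Phi>)"
  and gen_inj: "i \<in> alphabet d \<Longrightarrow> inj_on (gens \<Phi> i) (base \<Phi>)"
  and gen_disjoint: "i \<in> alphabet d \<Longrightarrow> j \<in> alphabet d \<Longrightarrow> i \<noteq> j \<Longrightarrow>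
        gens \<Phi> i ` interior (base \<Phi>) \<inter> gens \<Phi> j ` interior (base \<Phi>) = {}"
proof -
  have *: "(\<forall>i\<in>alphabet d. gens \<Phi> i ` base \<Phi> \<subseteq> interior (base \<Phi>) \<and> inj_on (gens \<Phi> i) (base \<Phi>) \<and>
        (\<exists>c<1. c-lipschitz_on (base \<Phi>) (gens \<Phi> i))) \<and>
     (\<forall>i\<in>alphabet d. \<forall>j\<in>alphabet d. i \<noteq> j \<longrightarrow>
        gens \<Phi> i ` interior (base \<Phi>) \<inter> gens \<Phi> j ` interior (base \<Phi>) = {})"
    using CS unfolding CS_def mem_Collect_eq by (elim conjE) (intro conjI)
  show "i \<in> alphabet d \<Longrightarrow> gens \<Phi> i ` base \<Phi> \<subseteq> interior (base \<Phi>)"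
    "i \<in> alphabet d \<Longrightarrow> inj_on (gens \<Phi> i) (base \<Phi>)"
    using * by simp_all
  show "i \<in> alphabet d \<Longrightarrow> j \<in> alphabet d \<Longrightarrow> i \<noteq> j \<Longrightarrow>
        gens \<Phi> i ` interior (base \<Phi>) \<inter> gens \<Phi> j ` interior (base \<Phi>) = {}"
    using * by simp
qed

lemma convex_base: "convex (base \<Phi>)"
  using connected_base by (simp add: is_interval_convex is_interval_connected_1)

lemma contraction:
  obtains c where "0 < c" "c < 1" "\<forall>i\<in>alphabet d. c-lipschitz_on (base \<Phi>) (gens \<Phi> i)"
proof -
  have "\<forall>i\<in>alphabet d. \<exists>c<1. c-lipschitz_on (base \<Phi>) (gens \<Phi> i)"
    using CS unfolding CS_def by blast
  then obtain c where c: "\<forall>i\<in>alphabet d. c i < 1 \<and> (c i)-lipschitz_on (base \<Phi>) (gens \<Phi> i)"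
    by metis
  define m where "m = Max (insert (1/2) (c ` alphabet d))"
  have "m < 1" using c by (auto simp: m_def)
  moreover have "1/2 \<le> m" unfolding m_def by (rule Max_ge) auto
  moreover have "\<forall>i\<in>alphabet d. m-lipschitz_on (base \<Phi>) (gens \<Phi> i)"
  proof
    fix i assume i: "i \<in> alphabet d"
    have "c i \<le> m" using i by (auto simp: m_def)
    then show "m-lipschitz_on (base \<Phi>) (gens \<Phi> i)" using c i lipschitz_on_le by blast
  qed
  ultimately show ?thesis using that[of m] by auto
qed

lemma comp_base: "set w \<subseteq> alphabet d \<Longrightarrow> \<phi> w ` base \<Phi> \<subseteq> base \<Phi>"
proof (induction w)
  case (Cons i w)
  then have "gens \<Phi> i ` (\<phi> w ` base \<Phi>) \<subseteq> gens \<Phi> i ` base \<Phi>" by (intro image_mono) auto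
  then show ?case using gen_interior[of i] interior_subset[of "base \<Phi>"] Cons.prems
    by (auto simp: image_comp)
qed simp

lemma comp_lipschitz:
  assumes "\<forall>i\<in>alphabet d. c-lipschitz_on (base \<Phi>) (gens \<Phi> i)" "set w \<subseteq> alphabet d"
  shows "(c ^ length w)-lipschitz_on (base \<Phi>) (\<phi> w)"
  using assms(2)
proof (induction w)
  case Nil
  then show ?case using lipschitz_on_id[of "base \<Phi>"] by (simp add: id_def)
next
  case (Cons i w)
  have "c-lipschitz_on (\<phi> w ` base \<Phi>) (gens \<Phi> i)"
    by (rule lipschitz_on_subset[of _ "base \<Phi>"]) (use assms(1) Cons comp_base in auto)
  then show ?case using Cons lipschitz_on_compose[of "c ^ length w" "base \<Phi>" "\<phi> w" c "gens \<Phi> i"]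
    by auto
qed

lemma comp_inj: "set w \<subseteq> alphabet d \<Longrightarrow> inj_on (\<phi> w) (base \<Phi>)"
proof (induction w)
  case (Cons i w)
  have "inj_on (gens \<Phi> i) (\<phi> w ` base \<Phi>)"
    by (rule inj_on_subset[OF gen_inj[of i]]) (use comp_base[of w] Cons in auto)
  then show ?case using Cons comp_inj_on[of "\<phi> w" "base \<Phi>" "gens \<Phi> i"] by (simp add: comp_def)
qed simp

lemma comp_compact:
  assumes "set w \<subseteq> alphabet d"
  shows "compact (\<phi> w ` base \<Phi>)"
proof -
  obtain c where "\<forall>i\<in>alphabet d. c-lipschitz_on (base \<Phi>) (gens \<Phi> i)" using contraction .
  then show ?thesis
    using comp_lipschitz[OF _ assms] compact_base compact_continuous_image
      lipschitz_on_continuous_on by blast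
qed

lemma comp_append_subset:
  assumes "set v \<subseteq> alphabet d"
  shows "\<phi> (u @ v) ` base \<Phi> \<subseteq> \<phi> u ` base \<Phi>"
  using comp_base[OF assms] by auto

lemma prefix_images_decreasing:
  assumes "x \<in> shift_space d" "m \<le> n"
  shows "\<phi> (prefix x n) ` base \<Phi> \<subseteq> \<phi> (prefix x m) ` base \<Phi>"
proof -
  have "prefix x n = prefix x m @ prefix ((shift ^^ m) x) (n - m)"
    using prefix_append[of x m "n - m"] assms(2) by simp
  then show ?thesis
    using comp_append_subset[OF set_prefix_subset[OF funpow_shift_in_shift_space[OF assms(1)]]]
    by simp
qed

lemma prefix_image_dist:
  obtains c D where "0 < c" "c < 1" "0 < D"
    "\<And>x n p q. x \<in> shift_space d \<Longrightarrow> p \<in> \<phi> (prefix x n) ` base \<Phi> \<Longrightarrow>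
        q \<in> \<phi> (prefix x n) ` base \<Phi> \<Longrightarrow> dist p q \<le> D * c ^ n"
proof -
  obtain c where c: "0 < c" "c < 1" "\<forall>i\<in>alphabet d. c-lipschitz_on (base \<Phi>) (gens \<Phi> i)"
    using contraction .
  define D where "D = diameter (base \<Phi>) + 1"
  have D: "dist p q \<le> D" if "p \<in> base \<Phi>" "q \<in> base \<Phi>" for p q
    unfolding D_def using diameter_bounded_bound[OF compact_imp_bounded[OF compact_base] that] by simp
  have "0 < D" unfolding D_def using diameter_ge_0[OF compact_imp_bounded[OF compact_base]] by simp
  moreover have "dist p q \<le> D * c ^ n"
    if x: "x \<in> shift_space d" and pq: "p \<in> \<phi> (prefix x n) ` base \<Phi>"
      "q \<in> \<phi> (prefix x n) ` base \<Phi>" for x n p q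
  proof -
    obtain p' q' where p': "p' \<in> base \<Phi>" "p = \<phi> (prefix x n) p'" and q': "q' \<in> base \<Phi>"
      "q = \<phi> (prefix x n) q'" using pq by auto
    have "dist p q \<le> c ^ n * dist p' q'"
      using lipschitz_onD[OF comp_lipschitz[OF c(3) set_prefix_subset[OF x, of n]] p'(1) q'(1)]
        p' q' by simp
    also have "\<dots> \<le> c ^ n * D" using D p' q' c by (intro mult_left_mono) auto
    finally show ?thesis by (simp add: mult.commute)
  qed
  ultimately show ?thesis by (intro that[OF c(1,2)]) auto
qed

text \<open>The nested compact images shrink at a geometric rate, so their intersection is a point: the
  code \<open>x\<close> determines the value of \<^const>\<open>coding\<close>.\<close>

lemma prefix_images_singleton:
  assumes x: "x \<in> shift_space d"
  shows "\<exists>p. (\<Inter>n. \<phi> (prefix x n) ` base \<Phi>) = {p}"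
proof -
  define F where "F = (\<lambda>n. \<phi> (prefix x n) ` base \<Phi>)"
  have "\<Inter> (range F) \<noteq> {}"
    by (rule compact_nest)
      (use comp_compact set_prefix_subset[OF x] base_nonempty prefix_images_decreasing[OF x]
       in \<open>auto simp: F_def\<close>)
  then obtain p where p: "p \<in> \<Inter> (range F)" by blast
  obtain c D where c: "0 < c" "c < 1" and D: "\<And>x n p q. x \<in> shift_space d \<Longrightarrow>
      p \<in> \<phi> (prefix x n) ` base \<Phi> \<Longrightarrow> q \<in> \<phi> (prefix x n) ` base \<Phi> \<Longrightarrow> dist p q \<le> D * c ^ n"
    using prefix_image_dist by metis
  have "q = p" if q: "q \<in> \<Inter> (range F)" for q
  proof -
    have le: "dist p q \<le> D * c ^ n" for n using D[OF x, of p n q] p q by (auto simp: F_def)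
    have "(\<lambda>n. D * c ^ n) \<longlonglongrightarrow> D * 0" using c by (intro tendsto_intros) auto
    then have "dist p q \<le> D * 0" by (rule LIMSEQ_le_const) (use le in auto)
    then show ?thesis by simp
  qed
  then have "\<Inter> (range F) = {p}" using p by blast
  then show ?thesis unfolding F_def by blast
qed

lemma coding_singleton:
  assumes "x \<in> shift_space d"
  shows "(\<Inter>n. \<phi> (prefix x n) ` base \<Phi>) = {coding \<Phi> x}"
proof -
  obtain p where p: "(\<Inter>n. \<phi> (prefix x n) ` base \<Phi>) = {p}"
    using prefix_images_singleton[OF assms] by (elim exE)
  then show ?thesis by (simp only: coding_def the_elem_eq)
qed

lemma coding_in_image:
  assumes "x \<in> shift_space d"
  shows "coding \<Phi> x \<in> \<phi> (prefix x n) ` base \<Phi>"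
proof -
  have "coding \<Phi> x \<in> (\<Inter>n. \<phi> (prefix x n) ` base \<Phi>)"
    unfolding coding_singleton[OF assms] by (rule singletonI)
  then show ?thesis by (rule INT_D) (rule UNIV_I)
qed

lemma coding_eqI:
  assumes x: "x \<in> shift_space d" and p: "\<And>n. p \<in> \<phi> (prefix x (m + n)) ` base \<Phi>"
  shows "coding \<Phi> x = p"
proof -
  have "p \<in> \<phi> (prefix x n) ` base \<Phi>" for n
    by (rule subsetD[OF prefix_images_decreasing[OF x, of n "m + n"] p]) simp
  then have "p \<in> (\<Inter>n. \<phi> (prefix x n) ` base \<Phi>)" by (intro INT_I)
  then have "p \<in> {coding \<Phi> x}" unfolding coding_singleton[OF x] .
  then show ?thesis by simp
qed

lemma coding_in_base: "x \<in> shift_space d \<Longrightarrow> coding \<Phi> x \<in> base \<Phi>"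
  using coding_in_image[of x 0] by simp

lemma coding_prepend:
  assumes w: "set w \<subseteq> alphabet d" and x: "x \<in> shift_space d"
  shows "coding \<Phi> (prepend w x) = \<phi> w (coding \<Phi> x)"
proof (rule coding_eqI[OF prepend_in_shift_space[OF w x], of _ "length w"])
  fix n
  show "\<phi> w (coding \<Phi> x) \<in> \<phi> (prefix (prepend w x) (length w + n)) ` base \<Phi>"
    using coding_in_image[OF x, of n] unfolding prefix_prepend_append by auto
qed

lemma coding_split:
  assumes "x \<in> shift_space d"
  shows "coding \<Phi> x = \<phi> (prefix x n) (coding \<Phi> ((shift ^^ n) x))"
  using coding_prepend[OF set_prefix_subset[OF assms, of n] funpow_shift_in_shift_space[OF assms, of n]]
  by (simp add: prepend_prefix)

lemma coding_shift:
  assumes "x \<in> shift_space d"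
  shows "coding \<Phi> x = gens \<Phi> (x 0) (coding \<Phi> (shift x))"
  using coding_split[OF assms, of 1] by simp

lemma coding_in_interior:
  assumes "x \<in> shift_space d"
  shows "coding \<Phi> x \<in> interior (base \<Phi>)"
  using coding_shift[OF assms] gen_interior[OF letter_in_alphabet[OF assms]]
    coding_in_base[OF shift_in_shift_space[OF assms]] by auto

lemma coding_dist:
  obtains c D where "0 < c" "c < 1" "0 < D"
    "\<And>x y n. x \<in> shift_space d \<Longrightarrow> y \<in> shift_space d \<Longrightarrow> \<forall>k<n. x k = y k \<Longrightarrow>
       code_dist \<Phi> x y \<le> D * c ^ n"
proof -
  obtain c D where c: "0 < c" "c < 1" "0 < D" and D: "\<And>x n p q. x \<in> shift_space d \<Longrightarrow>
      p \<in> \<phi> (prefix x n) ` base \<Phi> \<Longrightarrow> q \<in> \<phi> (prefix x n) ` base \<Phi> \<Longrightarrow> dist p q \<le> D * c ^ n"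
    using prefix_image_dist by metis
  show ?thesis
  proof (rule that[OF c])
    fix x y n assume xy: "x \<in> shift_space d" "y \<in> shift_space d" "\<forall>k<n. x k = y k"
    then have "prefix x n = prefix y n" by (simp add: prefix_eq_iff)
    then show "code_dist \<Phi> x y \<le> D * c ^ n"
      using D[OF xy(1) coding_in_image[OF xy(1), of n], of "coding \<Phi> y"] coding_in_image[OF xy(2), of n]
      unfolding dist_real_def by metis
  qed
qed

text \<open>Only the images of the open interval are disjoint, so the images of \<open>base\<close> may touch. The
  second-level images \<open>\<phi>\<^sub>i(\<phi>\<^sub>j(X))\<close> lie in \<open>\<phi>\<^sub>i(Int X)\<close> and are compact, hence a positive distance
  apart for different \<open>i\<close>.\<close>

lemma coding_separation:
  obtains \<delta> where "0 < \<delta>"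
    "\<And>x y. x \<in> shift_space d \<Longrightarrow> y \<in> shift_space d \<Longrightarrow> x 0 \<noteq> y 0 \<Longrightarrow>
       \<delta> \<le> code_dist \<Phi> x y"
proof -
  define K where "K i = (\<Union>j\<in>alphabet d. \<phi> [i, j] ` base \<Phi>)" for i
  have comp: "compact (K i)" if "i \<in> alphabet d" for i
    unfolding K_def by (intro compact_UN comp_compact) (use that in auto)
  have sub: "K i \<subseteq> gens \<Phi> i ` interior (base \<Phi>)" for i
    unfolding K_def using gen_interior by (fastforce simp: image_def)
  have "\<exists>\<delta>>0. \<forall>p\<in>K i. \<forall>q\<in>K j. \<delta> \<le> dist p q"
    if "i \<in> alphabet d" "j \<in> alphabet d" "i \<noteq> j" for i j
    by (rule separate_compact_closed)
      (use comp[OF that(1)] compact_imp_closed[OF comp[OF that(2)]] sub[of i] sub[of j]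
        gen_disjoint[OF that] in auto)
  then obtain \<delta> where \<delta>: "\<And>i j. i \<in> alphabet d \<Longrightarrow> j \<in> alphabet d \<Longrightarrow> i \<noteq> j \<Longrightarrow>
      \<delta> i j > (0::real) \<and> (\<forall>p\<in>K i. \<forall>q\<in>K j. \<delta> i j \<le> dist p q)"
    by metis
  define I where "I = {(i, j). i \<in> alphabet d \<and> j \<in> alphabet d \<and> i \<noteq> j}"
  have finI: "finite I"
    by (rule finite_subset[of _ "alphabet d \<times> alphabet d"]) (auto simp: I_def)
  define m where "m = Min (insert 1 (case_prod \<delta> ` I))"
  have "m > 0" unfolding m_def using finI \<delta> by (subst Min_gr_iff) (auto simp: I_def)
  moreover have "m \<le> code_dist \<Phi> x y"
    if x: "x \<in> shift_space d" and y: "y \<in> shift_space d" and ne: "x 0 \<noteq> y 0" for x y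
  proof -
    have inK: "coding \<Phi> z \<in> K (z 0)" if "z \<in> shift_space d" for z
      using coding_in_image[OF that, of 2] letter_in_alphabet[OF that, of 1]
      unfolding K_def by (auto simp: numeral_2_eq_2)
    have mem: "(x 0, y 0) \<in> I" using x y ne letter_in_alphabet by (auto simp: I_def)
    then have "m \<le> \<delta> (x 0) (y 0)" unfolding m_def using finI by (intro Min_le) force+
    also have "\<dots> \<le> dist (coding \<Phi> x) (coding \<Phi> y)"
      using \<delta>[of "x 0" "y 0"] mem inK[OF x] inK[OF y] by (auto simp: I_def)
    finally show ?thesis by (simp add: dist_real_def)
  qed
  ultimately show ?thesis using that by blast
qed

lemma coding_inj: "inj_on (coding \<Phi>) (shift_space d)"
proof (rule inj_onI, rule ccontr)
  fix x y assume x: "x \<in> shift_space d" and y: "y \<in> shift_space d"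
    and eq: "coding \<Phi> x = coding \<Phi> y" and "x \<noteq> y"
  then obtain n where n: "\<forall>k<n. x k = y k" "x n \<noteq> y n" using first_difference by blast
  obtain \<delta> where \<delta>: "0 < \<delta>" "\<And>x y. x \<in> shift_space d \<Longrightarrow> y \<in> shift_space d \<Longrightarrow> x 0 \<noteq> y 0 \<Longrightarrow>
       \<delta> \<le> code_dist \<Phi> x y" using coding_separation by metis
  let ?x = "(shift ^^ n) x" and ?y = "(shift ^^ n) y"
  have x': "?x \<in> shift_space d" and y': "?y \<in> shift_space d"
    using x y funpow_shift_in_shift_space by auto
  have "prefix x n = prefix y n" using n by (simp add: prefix_eq_iff)
  then have "\<phi> (prefix x n) (coding \<Phi> ?x) = \<phi> (prefix x n) (coding \<Phi> ?y)"
    using coding_split[OF x, of n] coding_split[OF y, of n] eq by metis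
  then have "coding \<Phi> ?x = coding \<Phi> ?y"
    using inj_onD[OF comp_inj[OF set_prefix_subset[OF x, of n]], of "coding \<Phi> ?x" "coding \<Phi> ?y"]
      coding_in_base[OF x'] coding_in_base[OF y'] by simp
  moreover have "?x 0 \<noteq> ?y 0" using n by (simp add: funpow_shift)
  ultimately show False using \<delta>(2)[OF x' y'] \<delta>(1) by simp
qed

text \<open>A point of the limit set has exactly one first letter \<open>i\<close>, and its preimage under
  \<open>\<phi>\<^sub>i\<close> is again in the limit set. Iterating this produces the code of the point.\<close>

lemma limit_set_eq: "limit_set d \<Phi> = coding \<Phi> ` shift_space d"
proof
  show "coding \<Phi> ` shift_space d \<subseteq> limit_set d \<Phi>"
    unfolding limit_set_def
    by (intro image_subsetI INT_I UN_I) (erule prefix_in_words, erule coding_in_image)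
  let ?L = "limit_set d \<Phi>"
  have hd: "\<exists>v. set v \<subseteq> alphabet d \<and> length v = Suc n \<and> i \<in> alphabet d \<and> p \<in> gens \<Phi> i ` \<phi> v ` base \<Phi>
     \<and> \<phi> v ` base \<Phi> \<subseteq> interior (base \<Phi>)"
    if p: "p \<in> ?L" and i: "i \<in> alphabet d" "p \<in> gens \<Phi> i ` interior (base \<Phi>)" for p n i
  proof -
    obtain w where w: "w \<in> words d (Suc (Suc n))" "p \<in> \<phi> w ` base \<Phi>"
      using p unfolding limit_set_def by blast
    obtain j k v where wv: "w = j # k # v" using w(1) unfolding words_def
      by (auto simp: length_Suc_conv)
    have set: "set (k # v) \<subseteq> alphabet d" "j \<in> alphabet d" "length v = n"
      using w(1) wv by (auto simp: words_def)
    have int: "\<phi> (k # v) ` base \<Phi> \<subseteq> interior (base \<Phi>)"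
      using comp_base[of v] gen_interior[of k] set by (auto simp: image_subset_iff)
    have pj: "p \<in> gens \<Phi> j ` \<phi> (k # v) ` base \<Phi>" using w(2) wv by auto
    then have "p \<in> gens \<Phi> j ` interior (base \<Phi>)" using int by blast
    then have "j = i" using gen_disjoint[of i j] i set by auto
    then show ?thesis using pj int set by (intro exI[of _ "k # v"]) auto
  qed
  have step: "\<exists>i q. i \<in> alphabet d \<and> q \<in> ?L \<and> p = gens \<Phi> i q" if p: "p \<in> ?L" for p
  proof -
    obtain w where w: "w \<in> words d 2" "p \<in> \<phi> w ` base \<Phi>"
      using p unfolding limit_set_def by blast
    obtain i k where wv: "w = [i, k]" using w(1) unfolding words_def
      by (auto simp: length_Suc_conv numeral_2_eq_2)
    have i: "i \<in> alphabet d" and k: "k \<in> alphabet d" using w wv by (auto simp: words_def)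
    have pi: "p \<in> gens \<Phi> i ` interior (base \<Phi>)" using w(2) wv gen_interior[OF k] by auto
    then obtain q where q: "q \<in> interior (base \<Phi>)" "p = gens \<Phi> i q" by blast
    have qb: "q \<in> base \<Phi>" using q interior_subset by blast
    have "q \<in> (\<Union>w\<in>words d n. \<phi> w ` base \<Phi>)" for n
    proof (cases n)
      case 0
      then show ?thesis using qb by (auto simp: words_def)
    next
      case (Suc m)
      obtain v where v: "set v \<subseteq> alphabet d" "length v = Suc m" "p \<in> gens \<Phi> i ` \<phi> v ` base \<Phi>"
        using hd[OF p i pi] by blast
      then obtain q' where q': "q' \<in> \<phi> v ` base \<Phi>" "p = gens \<Phi> i q'" by blast
      then have "q' \<in> base \<Phi>" using comp_base[OF v(1)] by blast
      then have "q' = q" using inj_onD[OF gen_inj[OF i]] q' q qb by metis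
      then show ?thesis using q' v Suc by (auto simp: words_def)
    qed
    then have "q \<in> ?L" unfolding limit_set_def by blast
    then show ?thesis using i q by blast
  qed
  then obtain lett tail where lt: "\<And>p. p \<in> ?L \<Longrightarrow>
      lett p \<in> alphabet d \<and> tail p \<in> ?L \<and> p = gens \<Phi> (lett p) (tail p)"
    by metis
  show "?L \<subseteq> coding \<Phi> ` shift_space d"
  proof
    fix p assume p: "p \<in> ?L"
    define x where "x k = lett ((tail ^^ k) p)" for k
    have T: "(tail ^^ k) p \<in> ?L" for k by (induction k) (use p lt in auto)
    have x: "x \<in> shift_space d" using lt[OF T] by (auto simp: x_def shift_space_def)
    have eq: "p = \<phi> (prefix x n) ((tail ^^ n) p)" for n
    proof (induction n)
      case (Suc n)
      have "(tail ^^ n) p = gens \<Phi> (x n) ((tail ^^ Suc n) p)" using lt[OF T[of n]] by (simp add: x_def)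
      then show ?case using Suc by simp
    qed simp
    have "?L \<subseteq> (\<Union>w\<in>words d 0. \<phi> w ` base \<Phi>)" unfolding limit_set_def by blast
    then have "?L \<subseteq> base \<Phi>" by (simp add: words_def)
    then have "coding \<Phi> x = p"
      by (intro coding_eqI[OF x, of _ 0]) (use eq T in auto)
    then show "p \<in> coding \<Phi> ` shift_space d" using x by blast
  qed
qed

end

section \<open>Equivalence in terms of the coding maps\<close>

text \<open>A conjugacy that respects the indices is forced to match points with the same code.\<close>

lemma equivalent_iff_coding_bilipschitz:
  assumes "d \<ge> 2" "\<Phi> \<in> CS d" "\<Psi> \<in> CS d"
  shows "equivalent d \<Phi> \<Psi> \<longleftrightarrow>
    (\<exists>L>0. \<forall>x\<in>shift_space d. \<forall>y\<in>shift_space d.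
       comparable L (code_dist \<Psi> x y) (code_dist \<Phi> x y))"
    (is "_ \<longleftrightarrow> ?R")
proof
  interpret P: cifs d \<Phi> using assms by unfold_locales auto
  interpret Q: cifs d \<Psi> using assms by unfold_locales auto
  let ?S = "shift_space d" and ?A = "limit_set d \<Phi>" and ?B = "limit_set d \<Psi>"
  {
    assume "equivalent d \<Phi> \<Psi>"
    then obtain h L1 L2 where h: "bij_betw h ?A ?B"
      and L1: "L1-lipschitz_on ?A h" and L2: "L2-lipschitz_on ?B (inv_into ?A h)"
      and conj: "\<And>i y. i \<in> alphabet d \<Longrightarrow> y \<in> ?B \<Longrightarrow> gens \<Psi> i y = h (gens \<Phi> i (inv_into ?A h y))"
      unfolding equivalent_def by blast
    have conj': "gens \<Psi> i (h p) = h (gens \<Phi> i p)" if "i \<in> alphabet d" "p \<in> ?A" for i p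
    proof -
      have "inv_into ?A h (h p) = p"
        using h that(2) by (simp add: bij_betw_def)
      then show ?thesis using conj[OF that(1), of "h p"] h that(2) by (auto simp: bij_betw_def)
    qed
    have hw: "h (P.\<phi> w (coding \<Phi> x)) = Q.\<phi> w (h (coding \<Phi> x))"
      if "set w \<subseteq> alphabet d" "x \<in> ?S" for w x
      using that(1)
    proof (induction w)
      case (Cons i w)
      have "P.\<phi> w (coding \<Phi> x) \<in> ?A"
        using P.coding_prepend[of w x] prepend_in_shift_space[of w d x] Cons that(2)
        unfolding P.limit_set_eq by (metis imageI insert_subset list.simps(15))
      then show ?case using conj'[of i "P.\<phi> w (coding \<Phi> x)"] Cons by simp
    qed simp
    have hc: "h (coding \<Phi> x) = coding \<Psi> x" if x: "x \<in> ?S" for x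
    proof (rule Q.coding_eqI[OF x, of _ 0, symmetric])
      fix n
      let ?y = "(shift ^^ n) x"
      have y: "?y \<in> ?S" using funpow_shift_in_shift_space[OF x] .
      have "coding \<Phi> ?y \<in> ?A" using y unfolding P.limit_set_eq by blast
      then have "h (coding \<Phi> ?y) \<in> ?B" using h by (auto simp: bij_betw_def)
      then have "h (coding \<Phi> ?y) \<in> base \<Psi>" unfolding Q.limit_set_eq using Q.coding_in_base by (elim imageE) simp
      moreover have "h (coding \<Phi> x) = Q.\<phi> (prefix x n) (h (coding \<Phi> ?y))"
        using hw[OF set_prefix_subset[OF x] y, of n] P.coding_split[OF x, of n] by simp
      ultimately show "h (coding \<Phi> x) \<in> Q.\<phi> (prefix x (0 + n)) ` base \<Psi>" by simp
    qed
    have hi: "inv_into ?A h (coding \<Psi> x) = coding \<Phi> x" if "x \<in> ?S" for x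
    proof -
      have "coding \<Phi> x \<in> ?A" using that unfolding P.limit_set_eq by blast
      then show ?thesis using hc[OF that] h by (metis bij_betw_def inv_into_f_f)
    qed
    define L where "L = max 1 (max L1 L2)"
    show ?R
    proof (intro exI[of _ L] conjI ballI)
      show "L > 0" by (auto simp: L_def)
      fix x y assume x: "x \<in> ?S" and y: "y \<in> ?S"
      have A: "coding \<Phi> x \<in> ?A" "coding \<Phi> y \<in> ?A" using x y unfolding P.limit_set_eq by auto
      have B: "coding \<Psi> x \<in> ?B" "coding \<Psi> y \<in> ?B" using x y unfolding Q.limit_set_eq by auto
      have "code_dist \<Psi> x y \<le> L1 * code_dist \<Phi> x y"
        using lipschitz_onD[OF L1 A] hc[OF x] hc[OF y] by (simp add: dist_real_def)
      also have "\<dots> \<le> L * code_dist \<Phi> x y" by (intro mult_right_mono) (auto simp: L_def)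
      finally show "code_dist \<Psi> x y \<le> L * code_dist \<Phi> x y" .
      have "code_dist \<Phi> x y \<le> L2 * code_dist \<Psi> x y"
        using lipschitz_onD[OF L2 B] hi[OF x] hi[OF y] by (simp add: dist_real_def)
      also have "\<dots> \<le> L * code_dist \<Psi> x y" by (intro mult_right_mono) (auto simp: L_def)
      finally show "code_dist \<Phi> x y \<le> L * code_dist \<Psi> x y" .
    qed
  }
  {
    assume ?R
    then obtain L where L: "L > 0" and
      L1: "\<And>x y. x \<in> ?S \<Longrightarrow> y \<in> ?S \<Longrightarrow> code_dist \<Psi> x y \<le> L * code_dist \<Phi> x y" and
      L2: "\<And>x y. x \<in> ?S \<Longrightarrow> y \<in> ?S \<Longrightarrow> code_dist \<Phi> x y \<le> L * code_dist \<Psi> x y"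
      by blast
    define h where "h p = coding \<Psi> (inv_into ?S (coding \<Phi>) p)" for p
    have hc: "h (coding \<Phi> x) = coding \<Psi> x" if "x \<in> ?S" for x
      unfolding h_def using that P.coding_inj by simp
    have bij: "bij_betw h ?A ?B"
      unfolding bij_betw_def
    proof
      show "inj_on h ?A" unfolding P.limit_set_eq
        using hc Q.coding_inj by (auto simp: inj_on_def)
      show "h ` ?A = ?B" unfolding P.limit_set_eq Q.limit_set_eq using hc by force
    qed
    have hi: "inv_into ?A h (coding \<Psi> x) = coding \<Phi> x" if "x \<in> ?S" for x
    proof -
      have "coding \<Phi> x \<in> ?A" using that unfolding P.limit_set_eq by blast
      then show ?thesis using hc[OF that] bij by (metis bij_betw_def inv_into_f_f)
    qed
    show "equivalent d \<Phi> \<Psi>"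
      unfolding equivalent_def
    proof (intro exI[of _ h] conjI ballI)
      show "bij_betw h ?A ?B" by fact
      show "\<exists>L. L-lipschitz_on ?A h"
        by (rule exI[of _ L], rule lipschitz_onI)
          (use L L1 hc in \<open>auto simp: P.limit_set_eq dist_real_def\<close>)
      show "\<exists>L. L-lipschitz_on ?B (inv_into ?A h)"
        by (rule exI[of _ L], rule lipschitz_onI)
          (use L L2 hi in \<open>auto simp: Q.limit_set_eq dist_real_def\<close>)
      fix i y assume i: "i \<in> alphabet d" and "y \<in> ?B"
      then obtain x where x: "x \<in> ?S" "y = coding \<Psi> x" unfolding Q.limit_set_eq by blast
      have p: "prepend [i] x \<in> ?S" using i x prepend_in_shift_space[of "[i]"] by simp
      show "gens \<Psi> i y = h (gens \<Phi> i (inv_into ?A h y))"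
        using hc[OF p] hi[OF x(1)] x P.coding_prepend[of "[i]" x] Q.coding_prepend[of "[i]" x] i
        by simp
    qed
  }
qed

section \<open>Distortion\<close>

text \<open>The relation holds with \<open>S\<close> given by the Birkhoff sums of the geometric potential and, for essentially affine
  systems, for the logarithms of products of affine ratios; comparing both with the same distance
  relates them to each other.\<close>

definition controls_distances ::
  "nat \<Rightarrow> ifs \<Rightarrow> real \<Rightarrow> (nat \<Rightarrow> (nat \<Rightarrow> nat) \<Rightarrow> real) \<Rightarrow> bool" where
  "controls_distances d \<Phi> K S \<longleftrightarrow> K > 0 \<and>
     (\<forall>x\<in>shift_space d. \<forall>y\<in>shift_space d. \<forall>n. (\<forall>k<n. x k = y k) \<longrightarrow> x n \<noteq> y n \<longrightarrow>
        comparable K (exp (S n x)) (code_dist \<Phi> x y))"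

lemma controls_distancesI:
  assumes "K > 0" "\<And>x y n. x \<in> shift_space d \<Longrightarrow> y \<in> shift_space d \<Longrightarrow> \<forall>k<n. x k = y k \<Longrightarrow>
    x n \<noteq> y n \<Longrightarrow> comparable K (exp (S n x)) (code_dist \<Phi> x y)"
  shows "controls_distances d \<Phi> K S"
  using assms unfolding controls_distances_def by blast

lemma controls_distancesD:
  assumes "controls_distances d \<Phi> K S"
  shows "K > 0" "\<And>x y n. x \<in> shift_space d \<Longrightarrow> y \<in> shift_space d \<Longrightarrow> \<forall>k<n. x k = y k \<Longrightarrow>
    x n \<noteq> y n \<Longrightarrow> comparable K (exp (S n x)) (code_dist \<Phi> x y)"
  using assms unfolding controls_distances_def by blast+

text \<open>The limit of the real difference quotients is real, so the modulus of the complex derivative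
  is the absolute value of the real one.\<close>

lemma real_restriction_derivative:
  assumes D: "(f has_field_derivative D) (at (complex_of_real x))"
    and S: "open S" "x \<in> S" "\<And>t. t \<in> S \<Longrightarrow> f (complex_of_real t) = complex_of_real (g t)"
  shows "(g has_real_derivative Re D) (at x)" "\<bar>Re D\<bar> = cmod D"
proof -
  have "((\<lambda>t. f (complex_of_real t)) has_vector_derivative D) (at x)"
    using D by (rule has_vector_derivative_real_field)
  then have v: "((\<lambda>t. complex_of_real (g t)) has_vector_derivative D) (at x)"
    by (rule has_vector_derivative_transform_within_open) (use S in auto)
  from bounded_linear.has_vector_derivative[OF bounded_linear_Re v]
  show "(g has_real_derivative Re D) (at x)"
    by (simp add: has_real_derivative_iff_has_vector_derivative)
  from bounded_linear.has_vector_derivative[OF bounded_linear_Im v]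
  have "((\<lambda>t. 0) has_vector_derivative Im D) (at x)" by simp
  then have "Im D = 0"
    using vector_derivative_unique_at has_vector_derivative_const by metis
  then show "\<bar>Re D\<bar> = cmod D" by (simp add: cmod_eq_Re)
qed

locale conformal_cifs = cifs +
  fixes U :: "complex set" and F :: "nat \<Rightarrow> complex \<Rightarrow> complex"
  assumes ext: "conformal_extension d \<Phi> U F"
begin

abbreviation fF :: "nat list \<Rightarrow> complex \<Rightarrow> complex" where "fF w \<equiv> foldr F w"

lemma open_U: "open U" and base_in_U: "x \<in> base \<Phi> \<Longrightarrow> complex_of_real x \<in> U"
  and F_holo: "i \<in> alphabet d \<Longrightarrow> F i holomorphic_on U"
  and F_deriv_nz: "i \<in> alphabet d \<Longrightarrow> z \<in> U \<Longrightarrow> deriv (F i) z \<noteq> 0"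
  and F_in_U: "i \<in> alphabet d \<Longrightarrow> z \<in> U \<Longrightarrow> F i z \<in> U"
  and F_real: "i \<in> alphabet d \<Longrightarrow> x \<in> base \<Phi> \<Longrightarrow> F i (complex_of_real x) = complex_of_real (gens \<Phi> i x)"
  using ext by (auto simp: conformal_extension_def image_subset_iff)

lemma F_has_derivative:
  "i \<in> alphabet d \<Longrightarrow> z \<in> U \<Longrightarrow> (F i has_field_derivative deriv (F i) z) (at z)"
  by (rule holomorphic_derivI[OF F_holo open_U])

lemma fF_in_U: "set w \<subseteq> alphabet d \<Longrightarrow> z \<in> U \<Longrightarrow> fF w z \<in> U"
  by (induction w) (auto intro: F_in_U)

lemma fF_real:
  "set w \<subseteq> alphabet d \<Longrightarrow> x \<in> base \<Phi> \<Longrightarrow> fF w (complex_of_real x) = complex_of_real (\<phi> w x)"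
proof (induction w)
  case (Cons i w)
  then have "\<phi> w x \<in> base \<Phi>" using comp_base[of w] by auto
  then show ?case using Cons F_real by simp
qed simp

lemma fF_chain:
  assumes "set w \<subseteq> alphabet d" "z \<in> U"
  shows "(fF w has_field_derivative deriv (fF w) z) (at z)"
    and "i \<in> alphabet d \<Longrightarrow> deriv (fF (i # w)) z = deriv (F i) (fF w z) * deriv (fF w) z"
    and "deriv (fF w) z \<noteq> 0"
proof -
  have step: "(fF (i # w) has_field_derivative deriv (F i) (fF w z) * deriv (fF w) z) (at z)"
    if "set w \<subseteq> alphabet d" "i \<in> alphabet d"
      "(fF w has_field_derivative deriv (fF w) z) (at z)" for i w
    using DERIV_chain[OF F_has_derivative[OF that(2) fF_in_U[OF that(1) assms(2)]] that(3)]
    by (simp add: comp_def)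
  have *: "(fF w has_field_derivative deriv (fF w) z) (at z)" if "set w \<subseteq> alphabet d" for w
    using that
  proof (induction w)
    case Nil
    have "((\<lambda>x. x) has_field_derivative 1) (at z)" by (rule DERIV_ident)
    then show ?case by (simp add: DERIV_imp_deriv[OF DERIV_ident] id_def)
  next
    case (Cons i w)
    then have "(fF (i # w) has_field_derivative deriv (F i) (fF w z) * deriv (fF w) z) (at z)"
      by (intro step) auto
    then show ?case using DERIV_imp_deriv by metis
  qed
  show "(fF w has_field_derivative deriv (fF w) z) (at z)" using *[OF assms(1)] .
  show "deriv (fF (i # w)) z = deriv (F i) (fF w z) * deriv (fF w) z" if "i \<in> alphabet d"
    by (rule DERIV_imp_deriv[OF step[OF assms(1) that *[OF assms(1)]]])
  show "deriv (fF w) z \<noteq> 0" using assms(1)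
  proof (induction w)
    case Nil
    then show ?case by (simp add: DERIV_imp_deriv[OF DERIV_ident] id_def)
  next
    case (Cons i w)
    then have "deriv (fF (i # w)) z = deriv (F i) (fF w z) * deriv (fF w) z"
      by (intro DERIV_imp_deriv[OF step] *) auto
    moreover have "deriv (F i) (fF w z) \<noteq> 0"
      by (rule F_deriv_nz) (use Cons.prems fF_in_U[of w z] assms(2) in auto)
    moreover have "deriv (fF w) z \<noteq> 0" using Cons by simp
    ultimately show ?case by (metis mult_eq_0_iff)
  qed
qed

lemma comp_has_real_derivative:
  assumes "set w \<subseteq> alphabet d" "x \<in> interior (base \<Phi>)"
  shows "(\<phi> w has_real_derivative Re (deriv (fF w) (complex_of_real x))) (at x)"
    and "\<bar>Re (deriv (fF w) (complex_of_real x))\<bar> = cmod (deriv (fF w) (complex_of_real x))"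
proof -
  have U: "complex_of_real x \<in> U" using assms(2) interior_subset base_in_U by blast
  note * = real_restriction_derivative[OF fF_chain(1)[OF assms(1) U] open_interior assms(2)
      fF_real[OF assms(1)]]
  show "(\<phi> w has_real_derivative Re (deriv (fF w) (complex_of_real x))) (at x)"
    "\<bar>Re (deriv (fF w) (complex_of_real x))\<bar> = cmod (deriv (fF w) (complex_of_real x))"
    using * interior_subset by blast+
qed

lemma geom_potential_eq:
  assumes "x \<in> shift_space d"
  shows "geom_potential \<Phi> x = ln (cmod (deriv (F (x 0)) (complex_of_real (coding \<Phi> (shift x)))))"
proof -
  have i: "set [x 0] \<subseteq> alphabet d" using letter_in_alphabet[OF assms] by simp
  note * = comp_has_real_derivative[OF i coding_in_interior[OF shift_in_shift_space[OF assms]]]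
  have "\<phi> [x 0] = gens \<Phi> (x 0)" "fF [x 0] = F (x 0)" by auto
  then show ?thesis using DERIV_imp_deriv[OF *(1)] *(2) unfolding geom_potential_def by simp
qed

text \<open>The chain rule along the orbit: each factor of the derivative of a composed branch is evaluated
  at the coding point of the corresponding shift of \<open>x\<close>.\<close>

lemma birkhoff_geom_potential:
  assumes "x \<in> shift_space d"
  shows "exp (birkhoff n (geom_potential \<Phi>) x) =
    cmod (deriv (fF (prefix x n)) (complex_of_real (coding \<Phi> ((shift ^^ n) x))))"
  using assms
proof (induction n arbitrary: x)
  case 0
  then show ?case by (simp add: birkhoff_def DERIV_imp_deriv[OF DERIV_ident] id_def)
next
  case (Suc n)
  let ?v = "prefix (shift x) n"
  have sx: "shift x \<in> shift_space d" using shift_in_shift_space[OF Suc.prems] .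
  have pre: "prefix x (Suc n) = x 0 # ?v"
    using prefix_append[of x 1 n] by simp
  have sh: "(shift ^^ Suc n) x = (shift ^^ n) (shift x)" by (simp add: funpow_swap1)
  let ?p = "coding \<Phi> ((shift ^^ n) (shift x))"
  have pb: "?p \<in> base \<Phi>" using coding_in_base[OF funpow_shift_in_shift_space[OF sx]] .
  have v: "set ?v \<subseteq> alphabet d" using set_prefix_subset[OF sx] .
  have i: "x 0 \<in> alphabet d" using letter_in_alphabet[OF Suc.prems] .
  have "fF ?v (complex_of_real ?p) = complex_of_real (coding \<Phi> (shift x))"
    using fF_real[OF v pb] coding_split[OF sx, of n] by simp
  then have "deriv (fF (prefix x (Suc n))) (complex_of_real ?p) =
      deriv (F (x 0)) (complex_of_real (coding \<Phi> (shift x))) * deriv (fF ?v) (complex_of_real ?p)"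
    unfolding pre using fF_chain(2)[OF v base_in_U[OF pb] i] by simp
  moreover have "deriv (F (x 0)) (complex_of_real (coding \<Phi> (shift x))) \<noteq> 0"
    using F_deriv_nz[OF i base_in_U[OF coding_in_base[OF sx]]] .
  ultimately show ?case
    unfolding sh birkhoff_Suc exp_add geom_potential_eq[OF Suc.prems] Suc.IH[OF sx]
    by (metis norm_mult exp_ln zero_less_norm_iff)
qed

lemma comp_distortion:
  assumes C: "\<And>w x y. set w \<subseteq> alphabet d \<Longrightarrow> x \<in> U \<Longrightarrow> y \<in> U \<Longrightarrow>
        cmod (deriv (fF w) y) \<le> C * cmod (deriv (fF w) x)"
    and w: "set w \<subseteq> alphabet d" and z: "z \<in> U"
    and pq: "p \<in> interior (base \<Phi>)" "q \<in> interior (base \<Phi>)"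
  shows "\<bar>\<phi> w p - \<phi> w q\<bar> \<le> C * cmod (deriv (fF w) z) * \<bar>p - q\<bar>"
    and "cmod (deriv (fF w) z) * \<bar>p - q\<bar> \<le> C * \<bar>\<phi> w p - \<phi> w q\<bar>"
proof -
  have *: "\<bar>\<phi> w p - \<phi> w q\<bar> \<le> C * cmod (deriv (fF w) z) * \<bar>p - q\<bar> \<and>
      cmod (deriv (fF w) z) * \<bar>p - q\<bar> \<le> C * \<bar>\<phi> w p - \<phi> w q\<bar>"
    if pq: "p \<in> interior (base \<Phi>)" "q \<in> interior (base \<Phi>)" "p < q" for p q
  proof -
    have int: "x \<in> interior (base \<Phi>)" if "p \<le> x" "x \<le> q" for x
      using convex_interior[OF convex_base] pq that
      by (metis is_interval_convex_1 mem_is_interval_1_I)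
    obtain t where t: "p < t" "t < q"
      "\<phi> w q - \<phi> w p = (q - p) * Re (deriv (fF w) (complex_of_real t))"
      using MVT2[OF pq(3), of "\<phi> w" "\<lambda>x. Re (deriv (fF w) (complex_of_real x))"]
        comp_has_real_derivative(1)[OF w int] by blast
    have ti: "t \<in> interior (base \<Phi>)" using int t by simp
    have tU: "complex_of_real t \<in> U" using ti interior_subset base_in_U by blast
    have eq: "\<bar>\<phi> w p - \<phi> w q\<bar> = \<bar>p - q\<bar> * cmod (deriv (fF w) (complex_of_real t))"
      using t(3) comp_has_real_derivative(2)[OF w ti] by (metis abs_minus_commute abs_mult)
    have "\<bar>p - q\<bar> * cmod (deriv (fF w) (complex_of_real t)) \<le> \<bar>p - q\<bar> * (C * cmod (deriv (fF w) z))"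
      by (intro mult_left_mono C[OF w z tU]) auto
    moreover have "\<bar>p - q\<bar> * cmod (deriv (fF w) z) \<le> \<bar>p - q\<bar> * (C * cmod (deriv (fF w) (complex_of_real t)))"
      by (intro mult_left_mono C[OF w tU z]) auto
    ultimately show ?thesis unfolding eq by (simp add: mult_ac)
  qed
  have "\<bar>\<phi> w p - \<phi> w q\<bar> \<le> C * cmod (deriv (fF w) z) * \<bar>p - q\<bar> \<and>
      cmod (deriv (fF w) z) * \<bar>p - q\<bar> \<le> C * \<bar>\<phi> w p - \<phi> w q\<bar>"
  proof (cases p q rule: linorder_cases)
    case less
    then show ?thesis using *[OF pq] by simp
  next
    case greater
    then show ?thesis using *[OF pq(2,1)] by (simp add: abs_minus_commute)
  qed simp
  then show "\<bar>\<phi> w p - \<phi> w q\<bar> \<le> C * cmod (deriv (fF w) z) * \<bar>p - q\<bar>"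
    "cmod (deriv (fF w) z) * \<bar>p - q\<bar> \<le> C * \<bar>\<phi> w p - \<phi> w q\<bar>" by auto
qed

lemma ln_derivative_lipschitz:
  assumes i: "i \<in> alphabet d"
  obtains L where "0 < L" "\<And>p q. p \<in> base \<Phi> \<Longrightarrow> q \<in> base \<Phi> \<Longrightarrow>
    \<bar>ln (cmod (deriv (F i) (complex_of_real p))) - ln (cmod (deriv (F i) (complex_of_real q)))\<bar>
      \<le> L * \<bar>p - q\<bar>"
proof -
  let ?G = "deriv (F i)" and ?B = "complex_of_real ` base \<Phi>"
  have BU: "?B \<subseteq> U" using base_in_U by blast
  have cB: "compact ?B" by (intro compact_continuous_image compact_base continuous_intros)
  have vB: "convex ?B" by (intro convex_linear_image convex_base) (simp add: linear_of_real)
  have G: "?G holomorphic_on U" by (rule holomorphic_deriv[OF F_holo[OF i] open_U])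
  have "continuous_on ?B (deriv ?G)"
    using holomorphic_on_imp_continuous_on[OF holomorphic_deriv[OF G open_U]] BU continuous_on_subset
    by blast
  then have "bounded (deriv ?G ` ?B)" by (intro compact_imp_bounded compact_continuous_image cB)
  then obtain B where B: "B > 0" "\<And>z. z \<in> ?B \<Longrightarrow> cmod (deriv ?G z) \<le> B"
    unfolding bounded_pos by auto
  have Gd: "(?G has_field_derivative deriv ?G z) (at z within ?B)" if "z \<in> ?B" for z
    by (rule has_field_derivative_at_within[OF holomorphic_derivI[OF G open_U]]) (use that BU in blast)
  have Glip: "cmod (?G p - ?G q) \<le> B * cmod (p - q)" if "p \<in> ?B" "q \<in> ?B" for p q
    by (rule field_differentiable_bound[OF vB Gd B(2)]) (use that in auto)
  have "continuous_on ?B (\<lambda>z. cmod (?G z))"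
    by (intro continuous_on_norm continuous_on_subset[OF holomorphic_on_imp_continuous_on[OF G] BU])
  then obtain z0 where z0: "z0 \<in> ?B" "\<And>z. z \<in> ?B \<Longrightarrow> cmod (?G z0) \<le> cmod (?G z)"
    using continuous_attains_inf[OF cB] base_nonempty by blast
  define m where "m = cmod (?G z0)"
  have m: "m > 0" unfolding m_def using F_deriv_nz[OF i] z0 BU by auto
  have lnle: "ln (cmod (?G p)) - ln (cmod (?G q)) \<le> B / m * cmod (p - q)"
    if "p \<in> ?B" "q \<in> ?B" for p q
  proof -
    have pos: "m \<le> cmod (?G p)" "m \<le> cmod (?G q)" unfolding m_def using z0 that by auto
    have "ln (cmod (?G p)) - ln (cmod (?G q)) \<le> (cmod (?G p) - cmod (?G q)) / cmod (?G q)"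
      using pos m by (intro ln_diff_le) auto
    also have "\<dots> \<le> \<bar>cmod (?G p) - cmod (?G q)\<bar> / m"
      using pos m by (intro frac_le) auto
    also have "\<dots> \<le> (B * cmod (p - q)) / m"
      using Glip[OF that] norm_triangle_ineq3[of "?G p" "?G q"] m
      by (intro divide_right_mono) auto
    finally show ?thesis by simp
  qed
  show ?thesis
  proof (rule that[of "B / m"])
    show "B / m > 0" using B m by simp
    fix p q assume pq: "p \<in> base \<Phi>" "q \<in> base \<Phi>"
    have "cmod (complex_of_real p - complex_of_real q) = \<bar>p - q\<bar>"
      by (metis norm_of_real of_real_diff)
    then show "\<bar>ln (cmod (?G (complex_of_real p))) - ln (cmod (?G (complex_of_real q)))\<bar>
      \<le> B / m * \<bar>p - q\<bar>"
      using lnle[of "complex_of_real p" "complex_of_real q"]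
        lnle[of "complex_of_real q" "complex_of_real p"] pq
      by (auto simp: abs_le_iff norm_minus_commute)
  qed
qed

end

context cifs
begin

lemma conformal_extension_obtains:
  obtains U F C where "conformal_cifs d \<Phi> U F" "C \<ge> 1"
    "\<And>w x y. set w \<subseteq> alphabet d \<Longrightarrow> x \<in> U \<Longrightarrow> y \<in> U \<Longrightarrow>
        cmod (deriv (foldr F w) y) \<le> C * cmod (deriv (foldr F w) x)"
proof -
  obtain U F where UF: "conformal_extension d \<Phi> U F" "bounded_distortion d U F"
    using CS unfolding CS_def mem_Collect_eq by (elim conjE exE)
  then obtain C where C: "C \<ge> 1" "\<And>n w x y. w \<in> words d n \<Longrightarrow> x \<in> U \<Longrightarrow> y \<in> U \<Longrightarrow>
      cmod (deriv (foldr F w) y) \<le> C * cmod (deriv (foldr F w) x)"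
    unfolding bounded_distortion_def by blast
  show ?thesis
    by (rule that[of U F C])
      (use UF(1) C in \<open>auto simp: conformal_cifs_def conformal_cifs_axioms_def words_def cifs_axioms\<close>)
qed

text \<open>Bounded distortion and the mean value theorem compare \<open>|\<phi>\<^sub>\<omega>(p) - \<phi>\<^sub>\<omega>(q)|\<close> with
  \<open>|\<phi>\<^sub>\<omega>'| |p - q|\<close>; if the codes of \<open>p\<close> and \<open>q\<close> differ in the first letter, \<open>|p - q|\<close> is bounded
  above and below. So the distance of two points of the limit set is governed by the Birkhoff sum
  over their common prefix.\<close>

lemma coding_dist_birkhoff:
  obtains K where "controls_distances d \<Phi> K (\<lambda>n. birkhoff n (geom_potential \<Phi>))"
proof -
  obtain U F C where UF: "conformal_cifs d \<Phi> U F" and C: "C \<ge> 1"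
    "\<And>w x y. set w \<subseteq> alphabet d \<Longrightarrow> x \<in> U \<Longrightarrow> y \<in> U \<Longrightarrow>
        cmod (deriv (foldr F w) y) \<le> C * cmod (deriv (foldr F w) x)"
    using conformal_extension_obtains by metis
  interpret conformal_cifs d \<Phi> U F by fact
  obtain \<delta> where \<delta>: "0 < \<delta>" "\<And>x y. x \<in> shift_space d \<Longrightarrow> y \<in> shift_space d \<Longrightarrow> x 0 \<noteq> y 0 \<Longrightarrow>
       \<delta> \<le> code_dist \<Phi> x y" using coding_separation by metis
  obtain c D where D: "0 < D" "\<And>x y n. x \<in> shift_space d \<Longrightarrow> y \<in> shift_space d \<Longrightarrow>
      \<forall>k<n. x k = y k \<Longrightarrow> code_dist \<Phi> x y \<le> D * c ^ n"
    using coding_dist by metis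
  define K where "K = C / \<delta> + C * D"
  show ?thesis
  proof (rule that[OF controls_distancesI[of K]])
    show "K > 0" unfolding K_def using C(1) \<delta>(1) D(1) by (intro add_pos_pos) auto
    fix x y n assume x: "x \<in> shift_space d" and y: "y \<in> shift_space d"
      and n: "\<forall>k<n. x k = y k" "x n \<noteq> y n"
    let ?w = "prefix x n" and ?x = "(shift ^^ n) x" and ?y = "(shift ^^ n) y"
    have w: "set ?w \<subseteq> alphabet d" and x': "?x \<in> shift_space d" and y': "?y \<in> shift_space d"
      using set_prefix_subset[OF x] funpow_shift_in_shift_space x y by auto
    let ?z = "complex_of_real (coding \<Phi> ?x)"
    let ?E = "exp (birkhoff n (geom_potential \<Phi>) x)"
    have "prefix x n = prefix y n" using n by (simp add: prefix_eq_iff)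
    then have eq: "coding \<Phi> x - coding \<Phi> y = \<phi> ?w (coding \<Phi> ?x) - \<phi> ?w (coding \<Phi> ?y)"
      using coding_split[OF x, of n] coding_split[OF y, of n] by metis
    have lower: "\<delta> \<le> code_dist \<Phi> ?x ?y"
      by (rule \<delta>(2)[OF x' y']) (use n in \<open>simp add: funpow_shift\<close>)
    have upper: "code_dist \<Phi> ?x ?y \<le> D"
      using D(2)[OF x' y', of 0] by simp
    note dist = comp_distortion[OF C(2) w base_in_U[OF coding_in_base[OF x']]
        coding_in_interior[OF x'] coding_in_interior[OF y'],
        folded birkhoff_geom_potential[OF x] eq]
    have pos: "0 \<le> code_dist \<Phi> x y" by simp
    have "?E * \<delta> \<le> ?E * code_dist \<Phi> ?x ?y" using lower by (intro mult_left_mono) auto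
    also have "\<dots> \<le> C * code_dist \<Phi> x y" using dist(2) by blast
    finally have "?E \<le> C / \<delta> * code_dist \<Phi> x y" using \<delta>(1) by (simp add: field_simps)
    also have "\<dots> \<le> K * code_dist \<Phi> x y"
      unfolding K_def using C(1) D(1) by (intro mult_right_mono) auto
    finally have 1: "?E \<le> K * code_dist \<Phi> x y" .
    have "code_dist \<Phi> x y \<le> C * ?E * code_dist \<Phi> ?x ?y" using dist(1) by blast
    also have "\<dots> \<le> C * ?E * D" using upper C(1) by (intro mult_left_mono) auto
    also have "\<dots> = (C * D) * ?E" by simp
    also have "\<dots> \<le> K * ?E" unfolding K_def using C(1) \<delta>(1) by (intro mult_right_mono) auto
    finally show "comparable K ?E (code_dist \<Phi> x y)"
      using 1 by blast
  qed
qed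

text \<open>For a fixed first letter the potential is a Lipschitz function of the coding point of
  \<open>shift x\<close>, and coding points approach each other at a geometric rate. Agreement is required at
  the \<open>n + 1\<close> places \<open>k \<le> n\<close>: the first letter selects the branch, the others bring the points
  together.\<close>

lemma geom_potential_hoelder:
  obtains K c where "K > 0" "0 < c" "c < 1"
    "\<And>x y n. x \<in> shift_space d \<Longrightarrow> y \<in> shift_space d \<Longrightarrow> \<forall>k\<le>n. x k = y k \<Longrightarrow>
      \<bar>geom_potential \<Phi> x - geom_potential \<Phi> y\<bar> \<le> K * c ^ n"
proof -
  obtain U F C where UF: "conformal_cifs d \<Phi> U F"
    using conformal_extension_obtains by metis
  interpret conformal_cifs d \<Phi> U F by fact
  obtain c D where c: "0 < c" "c < 1" "0 < D" "\<And>x y n. x \<in> shift_space d \<Longrightarrow> y \<in> shift_space d \<Longrightarrow>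
      \<forall>k<n. x k = y k \<Longrightarrow> code_dist \<Phi> x y \<le> D * c ^ n"
    using coding_dist by metis
  let ?l = "\<lambda>i p. ln (cmod (deriv (F i) (complex_of_real p)))"
  have "\<forall>i\<in>alphabet d. \<exists>L>0. \<forall>p\<in>base \<Phi>. \<forall>q\<in>base \<Phi>. \<bar>?l i p - ?l i q\<bar> \<le> L * \<bar>p - q\<bar>"
    using ln_derivative_lipschitz by metis
  then obtain L where L: "\<And>i. i \<in> alphabet d \<Longrightarrow> L i > 0"
    "\<And>i p q. i \<in> alphabet d \<Longrightarrow> p \<in> base \<Phi> \<Longrightarrow> q \<in> base \<Phi> \<Longrightarrow> \<bar>?l i p - ?l i q\<bar> \<le> L i * \<bar>p - q\<bar>"
    by metis
  define M where "M = (\<Sum>i\<in>alphabet d. L i)"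
  have LM: "L i \<le> M" if "i \<in> alphabet d" for i
    unfolding M_def using that L(1) by (intro member_le_sum) (auto simp: less_imp_le)
  have "M > 0" using LM[OF one_two_in_alphabet(1)] L(1)[OF one_two_in_alphabet(1)] by simp
  show ?thesis
  proof (rule that[of "M * D" c])
    show "M * D > 0" using \<open>M > 0\<close> c by simp
    fix x y n assume x: "x \<in> shift_space d" and y: "y \<in> shift_space d" and n: "\<forall>k\<le>n. x k = y k"
    have eq0: "y 0 = x 0" using n by simp
    have i: "x 0 \<in> alphabet d" using letter_in_alphabet[OF x] .
    note sx = shift_in_shift_space[OF x] and sy = shift_in_shift_space[OF y]
    have "\<bar>geom_potential \<Phi> x - geom_potential \<Phi> y\<bar>
        \<le> L (x 0) * code_dist \<Phi> (shift x) (shift y)"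
      unfolding geom_potential_eq[OF x] geom_potential_eq[OF y] eq0
      by (rule L(2)[OF i coding_in_base[OF sx] coding_in_base[OF sy]])
    also have "\<dots> \<le> M * (D * c ^ n)"
      by (intro mult_mono LM i c(4)[OF sx sy]) (use n \<open>M > 0\<close> in \<open>auto simp: shift_def\<close>)
    finally show "\<bar>geom_potential \<Phi> x - geom_potential \<Phi> y\<bar> \<le> M * D * c ^ n" by simp
  qed (use c in auto)
qed

end

section \<open>Contraction ratios of essentially affine systems\<close>

definition letter_sum :: "(nat \<Rightarrow> real) \<Rightarrow> nat \<Rightarrow> (nat \<Rightarrow> nat) \<Rightarrow> real" where
  "letter_sum \<rho> n x = (\<Sum>k<n. \<rho> (x k))"

lemma letter_sum_cong:
  "\<forall>i\<in>alphabet d. \<rho> i = \<tau> i \<Longrightarrow> x \<in> shift_space d \<Longrightarrow> letter_sum \<tau> n x = letter_sum \<rho> n x"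
  unfolding letter_sum_def using letter_in_alphabet[of x d] by simp

text \<open>An essentially affine system is bi-Lipschitz conjugate to an affine one, so distances in its
  limit set are comparable to products of the affine ratios. The parameter \<open>\<rho>\<close> holds the logarithms
  of these ratios, which turns products over words into sums and powers \<open>r\<^sub>i\<^sup>u\<close> into exponentials of
  linear functions of \<open>u\<close>.\<close>

locale ratio_ifs = cifs +
  fixes \<rho> :: "nat \<Rightarrow> real"
  assumes ratio_neg: "i \<in> alphabet d \<Longrightarrow> \<rho> i < 0"
    and ratio_metric: "\<exists>K. controls_distances d \<Phi> K (letter_sum \<rho>)"

text \<open>The potential of an affine system depends on the first letter only, and its Birkhoff sums are
  the letter sums of \<open>ln \<bar>a\<^sub>i\<bar>\<close>, where \<open>a\<^sub>i\<close> are the slopes.\<close>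

lemma AS_ratios:
  assumes d: "d \<ge> 2" and AS: "\<Phi> \<in> AS d"
  shows "\<exists>\<rho>. ratio_ifs d \<Phi> \<rho>"
proof -
  have CS: "\<Phi> \<in> CS d" using AS by (simp add: AS_def)
  interpret cifs d \<Phi> using d CS by unfold_locales
  obtain a b where ab: "\<And>i x. i \<in> alphabet d \<Longrightarrow> x \<in> base \<Phi> \<Longrightarrow> gens \<Phi> i x = a i * x + b i"
    using AS unfolding AS_def by (simp, metis)
  define p where "p = coding \<Phi> (\<lambda>_. 1)"
  define q where "q = coding \<Phi> (\<lambda>_. 2)"
  have pb: "p \<in> base \<Phi>" and qb: "q \<in> base \<Phi>" and "p \<noteq> q"
    using coding_in_base const_in_shift_space one_two_in_alphabet
      inj_onD[OF coding_inj, of "\<lambda>_. 1" "\<lambda>_. 2"]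
    unfolding p_def q_def by (auto simp: fun_eq_iff)
  obtain c where c: "0 < c" "c < 1" "\<forall>i\<in>alphabet d. c-lipschitz_on (base \<Phi>) (gens \<Phi> i)"
    using contraction .
  have a: "a i \<noteq> 0" "\<bar>a i\<bar> < 1" if i: "i \<in> alphabet d" for i
  proof -
    have diff: "gens \<Phi> i p - gens \<Phi> i q = a i * (p - q)"
      using ab[OF i pb] ab[OF i qb] by (simp add: algebra_simps)
    show "a i \<noteq> 0"
    proof
      assume "a i = 0"
      then have "gens \<Phi> i p = gens \<Phi> i q" using diff by simp
      then show False using inj_onD[OF gen_inj[OF i]] pb qb \<open>p \<noteq> q\<close> by blast
    qed
    have "c-lipschitz_on (base \<Phi>) (gens \<Phi> i)" using c(3) i by blast
    then have "\<bar>gens \<Phi> i p - gens \<Phi> i q\<bar> \<le> c * \<bar>p - q\<bar>"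
      using lipschitz_onD[of c "base \<Phi>" "gens \<Phi> i", OF _ pb qb] by (simp add: dist_real_def)
    then have "\<bar>a i\<bar> * \<bar>p - q\<bar> \<le> c * \<bar>p - q\<bar>" by (simp add: diff abs_mult)
    then show "\<bar>a i\<bar> < 1" using \<open>p \<noteq> q\<close> c(2) by auto
  qed
  define \<rho> where "\<rho> i = ln \<bar>a i\<bar>" for i
  have geom: "geom_potential \<Phi> x = \<rho> (x 0)" if x: "x \<in> shift_space d" for x
  proof -
    note i = letter_in_alphabet[OF x, of 0]
    let ?p = "coding \<Phi> (shift x)"
    have p: "?p \<in> interior (base \<Phi>)" using coding_in_interior[OF shift_in_shift_space[OF x]] .
    have "((\<lambda>t. a (x 0) * t + b (x 0)) has_real_derivative a (x 0)) (at ?p)"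
      by (auto intro!: derivative_eq_intros)
    then have "(gens \<Phi> (x 0) has_real_derivative a (x 0)) (at ?p)"
      by (rule has_field_derivative_transform_within_open[OF _ open_interior p])
        (use ab[OF i subsetD[OF interior_subset]] in simp)
    then show ?thesis unfolding geom_potential_def \<rho>_def by (simp add: DERIV_imp_deriv)
  qed
  have birk: "birkhoff n (geom_potential \<Phi>) x = letter_sum \<rho> n x" if x: "x \<in> shift_space d" for x n
    unfolding birkhoff_def letter_sum_def
    by (intro sum.cong refl)
      (simp only: geom[OF funpow_shift_in_shift_space[OF x]], simp add: funpow_shift)
  have "ratio_ifs d \<Phi> \<rho>"
  proof
    show "\<rho> i < 0" if "i \<in> alphabet d" for i
      unfolding \<rho>_def using a[OF that] by (intro ln_less_zero) auto
    obtain K where "controls_distances d \<Phi> K (\<lambda>n. birkhoff n (geom_potential \<Phi>))"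
    using coding_dist_birkhoff .
  note K = controls_distancesD[OF this]
    show "\<exists>K. controls_distances d \<Phi> K (letter_sum \<rho>)"
      by (intro exI[of _ K] controls_distancesI K(1)) (use K(2) birk in force)
  qed
  then show ?thesis by blast
qed

lemma ratio_ifs_bilipschitz:
  assumes "ratio_ifs d \<Phi> \<rho>" "\<Psi> \<in> CS d" "L > 0"
    and L: "\<And>x y. x \<in> shift_space d \<Longrightarrow> y \<in> shift_space d \<Longrightarrow>
       comparable L (code_dist \<Psi> x y) (code_dist \<Phi> x y)"
  shows "ratio_ifs d \<Psi> \<rho>"
proof -
  interpret ratio_ifs d \<Phi> \<rho> by fact
  obtain K where "controls_distances d \<Phi> K (letter_sum \<rho>)"
    using ratio_metric by blast
  note K = controls_distancesD[OF this]
  show ?thesis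
  proof
    show "d \<ge> 2" "\<Psi> \<in> CS d" by (rule d2, fact)
    show "\<rho> i < 0" if "i \<in> alphabet d" for i using ratio_neg[OF that] .
    show "\<exists>K. controls_distances d \<Psi> K (letter_sum \<rho>)"
    proof (rule exI[of _ "K * L"], rule controls_distancesI, goal_cases pos dist)
      case pos
      show ?case using K(1) assms(3) by simp
    next
      case (dist x y n)
      note xy = dist
      have "exp (letter_sum \<rho> n x) \<le> K * code_dist \<Phi> x y" using K(2)[OF xy] by blast
      also have "\<dots> \<le> K * (L * code_dist \<Psi> x y)"
        using L[OF xy(1,2)] K(1) by (intro mult_left_mono) auto
      finally have 1: "exp (letter_sum \<rho> n x) \<le> K * L * code_dist \<Psi> x y" by simp
      have "code_dist \<Psi> x y \<le> L * code_dist \<Phi> x y" using L[OF xy(1,2)] by blast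
      also have "\<dots> \<le> L * (K * exp (letter_sum \<rho> n x))"
        using K(2)[OF xy] assms(3) by (intro mult_left_mono) auto
      finally show ?case using 1 by (simp add: mult_ac)
    qed
  qed
qed

lemma EAS_ratios:
  assumes d: "d \<ge> 2" and EAS: "\<Psi> \<in> EAS d"
  shows "\<exists>\<rho>. ratio_ifs d \<Psi> \<rho>"
proof -
  obtain \<Phi> where \<Phi>: "\<Phi> \<in> AS d" "equivalent d \<Phi> \<Psi>" "\<Psi> \<in> CS d" using EAS by (auto simp: EAS_def)
  then obtain \<rho> where "ratio_ifs d \<Phi> \<rho>" using AS_ratios[OF d] by blast
  moreover have "\<Phi> \<in> CS d" using \<Phi> by (simp add: AS_def)
  ultimately show ?thesis
    using \<Phi> equivalent_iff_coding_bilipschitz[OF d, of \<Phi> \<Psi>] ratio_ifs_bilipschitz[of d \<Phi> \<rho> \<Psi>] by blast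
qed

context ratio_ifs
begin

lemma other_letter:
  obtains j where "j \<in> alphabet d" "j \<noteq> i"
  using one_two_in_alphabet by (metis num.distinct(1) numeral_eq_iff one_eq_numeral_iff)

text \<open>Both sums control the distance between \<open>x\<close> and a point whose code first differs from that of
  \<open>x\<close> at place \<open>n\<close>.\<close>

lemma birkhoff_letter_sum:
  obtains K where "K > 0" "\<And>x n. x \<in> shift_space d \<Longrightarrow>
    \<bar>birkhoff n (geom_potential \<Phi>) x - letter_sum \<rho> n x\<bar> \<le> K"
proof -
  obtain K1 where "controls_distances d \<Phi> K1 (\<lambda>n. birkhoff n (geom_potential \<Phi>))"
    using coding_dist_birkhoff .
  note K1 = controls_distancesD[OF this]
  obtain K2 where "controls_distances d \<Phi> K2 (letter_sum \<rho>)"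
    using ratio_metric by blast
  note K2 = controls_distancesD[OF this]
  define K where "K = \<bar>ln (K1 * K2)\<bar> + 1"
  show ?thesis
  proof (rule that[of K])
    show "K > 0" by (simp add: K_def)
    fix x n assume x: "x \<in> shift_space d"
    obtain j where j: "j \<in> alphabet d" "j \<noteq> x n" using other_letter .
    let ?y = "x(n := j)" and ?b = "birkhoff n (geom_potential \<Phi>) x" and ?l = "letter_sum \<rho> n x"
    let ?D = "code_dist \<Phi> x ?y"
    have y: "?y \<in> shift_space d" using x j by (auto simp: shift_space_def)
    have ag: "\<forall>k<n. x k = ?y k" "x n \<noteq> ?y n" using j by auto
    have "exp ?b \<le> K1 * ?D" using K1(2)[OF x y ag] by blast
    also have "\<dots> \<le> K1 * (K2 * exp ?l)" using K2(2)[OF x y ag] K1(1) by (intro mult_left_mono) (blast, simp)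
    also have "\<dots> = exp (ln (K1 * K2) + ?l)" using K1(1) K2(1) by (simp add: exp_add)
    finally have 1: "?b \<le> ln (K1 * K2) + ?l" by simp
    have "exp ?l \<le> K2 * ?D" using K2(2)[OF x y ag] by blast
    also have "\<dots> \<le> K2 * (K1 * exp ?b)" using K1(2)[OF x y ag] K2(1) by (intro mult_left_mono) (blast, simp)
    also have "\<dots> = exp (ln (K1 * K2) + ?b)" using K1(1) K2(1) by (simp add: exp_add)
    finally have 2: "?l \<le> ln (K1 * K2) + ?b" by simp
    show "\<bar>?b - ?l\<bar> \<le> K" using 1 2 unfolding K_def by linarith
  qed
qed

lemma letter_sum_const: "letter_sum \<rho> n (\<lambda>_. i) = n * \<rho> i"
  by (simp add: letter_sum_def)

end

lemma bounded_multiples_imp_eq: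
  fixes a b :: real
  assumes "\<And>n::nat. \<bar>n * a - n * b\<bar> \<le> K"
  shows "a = b"
proof (rule ccontr)
  assume "a \<noteq> b"
  then obtain n :: nat where "K < n * \<bar>a - b\<bar>"
    using reals_Archimedean3[of "\<bar>a - b\<bar>"] by auto
  also have "\<dots> = \<bar>n * a - n * b\<bar>" by (metis abs_mult abs_of_nat right_diff_distrib)
  also have "\<dots> \<le> K" by (rule assms)
  finally show False by simp
qed

text \<open>A bi-Lipschitz conjugacy makes both families of ratios control the same distances, so their
  letter sums stay within a bounded distance; along the constant code of \<open>i\<close> they are \<open>n \<rho>\<^sub>i\<close> and
  \<open>n \<tau>\<^sub>i\<close>. Conversely, equal ratios make the two metrics on the shift space comparable.\<close>

lemma equivalent_iff_ratios_eq:
  assumes "ratio_ifs d \<Phi> \<rho>" "ratio_ifs d \<Psi> \<tau>"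
  shows "equivalent d \<Phi> \<Psi> \<longleftrightarrow> (\<forall>i\<in>alphabet d. \<rho> i = \<tau> i)"
proof -
  interpret P: ratio_ifs d \<Phi> \<rho> by fact
  interpret Q: ratio_ifs d \<Psi> \<tau> by fact
  note equiv = equivalent_iff_coding_bilipschitz[OF P.d2 P.CS Q.CS]
  obtain K2 where "controls_distances d \<Psi> K2 (letter_sum \<tau>)"
    using Q.ratio_metric by blast
  note K2 = controls_distancesD[OF this]
  show ?thesis
  proof
    assume "equivalent d \<Phi> \<Psi>"
    then obtain L where "L > 0" "\<And>x y. x \<in> shift_space d \<Longrightarrow> y \<in> shift_space d \<Longrightarrow>
       comparable L (code_dist \<Psi> x y) (code_dist \<Phi> x y)" unfolding equiv by blast
    then have "ratio_ifs d \<Psi> \<rho>" using ratio_ifs_bilipschitz[OF assms(1) Q.CS] by blast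
    then interpret R: ratio_ifs d \<Psi> \<rho> .
    obtain K1 where K1: "\<And>x n. x \<in> shift_space d \<Longrightarrow>
       \<bar>birkhoff n (geom_potential \<Psi>) x - letter_sum \<rho> n x\<bar> \<le> K1" using R.birkhoff_letter_sum by metis
    obtain K2 where K2: "\<And>x n. x \<in> shift_space d \<Longrightarrow>
       \<bar>birkhoff n (geom_potential \<Psi>) x - letter_sum \<tau> n x\<bar> \<le> K2" using Q.birkhoff_letter_sum by metis
    show "\<forall>i\<in>alphabet d. \<rho> i = \<tau> i"
    proof
      fix i assume i: "i \<in> alphabet d"
      show "\<rho> i = \<tau> i"
      proof (rule bounded_multiples_imp_eq)
        fix n :: nat
        show "\<bar>n * \<rho> i - n * \<tau> i\<bar> \<le> K1 + K2"
          using K1[OF const_in_shift_space[OF i], of n] K2[OF const_in_shift_space[OF i], of n]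
          unfolding R.letter_sum_const Q.letter_sum_const by linarith
      qed
    qed
  next
    assume eq: "\<forall>i\<in>alphabet d. \<rho> i = \<tau> i"
    note ls = letter_sum_cong[OF eq]
    obtain K1 where "controls_distances d \<Phi> K1 (letter_sum \<rho>)"
    using P.ratio_metric by blast
  note K1 = controls_distancesD[OF this]
    have "comparable (K1 * K2) (code_dist \<Psi> x y) (code_dist \<Phi> x y)"
      if xy: "x \<in> shift_space d" "y \<in> shift_space d" for x y
    proof (cases "x = y")
      case False
      then obtain n where n: "\<forall>k<n. x k = y k" "x n \<noteq> y n" using first_difference by blast
      note 1 = K1(2)[OF xy n] and 2 = K2(2)[OF xy n, unfolded ls[OF xy(1)]]
      have "code_dist \<Psi> x y \<le> K2 * exp (letter_sum \<rho> n x)" using 2 by blast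
      also have "\<dots> \<le> K2 * (K1 * code_dist \<Phi> x y)"
        using 1 K2(1) by (intro mult_left_mono) auto
      finally have A: "code_dist \<Psi> x y \<le> K1 * K2 * code_dist \<Phi> x y"
        by (simp add: mult_ac)
      have "code_dist \<Phi> x y \<le> K1 * exp (letter_sum \<rho> n x)" using 1 by blast
      also have "\<dots> \<le> K1 * (K2 * code_dist \<Psi> x y)"
        using 2 K1(1) by (intro mult_left_mono) auto
      finally show ?thesis using A by (simp add: mult_ac)
    qed simp
    then show "equivalent d \<Phi> \<Psi>" unfolding equiv
      by (intro exI[of _ "K1 * K2"]) (use K1(1) K2(1) in auto)
  qed
qed

section \<open>Permuting the generators\<close>

lemma permuted_in_shift_space:
  "p permutes alphabet d \<Longrightarrow> x \<in> shift_space d \<Longrightarrow> p \<circ> x \<in> shift_space d"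
  by (auto simp: shift_space_def permutes_in_image)

lemma permute_gens_CS:
  assumes p: "p permutes alphabet d" and CS: "\<Psi> \<in> CS d"
  shows "permute_gens p \<Psi> \<in> CS d"
proof -
  have pa: "p i \<in> alphabet d" if "i \<in> alphabet d" for i using p that by (simp add: permutes_in_image)
  have pinj: "p i \<noteq> p j" if "i \<noteq> j" for i j using permutes_inj[OF p] that by (auto dest: injD)
  obtain U F where UF: "conformal_extension d \<Psi> U F" "bounded_distortion d U F"
    using CS unfolding CS_def mem_Collect_eq by (elim conjE exE)
  have "conformal_extension d (permute_gens p \<Psi>) U (\<lambda>i. F (p i))"
    using UF(1) pa unfolding conformal_extension_def permute_gens_def by simp
  moreover have "bounded_distortion d U (\<lambda>i. F (p i))"
  proof -
    obtain C where C: "C \<ge> 1" "\<forall>n. \<forall>w\<in>words d n. \<forall>x\<in>U. \<forall>y\<in>U.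
        cmod (deriv (foldr F w) y) \<le> C * cmod (deriv (foldr F w) x)"
      using UF(2) unfolding bounded_distortion_def by blast
    have fold: "foldr (\<lambda>i. F (p i)) w = foldr F (map p w)" for w by (induction w) auto
    have "map p w \<in> words d n" if "w \<in> words d n" for w n using that pa by (auto simp: words_def)
    then show ?thesis unfolding bounded_distortion_def fold using C by blast
  qed
  ultimately have "\<exists>U F. conformal_extension d (permute_gens p \<Psi>) U F \<and> bounded_distortion d U F"
    by blast
  then show ?thesis using CS pa pinj unfolding CS_def by (simp add: permute_gens_def)
qed

lemma coding_permute_gens: "coding (permute_gens p \<Psi>) x = coding \<Psi> (p \<circ> x)"
  by (simp add: coding_def permute_gens_def foldr_map comp_def)

lemma geom_potential_permute_gens:
  "geom_potential (permute_gens p \<Psi>) x = geom_potential \<Psi> (p \<circ> x)"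
  by (simp add: geom_potential_def coding_permute_gens) (simp add: permute_gens_def shift_def comp_def)

lemma birkhoff_permute_gens:
  "birkhoff n (geom_potential (permute_gens p \<Psi>)) x = birkhoff n (geom_potential \<Psi>) (p \<circ> x)"
  by (simp add: birkhoff_def geom_potential_permute_gens funpow_shift comp_def)

lemma ratio_ifs_permute_gens:
  assumes p: "p permutes alphabet d" and "ratio_ifs d \<Psi> \<tau>"
  shows "ratio_ifs d (permute_gens p \<Psi>) (\<lambda>i. \<tau> (p i))"
proof -
  interpret ratio_ifs d \<Psi> \<tau> by fact
  show ?thesis
  proof
    show "d \<ge> 2" by (rule d2)
    show "permute_gens p \<Psi> \<in> CS d" by (rule permute_gens_CS[OF p CS])
    show "\<tau> (p i) < 0" if "i \<in> alphabet d" for i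
      using ratio_neg[of "p i"] that p by (simp add: permutes_in_image)
    have ls: "letter_sum (\<lambda>i. \<tau> (p i)) n x = letter_sum \<tau> n (p \<circ> x)" for n x
      by (simp add: letter_sum_def)
    have pinj: "p i = p j \<longleftrightarrow> i = j" for i j using permutes_inj[OF p] by (auto dest: injD)
    obtain K where "controls_distances d \<Psi> K (letter_sum \<tau>)"
      using ratio_metric by blast
    note K = controls_distancesD[OF this]
    show "\<exists>K. controls_distances d (permute_gens p \<Psi>) K (letter_sum (\<lambda>i. \<tau> (p i)))"
    proof (intro exI[of _ K] controls_distancesI K(1))
      fix x y n assume "x \<in> shift_space d" "y \<in> shift_space d" "\<forall>k<n. x k = y k" "x n \<noteq> y n"
      then show "comparable K (exp (letter_sum (\<lambda>i. \<tau> (p i)) n x)) (code_dist (permute_gens p \<Psi>) x y)"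
        unfolding coding_permute_gens ls
        by (intro K(2) permuted_in_shift_space[OF p]) (auto simp: pinj)
    qed
  qed
qed

lemma equivalent_upto_perm_iff:
  assumes "ratio_ifs d \<Phi> \<rho>" "ratio_ifs d \<Psi> \<tau>"
  shows "equivalent_upto_perm d \<Phi> \<Psi> \<longleftrightarrow>
    (\<exists>p. p permutes alphabet d \<and> (\<forall>i\<in>alphabet d. \<rho> i = \<tau> (p i)))"
  unfolding equivalent_upto_perm_def
  using equivalent_iff_ratios_eq[OF assms(1) ratio_ifs_permute_gens[OF _ assms(2)]] by blast

section \<open>Cohomology\<close>

lemma open_agree: "open {y :: nat \<Rightarrow> nat. \<forall>k<n. y k = x k}"
proof -
  have "{y :: nat \<Rightarrow> nat. \<forall>k<n. y k = x k} = (\<Inter>k\<in>{..<n}. (\<lambda>y. y k) -` {x k})" by auto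
  moreover have "open ((\<lambda>y :: nat \<Rightarrow> nat. y k) -` {x k})" for k
    by (rule open_vimage[OF Topological_Spaces.open_discrete continuous_on_product_coordinates])
  ultimately show ?thesis by (simp add: open_INT)
qed

lemma continuous_on_shift_spaceI:
  assumes c: "0 < c" "c < 1"
    and e: "\<And>x y n. x \<in> shift_space d \<Longrightarrow> y \<in> shift_space d \<Longrightarrow> \<forall>k\<le>n. x k = y k \<Longrightarrow>
      \<bar>e x - e y\<bar> \<le> M * c ^ n"
  shows "continuous_on (shift_space d) (e :: (nat \<Rightarrow> nat) \<Rightarrow> real)"
  unfolding continuous_on_def
proof (intro ballI tendstoI)
  fix x :: "nat \<Rightarrow> nat" and \<epsilon> :: real assume x: "x \<in> shift_space d" and "\<epsilon> > 0"
  have "(\<lambda>n. M * c ^ n) \<longlonglongrightarrow> M * 0" using c by (intro tendsto_intros) auto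
  then have "eventually (\<lambda>n. M * c ^ n < \<epsilon>) sequentially"
    using \<open>\<epsilon> > 0\<close> order_tendstoD(2) by fastforce
  then obtain n where n: "M * c ^ n < \<epsilon>" by (auto simp: eventually_sequentially)
  show "\<forall>\<^sub>F y in at x within shift_space d. dist (e y) (e x) < \<epsilon>"
    unfolding eventually_at_topological
  proof (intro exI[of _ "{y. \<forall>k<Suc n. y k = x k}"] conjI open_agree ballI impI)
    fix y assume "y \<in> {y. \<forall>k<Suc n. y k = x k}" "y \<in> shift_space d"
    then have "\<bar>e y - e x\<bar> \<le> M * c ^ n" using e[of y x n] x by auto
    then show "dist (e y) (e x) < \<epsilon>" using n by (simp add: dist_real_def)
  qed simp
qed

lemma all_multiples_bounded_imp_zero:
  fixes a :: real
  assumes "\<And>m::nat. \<bar>m * a\<bar> \<le> B"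
  shows "a = 0"
  using bounded_multiples_imp_eq[of a 0 B] assms by simp

text \<open>Livsic's theorem for the full shift. The supremum \<open>E\<close> of the Birkhoff sums along all inverse
  branches satisfies \<open>f \<le> E \<circ> \<sigma> - E\<close>. The defect is continuous and nonnegative, and its sum over a
  periodic orbit telescopes to minus the sum of \<open>f\<close>, which vanishes because its multiples stay
  bounded. So the defect vanishes at periodic points, which are dense.\<close>

lemma livsic:
  assumes d: "d \<ge> 1" and c: "0 < c" "c < 1" and "K \<ge> 0"
    and f: "\<And>x y n. x \<in> shift_space d \<Longrightarrow> y \<in> shift_space d \<Longrightarrow> \<forall>k\<le>n. x k = y k \<Longrightarrow>
      \<bar>f x - f y\<bar> \<le> K * c ^ n"
    and B: "\<And>x n. x \<in> shift_space d \<Longrightarrow> \<bar>birkhoff n f x\<bar> \<le> B"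
  obtains e where "continuous_on (shift_space d) e"
    "\<And>x. x \<in> shift_space d \<Longrightarrow> f x = e x - e (shift x)"
proof -
  let ?S = "shift_space d"
  define W where "W = {w. set w \<subseteq> alphabet d}"
  define S where "S w x = birkhoff (length w) f (prepend w x)" for w x
  define E where "E x = (SUP w\<in>W. S w x)" for x
  define M where "M = K / (1 - c)"
  have M0: "M \<ge> 0" using c \<open>K \<ge> 0\<close> by (simp add: M_def)
  have W0: "W \<noteq> {}" unfolding W_def by (auto intro!: exI[of _ "[]"])
  have bdd: "bdd_above ((\<lambda>w. S w x) ` W)" if "x \<in> ?S" for x
  proof (rule bdd_aboveI2)
    fix w assume "w \<in> W"
    then have "prepend w x \<in> ?S" using that prepend_in_shift_space by (auto simp: W_def)
    then show "S w x \<le> B" using B[of "prepend w x" "length w"] by (simp add: S_def)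
  qed
  have SE: "S w x \<le> E x" if "x \<in> ?S" "w \<in> W" for w x
    unfolding E_def by (rule cSUP_upper[OF that(2) bdd[OF that(1)]])
  have geo: "(\<Sum>j<n. c ^ j) \<le> 1 / (1 - c)" for n
    using c by (simp add: sum_gp_strict divide_right_mono)
  have Sdist: "\<bar>S w x - S w y\<bar> \<le> K * c ^ n * (\<Sum>j<length w. c ^ j)"
    if "x \<in> ?S" "y \<in> ?S" "\<forall>k\<le>n. x k = y k" "w \<in> W" for w x y n
    using that(4)
  proof (induction w)
    case (Cons i w)
    have w: "set w \<subseteq> alphabet d" "i \<in> alphabet d" using Cons.prems by (auto simp: W_def)
    have S: "S (i # w) z = f (prepend (i # w) z) + S w z" for z
      unfolding S_def by (simp add: birkhoff_Suc shift_prepend_Cons)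
    have "\<bar>f (prepend (i # w) x) - f (prepend (i # w) y)\<bar> \<le> K * c ^ (n + length w)"
      by (rule f[OF prepend_in_shift_space prepend_in_shift_space])
        (use w that in \<open>auto simp: prepend_def\<close>)
    moreover have "\<bar>S w x - S w y\<bar> \<le> K * c ^ n * (\<Sum>j<length w. c ^ j)"
      using Cons by (simp add: W_def)
    ultimately show ?case unfolding S by (simp add: algebra_simps power_add)
  qed (simp add: S_def birkhoff_def)
  have Sdist': "S w x \<le> S w y + M * c ^ n"
    if "x \<in> ?S" "y \<in> ?S" "\<forall>k\<le>n. x k = y k" "w \<in> W" for w x y n
  proof -
    have "K * c ^ n * (\<Sum>j<length w. c ^ j) \<le> K * c ^ n * (1 / (1 - c))"
      using c \<open>K \<ge> 0\<close> by (intro mult_left_mono geo) auto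
    then show ?thesis using Sdist[OF that] by (simp add: M_def)
  qed
  have E1: "E x \<le> E y + M * c ^ n" if "x \<in> ?S" "y \<in> ?S" "\<forall>k\<le>n. x k = y k" for x y n
    unfolding E_def[of x]
  proof (rule cSUP_least[OF W0])
    fix w assume "w \<in> W"
    then show "S w x \<le> E y + M * c ^ n" using Sdist'[OF that \<open>w \<in> W\<close>] SE[OF that(2) \<open>w \<in> W\<close>] by simp
  qed
  have Ed: "\<bar>E x - E y\<bar> \<le> M * c ^ n" if "x \<in> ?S" "y \<in> ?S" "\<forall>k\<le>n. x k = y k" for x y n
    using E1[OF that] E1[of y x n] that by (auto simp: abs_le_iff)
  define g where "g x = E (shift x) - E x - f x" for x
  have g0: "g x \<ge> 0" if x: "x \<in> ?S" for x
  proof -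
    have "E x \<le> E (shift x) - f x" unfolding E_def[of x]
    proof (rule cSUP_least[OF W0])
      fix w assume w: "w \<in> W"
      have w': "w @ [x 0] \<in> W" using w letter_in_alphabet[OF x] by (auto simp: W_def)
      have "S (w @ [x 0]) (shift x) = birkhoff (length w + 1) f (prepend w x)"
        unfolding S_def by (simp add: prepend_append prepend_hd)
      also have "\<dots> = S w x + f x"
        unfolding birkhoff_add birkhoff_1 funpow_shift_prepend S_def ..
      finally show "S w x \<le> E (shift x) - f x"
        using SE[OF shift_in_shift_space[OF x] w'] by simp
    qed
    then show ?thesis by (simp add: g_def)
  qed
  have gper: "g z = 0" if z: "z \<in> ?S" "(shift ^^ Suc p) z = z" for z p
  proof -
    have mult: "birkhoff (m * Suc p) f z = m * birkhoff (Suc p) f z" for m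
    proof (induction m)
      case (Suc m)
      have "birkhoff (Suc m * Suc p) f z = birkhoff (Suc p + m * Suc p) f z" by (simp only: mult_Suc)
      also have "\<dots> = birkhoff (Suc p) f z + birkhoff (m * Suc p) f z"
        unfolding birkhoff_add z(2) ..
      finally show ?case using Suc by (simp add: algebra_simps)
    qed (simp add: birkhoff_def)
    have zero: "birkhoff (Suc p) f z = 0"
      by (rule all_multiples_bounded_imp_zero[of _ B]) (use B[OF z(1)] mult in metis)
    have "(\<Sum>k<n. g ((shift ^^ k) z)) = E ((shift ^^ n) z) - E z - birkhoff n f z" for n
      by (induction n) (simp_all add: g_def birkhoff_def)
    then have "(\<Sum>k<Suc p. g ((shift ^^ k) z)) = E z - E z - 0" using z(2) zero by (simp only:)
    moreover have "0 \<le> g ((shift ^^ k) z)" for k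
      using g0 funpow_shift_in_shift_space[OF z(1)] by blast
    ultimately have "\<forall>k\<in>{..<Suc p}. g ((shift ^^ k) z) = 0"
      using sum_nonneg_eq_0_iff[of "{..<Suc p}" "\<lambda>k. g ((shift ^^ k) z)"] by simp
    then have "g ((shift ^^ 0) z) = 0" by blast
    then show ?thesis by simp
  qed
  have g_zero: "g x = 0" if x: "x \<in> ?S" for x
  proof -
    have le: "\<bar>g x\<bar> \<le> (2 * M + K) * c ^ n" for n
    proof -
      define z where "z k = x (k mod (n + 2))" for k
      have z: "z \<in> ?S" using x by (auto simp: z_def shift_space_def)
      have "(shift ^^ Suc (Suc n)) z = z" by (auto simp: z_def funpow_shift simp flip: add_2_eq_Suc')
      then have gz: "g z = 0" by (rule gper[OF z])
      have ag: "\<forall>k\<le>Suc n. x k = z k" by (auto simp: z_def)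
      have "\<bar>f x - f z\<bar> \<le> K * c ^ n" by (rule f) (use x z ag in auto)
      moreover have "\<bar>E x - E z\<bar> \<le> M * c ^ n" by (rule Ed) (use x z ag in auto)
      moreover have "\<bar>E (shift x) - E (shift z)\<bar> \<le> M * c ^ n"
        by (rule Ed[OF shift_in_shift_space shift_in_shift_space])
          (use x z ag in \<open>auto simp: shift_def\<close>)
      moreover have "g x = (E (shift x) - E (shift z)) - (E x - E z) - (f x - f z)"
        using gz by (simp add: g_def)
      ultimately show ?thesis by (simp add: algebra_simps)
    qed
    have "(\<lambda>n. (2 * M + K) * c ^ n) \<longlonglongrightarrow> (2 * M + K) * 0" using c by (intro tendsto_intros) auto
    then have "\<bar>g x\<bar> \<le> (2 * M + K) * 0" by (rule LIMSEQ_le_const) (use le in auto)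
    then show ?thesis by simp
  qed
  show ?thesis
  proof (rule that[of "\<lambda>x. - E x"])
    show "continuous_on ?S (\<lambda>x. - E x)"
      by (intro continuous_on_minus continuous_on_shift_spaceI[OF c Ed])
    show "f x = - E x - - E (shift x)" if "x \<in> ?S" for x
      using g_zero[OF that] by (simp add: g_def)
  qed
qed

lemma birkhoff_diff: "birkhoff n (\<lambda>x. f x - g x) x = birkhoff n f x - birkhoff n g x"
  by (simp add: birkhoff_def sum_subtractf)

lemma birkhoff_const: "birkhoff n f (\<lambda>_. i) = n * f (\<lambda>_. i)"
  by (simp add: birkhoff_def funpow_shift)

lemma (in ratio_ifs) geom_potential_const:
  assumes "i \<in> alphabet d"
  shows "geom_potential \<Phi> (\<lambda>_. i) = \<rho> i"
proof -
  obtain K where K: "\<And>x n. x \<in> shift_space d \<Longrightarrow>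
    \<bar>birkhoff n (geom_potential \<Phi>) x - letter_sum \<rho> n x\<bar> \<le> K" using birkhoff_letter_sum by metis
  show ?thesis
    by (rule bounded_multiples_imp_eq)
      (use K[OF const_in_shift_space[OF assms]] in \<open>simp add: birkhoff_const letter_sum_const\<close>)
qed

text \<open>A coboundary vanishes at the fixed points of the shift, where the potential takes the values
  \<open>\<rho>\<^sub>i\<close>. If the ratios agree, the difference of the potentials has bounded Birkhoff sums and Livsic's
  theorem applies.\<close>

lemma cohomologous_iff_ratios_eq:
  assumes "ratio_ifs d \<Phi> \<rho>" "ratio_ifs d \<Psi> \<tau>"
  shows "cohomologous d (geom_potential \<Phi>) (geom_potential \<Psi>) \<longleftrightarrow> (\<forall>i\<in>alphabet d. \<rho> i = \<tau> i)"
proof -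
  interpret P: ratio_ifs d \<Phi> \<rho> by fact
  interpret Q: ratio_ifs d \<Psi> \<tau> by fact
  show ?thesis
  proof
    assume "cohomologous d (geom_potential \<Phi>) (geom_potential \<Psi>)"
    then obtain e where e: "\<forall>x\<in>shift_space d. geom_potential \<Phi> x - geom_potential \<Psi> x = e x - e (shift x)"
      unfolding cohomologous_def by blast
    show "\<forall>i\<in>alphabet d. \<rho> i = \<tau> i"
    proof
      fix i assume i: "i \<in> alphabet d"
      have "shift (\<lambda>_. i) = (\<lambda>_. i)" by (simp add: shift_def)
      then show "\<rho> i = \<tau> i"
        using e const_in_shift_space[OF i] P.geom_potential_const[OF i] Q.geom_potential_const[OF i]
        by (metis diff_self eq_iff_diff_eq_0)
    qed
  next
    assume eq: "\<forall>i\<in>alphabet d. \<rho> i = \<tau> i"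
    note ls = letter_sum_cong[OF eq]
    obtain B1 where B1: "\<And>x n. x \<in> shift_space d \<Longrightarrow>
       \<bar>birkhoff n (geom_potential \<Phi>) x - letter_sum \<rho> n x\<bar> \<le> B1" using P.birkhoff_letter_sum by metis
    obtain B2 where B2: "\<And>x n. x \<in> shift_space d \<Longrightarrow>
       \<bar>birkhoff n (geom_potential \<Psi>) x - letter_sum \<tau> n x\<bar> \<le> B2" using Q.birkhoff_letter_sum by metis
    obtain K1 c1 where 1: "K1 > 0" "0 < c1" "c1 < 1"
      "\<And>x y n. x \<in> shift_space d \<Longrightarrow> y \<in> shift_space d \<Longrightarrow> \<forall>k\<le>n. x k = y k \<Longrightarrow>
      \<bar>geom_potential \<Phi> x - geom_potential \<Phi> y\<bar> \<le> K1 * c1 ^ n"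
      using P.geom_potential_hoelder by metis
    obtain K2 c2 where 2: "K2 > 0" "0 < c2" "c2 < 1"
      "\<And>x y n. x \<in> shift_space d \<Longrightarrow> y \<in> shift_space d \<Longrightarrow> \<forall>k\<le>n. x k = y k \<Longrightarrow>
      \<bar>geom_potential \<Psi> x - geom_potential \<Psi> y\<bar> \<le> K2 * c2 ^ n"
      using Q.geom_potential_hoelder by metis
    define c where "c = max c1 c2"
    have c: "0 < c" "c < 1" using 1 2 by (auto simp: c_def)
    obtain e where "continuous_on (shift_space d) e"
      "\<And>x. x \<in> shift_space d \<Longrightarrow> geom_potential \<Phi> x - geom_potential \<Psi> x = e x - e (shift x)"
    proof (rule livsic[of d c "K1 + K2" "\<lambda>x. geom_potential \<Phi> x - geom_potential \<Psi> x" "B1 + B2"])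
      fix x y n assume xy: "x \<in> shift_space d" "y \<in> shift_space d" "\<forall>k\<le>n. x k = y k"
      have "K1 * c1 ^ n \<le> K1 * c ^ n" "K2 * c2 ^ n \<le> K2 * c ^ n"
        using 1 2 by (auto intro!: power_mono simp: c_def)
      then show "\<bar>(geom_potential \<Phi> x - geom_potential \<Psi> x) - (geom_potential \<Phi> y - geom_potential \<Psi> y)\<bar>
          \<le> (K1 + K2) * c ^ n"
        using 1(4)[OF xy] 2(4)[OF xy] unfolding distrib_right by linarith
    next
      fix x n assume x: "x \<in> shift_space d"
      show "\<bar>birkhoff n (\<lambda>x. geom_potential \<Phi> x - geom_potential \<Psi> x) x\<bar> \<le> B1 + B2"
        unfolding birkhoff_diff using B1[OF x, of n] B2[OF x, of n] ls[OF x, of n] by linarith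
    qed (use P.d2 c 1 2 in auto)
    then show "cohomologous d (geom_potential \<Phi>) (geom_potential \<Psi>)"
      unfolding cohomologous_def by blast
  qed
qed

lemma potentials_cohomologous_upto_perm_iff:
  assumes "ratio_ifs d \<Phi> \<rho>" "ratio_ifs d \<Psi> \<tau>"
  shows "potentials_cohomologous_upto_perm d \<Phi> \<Psi> \<longleftrightarrow>
    (\<exists>p. p permutes alphabet d \<and> (\<forall>i\<in>alphabet d. \<rho> i = \<tau> (p i)))"
  unfolding potentials_cohomologous_upto_perm_def
  using cohomologous_iff_ratios_eq[OF assms(1) ratio_ifs_permute_gens[OF _ assms(2)]] by blast

section \<open>Pressure\<close>

lemma words_Suc: "words d (Suc n) = (\<lambda>(i, w). i # w) ` (alphabet d \<times> words d n)"
  by (auto simp: words_def length_Suc_conv image_iff)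

lemma sum_words_prod:
  fixes f :: "nat \<Rightarrow> real"
  shows "(\<Sum>w\<in>words d n. prod_list (map f w)) = (\<Sum>i\<in>alphabet d. f i) ^ n"
proof (induction n)
  case 0
  have "words d 0 = {[]}" by (auto simp: words_def)
  then show ?case by simp
next
  case (Suc n)
  have "(\<Sum>w\<in>words d (Suc n). prod_list (map f w)) =
      (\<Sum>(i, w)\<in>alphabet d \<times> words d n. f i * prod_list (map f w))"
    unfolding words_Suc by (subst sum.reindex) (auto simp: inj_on_def case_prod_unfold)
  also have "\<dots> = (\<Sum>i\<in>alphabet d. f i) * (\<Sum>w\<in>words d n. prod_list (map f w))"
    by (simp add: sum_product sum.cartesian_product)
  finally show ?case using Suc by simp
qed

lemma exp_sum_list: "exp (sum_list (map g w)) = prod_list (map (\<lambda>i. exp (g i)) w)" for g :: "nat \<Rightarrow> real"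
  by (induction w) (auto simp: exp_add)

lemma sum_words_exp:
  fixes g :: "nat \<Rightarrow> real"
  shows "(\<Sum>w\<in>words d n. exp (sum_list (map g w))) = (\<Sum>i\<in>alphabet d. exp (g i)) ^ n"
  unfolding exp_sum_list by (rule sum_words_prod)

lemma letter_sum_prefix: "letter_sum \<rho> n x = sum_list (map \<rho> (prefix x n))"
  by (induction n) (auto simp: letter_sum_def)

lemma letter_sum_cylinder:
  "w \<in> words d n \<Longrightarrow> x \<in> cylinder d w \<Longrightarrow> letter_sum \<rho> n x = sum_list (map \<rho> w)"
  unfolding letter_sum_prefix mem_cylinder_iff words_def by (metis (mono_tags) mem_Collect_eq)

lemma sum_list_const_mult_map: "sum_list (map (\<lambda>i. u * \<rho> i) w) = u * sum_list (map \<rho> w)"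
  for u :: real by (rule sum_list_const_mult)

lemma birkhoff_mult: "birkhoff n (\<lambda>x. u * f x) x = u * birkhoff n f x"
  by (simp add: birkhoff_def sum_distrib_left)

context ratio_ifs
begin

lemma cylinder_nonempty:
  assumes "w \<in> words d n"
  shows "cylinder d w \<noteq> {}"
proof -
  have "prepend w (\<lambda>_. 1) \<in> cylinder d w"
    using assms one_two_in_alphabet const_in_shift_space[of 1 d]
    by (intro prepend_in_cylinder) (auto simp: words_def)
  then show ?thesis by blast
qed

definition partition_sum :: "real \<Rightarrow> real" where
  "partition_sum u = (\<Sum>i\<in>alphabet d. exp (u * \<rho> i))"

lemma partition_sum_pos: "partition_sum u > 0"
  unfolding partition_sum_def using one_two_in_alphabet by (intro sum_pos) auto

text \<open>Replacing Birkhoff sums by letter sums changes each summand of the partition function by a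
  bounded factor, and for letter sums the partition function is exactly the \<open>n\<close>-th power of
  \<open>partition_sum u\<close>.\<close>

lemma pressure_fun_eq: "pressure_fun d \<Phi> u = ln (partition_sum u)"
proof -
  obtain K where K: "K > 0" "\<And>x n. x \<in> shift_space d \<Longrightarrow>
    \<bar>birkhoff n (geom_potential \<Phi>) x - letter_sum \<rho> n x\<bar> \<le> K" using birkhoff_letter_sum by metis
  let ?f = "\<lambda>x. u * geom_potential \<Phi> x" and ?Z = "partition_sum u" and ?k = "\<bar>u\<bar> * K"
  define Z where "Z n = (\<Sum>w\<in>words d n. exp (SUP x\<in>cylinder d w. birkhoff n ?f x))" for n
  have dist: "\<bar>birkhoff n ?f x - u * sum_list (map \<rho> w)\<bar> \<le> ?k"
    if "w \<in> words d n" "x \<in> cylinder d w" for n w x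
  proof -
    have x: "x \<in> shift_space d" using that by (simp add: mem_cylinder_iff)
    have "\<bar>birkhoff n ?f x - u * sum_list (map \<rho> w)\<bar>
        = \<bar>u\<bar> * \<bar>birkhoff n (geom_potential \<Phi>) x - letter_sum \<rho> n x\<bar>"
      unfolding birkhoff_mult letter_sum_cylinder[OF that] by (simp add: abs_mult[symmetric] algebra_simps)
    also have "\<dots> \<le> ?k" by (intro mult_left_mono K x) auto
    finally show ?thesis .
  qed
  have sup: "\<bar>(SUP x\<in>cylinder d w. birkhoff n ?f x) - u * sum_list (map \<rho> w)\<bar> \<le> ?k"
    if w: "w \<in> words d n" for n w
  proof -
    have up: "(SUP x\<in>cylinder d w. birkhoff n ?f x) \<le> u * sum_list (map \<rho> w) + ?k"
      using dist[OF w] by (intro cSUP_least cylinder_nonempty[OF w]) (force simp: abs_le_iff)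
    obtain x where x: "x \<in> cylinder d w" using cylinder_nonempty[OF w] by blast
    have "u * sum_list (map \<rho> w) - ?k \<le> birkhoff n ?f x" using dist[OF w x] by linarith
    also have "\<dots> \<le> (SUP x\<in>cylinder d w. birkhoff n ?f x)"
    proof (rule cSUP_upper[OF x])
      show "bdd_above ((\<lambda>x. birkhoff n ?f x) ` cylinder d w)"
        using dist[OF w] by (intro bdd_aboveI2[of _ _ "u * sum_list (map \<rho> w) + ?k"]) (force simp: abs_le_iff)
    qed
    finally show ?thesis using up by linarith
  qed
  have Zn: "(\<Sum>w\<in>words d n. exp (u * sum_list (map \<rho> w))) = ?Z ^ n" for n
    using sum_words_exp[of "\<lambda>i. u * \<rho> i" d n]
    unfolding sum_list_const_mult_map partition_sum_def .
  have up: "Z n \<le> exp ?k * ?Z ^ n" for n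
  proof -
    have "Z n \<le> (\<Sum>w\<in>words d n. exp ?k * exp (u * sum_list (map \<rho> w)))"
      unfolding Z_def exp_add[symmetric] using sup by (intro sum_mono) (force simp: abs_le_iff)
    then show ?thesis unfolding sum_distrib_left[symmetric] Zn .
  qed
  have lo: "exp (- ?k) * ?Z ^ n \<le> Z n" for n
  proof -
    have "(\<Sum>w\<in>words d n. exp (- ?k) * exp (u * sum_list (map \<rho> w))) \<le> Z n"
      unfolding Z_def exp_add[symmetric] using sup by (intro sum_mono) (force simp: abs_le_iff)
    then show ?thesis unfolding sum_distrib_left[symmetric] Zn .
  qed
  have Zpos: "Z n > 0" for n
    using lo[of n] partition_sum_pos[of u] by (smt (verit) exp_gt_zero mult_pos_pos zero_less_power)
  have ln_le: "ln (Z n) \<le> ?k + n * ln ?Z" "- ?k + n * ln ?Z \<le> ln (Z n)" for n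
    using ln_mono[OF up[of n] Zpos] ln_mono[OF lo[of n]] partition_sum_pos[of u]
    by (simp_all add: ln_mult ln_realpow)
  have "(\<lambda>n. ln (Z n) / real n - ln ?Z) \<longlonglongrightarrow> 0"
  proof (rule Lim_null_comparison)
    show "\<forall>\<^sub>F n in sequentially. norm (ln (Z n) / real n - ln ?Z) \<le> ?k / real n"
      using eventually_gt_at_top[of 0]
    proof eventually_elim
      case (elim n)
      have "ln (Z n) / real n - ln ?Z = (ln (Z n) - n * ln ?Z) / n" using elim by (simp add: field_simps)
      then have "norm (ln (Z n) / real n - ln ?Z) = \<bar>ln (Z n) - n * ln ?Z\<bar> / n" by simp
      also have "\<dots> \<le> ?k / n" using ln_le[of n] by (intro divide_right_mono) auto
      finally show ?case .
    qed
    show "(\<lambda>n. ?k / real n) \<longlonglongrightarrow> 0" by (rule lim_const_over_n)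
  qed
  then have "(\<lambda>n. ln (Z n) / real n) \<longlonglongrightarrow> ln ?Z" by (simp add: LIM_zero_iff)
  then show ?thesis unfolding pressure_fun_def pressure_def Z_def by (rule limI)
qed

end

text \<open>Equal power sums give equal sums of any polynomial, and a polynomial that vanishes at all values but one counts that value.\<close>

lemma power_sums_determine_multiset:
  fixes r s :: "'a \<Rightarrow> real"
  assumes A: "finite A" and ps: "\<And>k::nat. (\<Sum>i\<in>A. r i ^ k) = (\<Sum>i\<in>A. s i ^ k)"
  shows "image_mset r (mset_set A) = image_mset s (mset_set A)"
proof (rule multiset_eqI)
  fix t
  have poly: "(\<Sum>i\<in>A. poly q (r i)) = (\<Sum>i\<in>A. poly q (s i))" for q
  proof -
    have "(\<Sum>i\<in>A. poly q (f i)) = (\<Sum>k\<le>degree q. coeff q k * (\<Sum>i\<in>A. f i ^ k))" for f :: "'a \<Rightarrow> real"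
      unfolding poly_altdef by (subst sum.swap) (simp add: sum_distrib_left)
    then show ?thesis using ps by simp
  qed
  define N where "N = (r ` A \<union> s ` A) - {t}"
  define q where "q = (\<Prod>v\<in>N. [:- v, 1:])"
  have N: "finite N" using A by (simp add: N_def)
  have qt: "poly q t \<noteq> 0" using N by (auto simp: q_def poly_prod N_def)
  have qv: "poly q v = 0" if "v \<in> N" for v using N that by (auto simp: q_def poly_prod)
  have count: "(\<Sum>i\<in>A. poly q (f i)) = card {i \<in> A. f i = t} * poly q t"
    if "f ` A \<subseteq> r ` A \<union> s ` A" for f
  proof -
    have "(\<Sum>i\<in>A. poly q (f i)) = (\<Sum>i\<in>{i \<in> A. f i = t}. poly q (f i))"
      by (rule sum.mono_neutral_right) (use A that qv in \<open>auto simp: N_def\<close>)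
    then show ?thesis by simp
  qed
  have "card {i \<in> A. r i = t} = card {i \<in> A. s i = t}"
    using poly[of q] count[of r] count[of s] qt by simp
  then show "count (image_mset r (mset_set A)) t = count (image_mset s (mset_set A)) t"
    using A by (simp add: count_image_mset_eq_card_vimage)
qed

lemma pressure_fun_eq_iff:
  assumes "ratio_ifs d \<Phi> \<rho>" "ratio_ifs d \<Psi> \<tau>"
  shows "pressure_fun d \<Phi> = pressure_fun d \<Psi> \<longleftrightarrow>
    (\<exists>p. p permutes alphabet d \<and> (\<forall>i\<in>alphabet d. \<rho> i = \<tau> (p i)))"
proof -
  interpret P: ratio_ifs d \<Phi> \<rho> by fact
  interpret Q: ratio_ifs d \<Psi> \<tau> by fact
  show ?thesis
  proof
    assume eq: "pressure_fun d \<Phi> = pressure_fun d \<Psi>"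
    have "P.partition_sum u = Q.partition_sum u" for u
      using fun_cong[OF eq, of u] P.partition_sum_pos[of u] Q.partition_sum_pos[of u]
      unfolding P.pressure_fun_eq Q.pressure_fun_eq by simp
    then have "(\<Sum>i\<in>alphabet d. exp (\<rho> i) ^ k) = (\<Sum>i\<in>alphabet d. exp (\<tau> i) ^ k)" for k :: nat
      unfolding P.partition_sum_def Q.partition_sum_def exp_of_nat_mult[symmetric] .
    then have "image_mset (\<lambda>i. exp (\<rho> i)) (mset_set (alphabet d)) =
        image_mset (\<lambda>i. exp (\<tau> i)) (mset_set (alphabet d))"
      by (intro power_sums_determine_multiset) auto
    then obtain p where "p permutes alphabet d" "\<forall>i\<in>alphabet d. exp (\<rho> i) = exp (\<tau> (p i))"
      using image_mset_eq_implies_permutes[OF finite_alphabet] by blast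
    then show "\<exists>p. p permutes alphabet d \<and> (\<forall>i\<in>alphabet d. \<rho> i = \<tau> (p i))" by auto
  next
    assume "\<exists>p. p permutes alphabet d \<and> (\<forall>i\<in>alphabet d. \<rho> i = \<tau> (p i))"
    then obtain p where p: "p permutes alphabet d" "\<forall>i\<in>alphabet d. \<rho> i = \<tau> (p i)" by blast
    have "P.partition_sum u = Q.partition_sum u" for u
      unfolding P.partition_sum_def Q.partition_sum_def
      using p(2) sum.permute[OF p(1), of "\<lambda>i. exp (u * \<tau> i)"] by (simp add: comp_def)
    then show "pressure_fun d \<Phi> = pressure_fun d \<Psi>"
      unfolding P.pressure_fun_eq Q.pressure_fun_eq fun_eq_iff by simp
  qed
qed

section \<open>Measures on the shift space\<close>

abbreviation shift_sigma :: "nat \<Rightarrow> (nat \<Rightarrow> nat) measure" where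
  "shift_sigma d \<equiv> restrict_space borel (shift_space d)"

lemma closed_shift_space: "closed (shift_space d)"
proof -
  have "shift_space d = (\<Inter>k. (\<lambda>x. x k) -` alphabet d)" by (auto simp: shift_space_def)
  moreover have "closed ((\<lambda>x :: nat \<Rightarrow> nat. x k) -` alphabet d)" for k
    by (rule closed_vimage) (auto intro: finite_imp_closed)
  ultimately show ?thesis by (simp add: closed_INT)
qed

lemma space_shift_sigma [simp]: "space (shift_sigma d) = shift_space d"
  by (simp add: space_restrict_space)

lemma cylinder_eq_Int_open: "cylinder d w = shift_space d \<inter> {y. \<forall>k<length w. y k = (\<lambda>k. w ! k) k}"
  by (auto simp: cylinder_def)

lemma cylinder_sets: "cylinder d w \<in> sets (shift_sigma d)"
  unfolding cylinder_eq_Int_open sets_restrict_space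
  by (intro imageI borel_open open_agree)

lemma cylinder_in_sets: "sets \<mu> = sets (shift_sigma d) \<Longrightarrow> cylinder d w \<in> sets \<mu>"
  using cylinder_sets by (simp only:)

lemma shift_measurable: "shift \<in> measurable (shift_sigma d) (shift_sigma d)"
proof -
  have "shift \<in> borel_measurable borel"
    unfolding shift_def by (rule measurable_coordinatewise_then_product)
      (rule measurable_product_coordinates)
  then show ?thesis
    by (intro measurable_restrict_space2 measurable_restrict_space1)
      (auto simp: shift_in_shift_space)
qed

lemma cylinder_append_subset: "cylinder d (u @ v) \<subseteq> cylinder d u"
  by (auto simp: cylinder_def nth_append)

lemma cylinder_disjoint:
  assumes "length u = length v" "u \<noteq> v"
  shows "cylinder d u \<inter> cylinder d v = {}"
  using assms by (metis (mono_tags) disjoint_iff mem_cylinder_iff)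

lemma cylinder_split:
  "cylinder d u = (\<Union>v\<in>words d n. cylinder d (u @ v))"
proof
  show "(\<Union>v\<in>words d n. cylinder d (u @ v)) \<subseteq> cylinder d u" using cylinder_append_subset by blast
  show "cylinder d u \<subseteq> (\<Union>v\<in>words d n. cylinder d (u @ v))"
  proof
    fix x assume x: "x \<in> cylinder d u"
    then have xs: "x \<in> shift_space d" "prefix x (length u) = u" by (auto simp: mem_cylinder_iff)
    let ?v = "prefix ((shift ^^ length u) x) n"
    have v: "?v \<in> words d n" by (rule prefix_in_words[OF funpow_shift_in_shift_space[OF xs(1)]])
    then have "length (u @ ?v) = length u + n" by (simp add: words_def)
    then have "x \<in> cylinder d (u @ ?v)"
      unfolding mem_cylinder_iff using prefix_append[of x "length u" n] xs by metis
    then show "x \<in> (\<Union>v\<in>words d n. cylinder d (u @ v))" using v by blast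
  qed
qed

lemma shift_vimage_cylinder:
  "shift -` cylinder d v \<inter> shift_space d = (\<Union>i\<in>alphabet d. cylinder d (i # v))"
proof
  show "shift -` cylinder d v \<inter> shift_space d \<subseteq> (\<Union>i\<in>alphabet d. cylinder d (i # v))"
  proof
    fix x assume x: "x \<in> shift -` cylinder d v \<inter> shift_space d"
    then have "x \<in> cylinder d (x 0 # v)"
      by (auto simp: cylinder_def shift_def nth_Cons split: nat.split)
    then show "x \<in> (\<Union>i\<in>alphabet d. cylinder d (i # v))" using x letter_in_alphabet by blast
  qed
  show "(\<Union>i\<in>alphabet d. cylinder d (i # v)) \<subseteq> shift -` cylinder d v \<inter> shift_space d"
  proof
    fix x assume "x \<in> (\<Union>i\<in>alphabet d. cylinder d (i # v))"
    then obtain i where x: "x \<in> cylinder d (i # v)" by blast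
    then have "x \<in> shift_space d" by (simp add: cylinder_def)
    moreover have "shift x k = v ! k" if "k < length v" for k
      using x that by (auto simp: cylinder_def shift_def dest: spec[of _ "Suc k"])
    ultimately show "x \<in> shift -` cylinder d v \<inter> shift_space d"
      using shift_in_shift_space by (auto simp: cylinder_def)
  qed
qed

text \<open>The empty set is included because two cylinders may be disjoint, and the family has to be
  closed under intersection in order to determine measures.\<close>

definition cylinder_family :: "nat \<Rightarrow> (nat \<Rightarrow> nat) set set" where
  "cylinder_family d = insert {} (cylinder d ` {w. set w \<subseteq> alphabet d})"

lemma cylinder_family_Pow: "cylinder_family d \<subseteq> Pow (shift_space d)"
  by (auto simp: cylinder_family_def cylinder_def)

lemma Int_stable_cylinder_family: "Int_stable (cylinder_family d)"
proof -
  have *: "cylinder d u \<inter> cylinder d v \<in> {{}, cylinder d v}" if "length u \<le> length v" for u v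
  proof (cases "take (length u) v = u")
    case True
    then have "cylinder d v \<subseteq> cylinder d u" using cylinder_append_subset by (metis append_take_drop_id)
    then show ?thesis by blast
  next
    case False
    have "cylinder d v \<subseteq> cylinder d (take (length u) v)"
      using cylinder_append_subset by (metis append_take_drop_id)
    then have "cylinder d u \<inter> cylinder d v = {}"
      using cylinder_disjoint[of u "take (length u) v" d] False that by auto
    then show ?thesis by simp
  qed
  show ?thesis
  proof (rule Int_stableI)
    fix A B assume A: "A \<in> cylinder_family d" and B: "B \<in> cylinder_family d"
    show "A \<inter> B \<in> cylinder_family d"
    proof (cases "A = {} \<or> B = {}")
      case True
      then show ?thesis by (auto simp: cylinder_family_def)
    next
      case False
      then obtain u v where uv: "A = cylinder d u" "B = cylinder d v"
        "set u \<subseteq> alphabet d" "set v \<subseteq> alphabet d"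
        using A B unfolding cylinder_family_def by blast
      have "A \<inter> B \<in> {{}, A, B}"
        using *[of u v] *[of v u] uv by (metis inf_commute insert_iff nle_le)
      then show ?thesis using A B by (auto simp: cylinder_family_def)
    qed
  qed
qed

lemma sets_shift_sigma: "sets (shift_sigma d) = sigma_sets (shift_space d) (cylinder_family d)"
proof
  let ?N = "sigma (shift_space d) (cylinder_family d)"
  have N: "space ?N = shift_space d" "sets ?N = sigma_sets (shift_space d) (cylinder_family d)"
    using cylinder_family_Pow by simp_all
  have coord: "(\<lambda>x. x k) \<in> borel_measurable ?N" for k
  proof (rule borel_measurableI)
    fix A :: "nat set"
    have "(\<lambda>x. x k) -` A \<inter> shift_space d =
        (\<Union>w\<in>{w \<in> words d (Suc k). w ! k \<in> A}. cylinder d w)"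
    proof
      show "(\<lambda>x. x k) -` A \<inter> shift_space d \<subseteq> (\<Union>w\<in>{w \<in> words d (Suc k). w ! k \<in> A}. cylinder d w)"
      proof
        fix x assume x: "x \<in> (\<lambda>x. x k) -` A \<inter> shift_space d"
        then have w: "prefix x (Suc k) \<in> words d (Suc k)" using prefix_in_words by blast
        have "prefix x (Suc k) ! k = x k" by (simp del: upt_Suc)
        moreover have "x \<in> cylinder d (prefix x (Suc k))" using x by (simp add: mem_cylinder_iff)
        ultimately show "x \<in> (\<Union>w\<in>{w \<in> words d (Suc k). w ! k \<in> A}. cylinder d w)"
          using w x by (intro UN_I[of "prefix x (Suc k)"]) (simp_all del: upt_Suc)
      qed
      show "(\<Union>w\<in>{w \<in> words d (Suc k). w ! k \<in> A}. cylinder d w) \<subseteq> (\<lambda>x. x k) -` A \<inter> shift_space d"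
        by (auto simp: cylinder_def words_def)
    qed
    moreover have "cylinder d w \<in> sets ?N" if "w \<in> words d (Suc k)" for w
      using that unfolding N by (intro sigma_sets.Basic) (auto simp: cylinder_family_def words_def)
    ultimately show "(\<lambda>x. x k) -` A \<inter> space ?N \<in> sets ?N"
      unfolding N(1) by (auto intro!: sets.finite_UN finite_subset[OF _ finite_words[of d "Suc k"]])
  qed
  have id: "(\<lambda>x. x) \<in> borel_measurable ?N"
    by (rule measurable_coordinatewise_then_product) (rule coord)
  show "sets (shift_sigma d) \<subseteq> sigma_sets (shift_space d) (cylinder_family d)"
  proof
    fix A assume "A \<in> sets (shift_sigma d)"
    then obtain B where "B \<in> sets borel" "A = shift_space d \<inter> B" by (auto simp: sets_restrict_space)
    then show "A \<in> sigma_sets (shift_space d) (cylinder_family d)"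
      using measurable_sets[OF id, of B] N by (simp add: Int_commute)
  qed
  have "cylinder_family d \<subseteq> sets (shift_sigma d)" using cylinder_sets by (auto simp: cylinder_family_def)
  then show "sigma_sets (shift_space d) (cylinder_family d) \<subseteq> sets (shift_sigma d)"
    using sets.sigma_sets_subset[of "cylinder_family d" "shift_sigma d"] by simp
qed

lemma measure_eq_on_cylinders:
  assumes \<mu>: "prob_space \<mu>" "sets \<mu> = sets (shift_sigma d)"
    and \<nu>: "prob_space \<nu>" "sets \<nu> = sets (shift_sigma d)"
    and eq: "\<And>w. set w \<subseteq> alphabet d \<Longrightarrow> measure \<mu> (cylinder d w) = measure \<nu> (cylinder d w)"
  shows "\<mu> = \<nu>"
proof -
  interpret M: prob_space \<mu> by fact
  interpret N: prob_space \<nu> by fact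
  show ?thesis
  proof (rule measure_eqI_generator_eq[OF Int_stable_cylinder_family cylinder_family_Pow,
        where A = "\<lambda>_. shift_space d"])
    fix X assume "X \<in> cylinder_family d"
    then show "emeasure \<mu> X = emeasure \<nu> X"
      using eq by (auto simp: cylinder_family_def M.emeasure_eq_measure N.emeasure_eq_measure)
  next
    have "cylinder d [] \<in> cylinder_family d" unfolding cylinder_family_def by (intro insertI2 imageI) simp
    then show "range (\<lambda>_::nat. shift_space d) \<subseteq> cylinder_family d" by (simp add: cylinder_Nil)
    show "sets \<mu> = sigma_sets (shift_space d) (cylinder_family d)"
      "sets \<nu> = sigma_sets (shift_space d) (cylinder_family d)"
      using \<mu>(2) \<nu>(2) by (simp_all only: sets_shift_sigma)
    show "(\<Union>i::nat. shift_space d) = shift_space d" by simp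
    show "emeasure \<mu> (shift_space d) \<noteq> \<infinity>" for i :: nat by simp
  qed
qed

lemma measure_cylinder_append:
  assumes "finite_measure \<mu>" "sets \<mu> = sets (shift_sigma d)"
  shows "(\<Sum>v\<in>words d n. measure \<mu> (cylinder d (u @ v))) = measure \<mu> (cylinder d u)"
proof -
  interpret finite_measure \<mu> by fact
  have "disjoint_family_on (\<lambda>v. cylinder d (u @ v)) (words d n)"
    unfolding disjoint_family_on_def
    by (intro ballI impI cylinder_disjoint) (auto simp: words_def)
  then show ?thesis
    using finite_measure_finite_Union[OF finite_words, of "\<lambda>v. cylinder d (u @ v)" d n]
      cylinder_in_sets[OF assms(2)] by (simp add: image_subset_iff flip: cylinder_split)
qed

lemma measure_distr_shift_cylinder:
  assumes "finite_measure \<mu>" and sets: "sets \<mu> = sets (shift_sigma d)"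
  shows "measure (distr \<mu> \<mu> shift) (cylinder d v) = (\<Sum>i\<in>alphabet d. measure \<mu> (cylinder d (i # v)))"
proof -
  interpret finite_measure \<mu> by fact
  have sp: "space \<mu> = shift_space d" using sets_eq_imp_space_eq[OF sets] by simp
  have meas: "shift \<in> measurable \<mu> \<mu>"
    using shift_measurable[of d] measurable_cong_sets[OF sets sets] by blast
  have "measure (distr \<mu> \<mu> shift) (cylinder d v) = measure \<mu> (\<Union>i\<in>alphabet d. cylinder d (i # v))"
    using measure_distr[OF meas cylinder_in_sets[OF sets], of v]
    unfolding sp shift_vimage_cylinder .
  also have "\<dots> = (\<Sum>i\<in>alphabet d. measure \<mu> (cylinder d (i # v)))"
  proof (rule finite_measure_finite_Union)
    show "disjoint_family_on (\<lambda>i. cylinder d (i # v)) (alphabet d)"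
      unfolding disjoint_family_on_def by (intro ballI impI cylinder_disjoint) auto
  qed (simp_all add: image_subset_iff cylinder_in_sets[OF sets])
  finally show ?thesis .
qed

lemma sum_words_Suc:
  "(\<Sum>w\<in>words d (Suc n). f w) = (\<Sum>w\<in>words d n. \<Sum>i\<in>alphabet d. f (i # w))"
proof -
  have "(\<Sum>w\<in>words d (Suc n). f w) = (\<Sum>(i, w)\<in>alphabet d \<times> words d n. f (i # w))"
    unfolding words_Suc by (subst sum.reindex) (auto simp: inj_on_def case_prod_unfold)
  also have "\<dots> = (\<Sum>w\<in>words d n. \<Sum>i\<in>alphabet d. f (i # w))"
    unfolding sum.cartesian_product[symmetric] by (rule sum.swap)
  finally show ?thesis .
qed

lemma words_0: "words d 0 = {[]}"
  by (auto simp: words_def)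

lemma measure_cylinder_prepend:
  assumes "finite_measure \<mu>" "sets \<mu> = sets (shift_sigma d)" "distr \<mu> \<mu> shift = \<mu>"
  shows "(\<Sum>w\<in>words d n. measure \<mu> (cylinder d (w @ v))) = measure \<mu> (cylinder d v)"
proof (induction n)
  case (Suc n)
  have "(\<Sum>i\<in>alphabet d. measure \<mu> (cylinder d (i # u))) = measure \<mu> (cylinder d u)" for u
    using measure_distr_shift_cylinder[OF assms(1,2), of u] unfolding assms(3) ..
  then show ?case unfolding sum_words_Suc append_Cons using Suc by simp
qed (simp add: words_0)

lemma sum_words_add:
  "(\<Sum>w\<in>words d (n + m). f w) = (\<Sum>u\<in>words d n. \<Sum>v\<in>words d m. f (u @ v))"
proof (induction n arbitrary: f)
  case (Suc n)
  have "(\<Sum>w\<in>words d (Suc n + m). f w) =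
      (\<Sum>u\<in>words d n. \<Sum>v\<in>words d m. \<Sum>i\<in>alphabet d. f (i # u @ v))"
    unfolding add_Suc sum_words_Suc Suc ..
  also have "\<dots> = (\<Sum>u\<in>words d n. \<Sum>i\<in>alphabet d. \<Sum>v\<in>words d m. f (i # u @ v))"
    by (intro sum.cong refl sum.swap)
  finally show ?case unfolding sum_words_Suc append_Cons .
qed (simp add: words_0)

lemma append_in_words: "u \<in> words d n \<Longrightarrow> v \<in> words d m \<Longrightarrow> u @ v \<in> words d (n + m)"
  by (auto simp: words_def)

lemma gibbs_inequality_term:
  fixes a b :: real
  assumes "a > 0" "b > 0"
  shows "a - b \<le> a * ln (a / b)" and "a * ln (a / b) = a - b \<Longrightarrow> a = b"
proof -
  have ln: "ln (a / b) = - ln (b / a)" using assms by (simp add: ln_div)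
  have "ln (b / a) \<le> b / a - 1" using assms by (intro ln_le_minus_one) auto
  then have "a * ln (b / a) \<le> a * (b / a - 1)" using assms by (intro mult_left_mono) auto
  also have "\<dots> = b - a" using assms by (simp add: field_simps)
  finally show "a - b \<le> a * ln (a / b)" unfolding ln by simp
  assume "a * ln (a / b) = a - b"
  then have "ln (b / a) = b / a - 1" unfolding ln using assms by (simp add: field_simps)
  then have "b / a = 1" using assms by (intro ln_eq_minus_one) auto
  then show "a = b" using assms by simp
qed

text \<open>The function \<open>m\<close> stands for the cylinder weights of a shift-invariant measure and \<open>b\<close> for those
  of a Bernoulli measure. The relative entropy \<open>H n\<close> of \<open>m\<close> with respect to \<open>b\<close> on words of
  length \<open>n\<close> is superadditive in \<open>n\<close> because \<open>b\<close> is a product and both marginals of \<open>m\<close> on a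
  concatenation are again \<open>m\<close>. Being bounded by \<open>ln c\<close> and nonnegative, it vanishes, and
  relative entropy zero means equality.\<close>

lemma invariant_weights_eq_bernoulli:
  fixes m b :: "nat list \<Rightarrow> real"
  assumes m: "\<And>n w. w \<in> words d n \<Longrightarrow> 0 < m w" and b: "\<And>n w. w \<in> words d n \<Longrightarrow> 0 < b w"
    and b_append: "\<And>u v. b (u @ v) = b u * b v"
    and m_right: "\<And>n u. (\<Sum>v\<in>words d n. m (u @ v)) = m u"
    and m_left: "\<And>n v. (\<Sum>u\<in>words d n. m (u @ v)) = m v"
    and "m [] = 1" and b_sum: "\<And>n. (\<Sum>w\<in>words d n. b w) = 1"
    and le: "\<And>n w. w \<in> words d n \<Longrightarrow> m w \<le> c * b w"
    and w: "w \<in> words d n"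
  shows "m w = b w"
proof -
  define H where "H n = (\<Sum>w\<in>words d n. m w * ln (m w / b w))" for n
  have m_sum: "(\<Sum>w\<in>words d n. m w) = 1" for n using m_right[of "[]" n] \<open>m [] = 1\<close> by simp
  have "H n \<le> ln c" for n
  proof -
    have "m w * ln (m w / b w) \<le> m w * ln c" if "w \<in> words d n" for w
    proof -
      have "m w / b w \<le> c" using le[OF that] b[OF that] by (simp add: field_simps)
      then have "ln (m w / b w) \<le> ln c" using m[OF that] b[OF that] by (intro ln_mono) auto
      then show ?thesis using m[OF that] by (intro mult_left_mono) auto
    qed
    then have "H n \<le> (\<Sum>w\<in>words d n. m w * ln c)" unfolding H_def by (intro sum_mono)
    also have "\<dots> = ln c" using m_sum by (simp flip: sum_distrib_right)
    finally show ?thesis .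
  qed
  note H_le = this
  have H_eq: "H n = (\<Sum>w\<in>words d n. m w * ln (m w / b w) - (m w - b w))" for n
    unfolding H_def by (simp add: sum_subtractf m_sum b_sum)
  have summand_nonneg: "0 \<le> m w * ln (m w / b w) - (m w - b w)" if "w \<in> words d n" for w n
    using gibbs_inequality_term(1)[OF m[OF that] b[OF that]] by simp
  have H_nonneg: "0 \<le> H n" for n unfolding H_eq using summand_nonneg by (intro sum_nonneg)
  have superadd: "H n + H k \<le> H (n + k)" for n k
  proof -
    have summand_le: "m (u @ v) * ln (m u / b u) + m (u @ v) * ln (m v / b v) + (m (u @ v) - m u * m v)
        \<le> m (u @ v) * ln (m (u @ v) / b (u @ v))"
      if u: "u \<in> words d n" and v: "v \<in> words d k" for u v
    proof -
      note pos = m[OF u] m[OF v] b[OF u] b[OF v] m[OF append_in_words[OF u v]]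
      have "ln (m (u @ v) / b (u @ v)) =
          ln (m u / b u) + ln (m v / b v) + ln (m (u @ v) / (m u * m v))"
        using pos by (simp add: b_append ln_div ln_mult)
      then have "m (u @ v) * ln (m (u @ v) / b (u @ v)) = m (u @ v) * ln (m u / b u) +
          m (u @ v) * ln (m v / b v) + m (u @ v) * ln (m (u @ v) / (m u * m v))"
        by (simp add: algebra_simps)
      then show ?thesis using gibbs_inequality_term(1)[of "m (u @ v)" "m u * m v"] pos by simp
    qed
    have 1: "(\<Sum>u\<in>words d n. \<Sum>v\<in>words d k. m (u @ v) * ln (m u / b u)) = H n"
      unfolding H_def sum_distrib_right[symmetric] m_right ..
    have 2: "(\<Sum>u\<in>words d n. \<Sum>v\<in>words d k. m (u @ v) * ln (m v / b v)) = H k"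
      unfolding H_def by (subst sum.swap) (simp only: sum_distrib_right[symmetric] m_left)
    have 3: "(\<Sum>u\<in>words d n. \<Sum>v\<in>words d k. m (u @ v) - m u * m v) = 0"
      by (simp add: sum_subtractf m_right m_sum flip: sum_distrib_left)
    have "H n + H k = (\<Sum>u\<in>words d n. \<Sum>v\<in>words d k.
        m (u @ v) * ln (m u / b u) + m (u @ v) * ln (m v / b v) + (m (u @ v) - m u * m v))"
      unfolding sum.distrib 1 2 3 by simp
    also have "\<dots> \<le> H (n + k)"
      unfolding H_def[of "n + k"] sum_words_add by (intro sum_mono summand_le)
    finally show ?thesis .
  qed
  have mult: "real k * H n \<le> H (k * n)" for k
  proof (induction k)
    case (Suc k)
    then show ?case using superadd[of n "k * n"] by (simp add: algebra_simps)
  qed (simp add: H_nonneg)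
  have "H n = 0"
  proof (rule all_multiples_bounded_imp_zero)
    fix k :: nat
    show "\<bar>real k * H n\<bar> \<le> ln c" using mult[of k] H_le[of "k * n"] H_nonneg[of n] by simp
  qed
  then have "\<forall>w\<in>words d n. m w * ln (m w / b w) - (m w - b w) = 0"
    using sum_nonneg_eq_0_iff[OF finite_words, of d n "\<lambda>w. m w * ln (m w / b w) - (m w - b w)"]
      summand_nonneg[of _ n] unfolding H_eq by simp
  then show ?thesis using gibbs_inequality_term(2)[OF m[OF w] b[OF w]] w by simp
qed

section \<open>Bernoulli measures\<close>

locale bernoulli =
  fixes d :: nat and q :: "nat \<Rightarrow> real" and \<nu> :: "(nat \<Rightarrow> nat) measure"
  assumes q_nonneg: "i \<in> alphabet d \<Longrightarrow> q i \<ge> 0" and q_sum: "(\<Sum>i\<in>alphabet d. q i) = 1"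
    and prob_\<nu>: "prob_space \<nu>" and sets_\<nu>: "sets \<nu> = sets (shift_sigma d)"
    and cyl_\<nu>: "set w \<subseteq> alphabet d \<Longrightarrow> measure \<nu> (cylinder d w) = prod_list (map q w)"
begin

sublocale prob_space \<nu> by (rule prob_\<nu>)

lemma space_\<nu>: "space \<nu> = shift_space d"
  using sets_eq_imp_space_eq[OF sets_\<nu>] by simp

text \<open>Summing the product weight over an additional first letter gives back the weight, because the
  letter weights sum to one.\<close>

lemma shift_invariant: "distr \<nu> \<nu> shift = \<nu>"
proof -
  have meas: "shift \<in> measurable \<nu> \<nu>"
    using shift_measurable[of d] measurable_cong_sets[OF sets_\<nu> sets_\<nu>] by blast
  show ?thesis
  proof (rule measure_eq_on_cylinders[of _ d])
    show "prob_space (distr \<nu> \<nu> shift)" by (rule prob_space_distr[OF meas])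
    show "prob_space \<nu>" by (rule prob_\<nu>)
    show "sets (distr \<nu> \<nu> shift) = sets (shift_sigma d)" "sets \<nu> = sets (shift_sigma d)"
      using sets_\<nu> by simp_all
    fix w assume w: "set w \<subseteq> alphabet d"
    have "measure (distr \<nu> \<nu> shift) (cylinder d w) = (\<Sum>i\<in>alphabet d. measure \<nu> (cylinder d (i # w)))"
      by (rule measure_distr_shift_cylinder[OF finite_measure_axioms sets_\<nu>])
    also have "\<dots> = (\<Sum>i\<in>alphabet d. q i * prod_list (map q w))"
      using w by (intro sum.cong refl) (simp add: cyl_\<nu>)
    also have "\<dots> = measure \<nu> (cylinder d w)"
      using w by (simp add: cyl_\<nu> q_sum flip: sum_distrib_right)
    finally show "measure (distr \<nu> \<nu> shift) (cylinder d w) = measure \<nu> (cylinder d w)" .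
  qed
qed

end

text \<open>The product measure lives on all sequences of naturals. It gives the shift space mass one, so
  its restriction there is a probability measure with the same cylinder weights.\<close>

lemma bernoulli_measure_exists:
  fixes q :: "nat \<Rightarrow> real"
  assumes q: "\<And>i. i \<in> alphabet d \<Longrightarrow> q i \<ge> 0" and q1: "(\<Sum>i\<in>alphabet d. q i) = 1"
  obtains \<nu> where "bernoulli d q \<nu>"
proof -
  define q' where "q' i = (if i \<in> alphabet d then q i else 0)" for i
  define Q where "Q = embed_pmf q'"
  have "(\<integral>\<^sup>+ i. ennreal (q' i) \<partial>count_space UNIV) = (\<Sum>i\<in>alphabet d. ennreal (q' i))"
    by (rule nn_integral_count_space') (auto simp: q'_def)
  also have "\<dots> = ennreal (\<Sum>i\<in>alphabet d. q' i)" using q by (intro sum_ennreal) (auto simp: q'_def)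
  also have "\<dots> = 1" using q1 by (simp add: q'_def)
  finally have pmfQ: "pmf Q i = q' i" for i
    unfolding Q_def using q by (intro pmf_embed_pmf) (auto simp: q'_def)
  interpret P: product_prob_space "\<lambda>_::nat. measure_pmf Q" UNIV
    by unfold_locales
  let ?M = "PiM UNIV (\<lambda>_::nat. measure_pmf Q)"
  have setsM: "sets ?M = sets (borel :: (nat \<Rightarrow> nat) measure)"
  proof -
    have "sets ?M = sets (PiM UNIV (\<lambda>_::nat. borel :: nat measure))"
      by (rule sets_PiM_cong) (auto simp: sets_borel_eq_count_space)
    then show ?thesis by (simp add: sets_PiM_equal_borel)
  qed
  have spM: "space ?M = UNIV" using sets_eq_imp_space_eq[OF setsM] by simp
  have rect: "emeasure ?M {x. \<forall>k\<in>J. x k \<in> A k} = (\<Prod>k\<in>J. emeasure (measure_pmf Q) (A k))"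
    if "finite J" for J :: "nat set" and A
  proof -
    have "prod_emb UNIV (\<lambda>_. measure_pmf Q) J (Pi\<^sub>E J A) = {x. \<forall>k\<in>J. x k \<in> A k}"
      by (auto simp: prod_emb_def PiE_def Pi_def)
    then show ?thesis using P.emeasure_PiM_emb[of J A] that by simp
  qed
  have Sig: "shift_space d \<in> sets ?M" unfolding setsM by (rule borel_closed[OF closed_shift_space])
  have null: "emeasure ?M {x. x k \<notin> alphabet d} = 0" for k
  proof -
    have "emeasure (measure_pmf Q) (- alphabet d) = 0"
      unfolding measure_pmf.emeasure_eq_measure
      by (simp add: measure_pmf_zero_iff set_pmf_eq pmfQ q'_def disjoint_iff)
    then show ?thesis using rect[of "{k}" "\<lambda>_. - alphabet d"] by simp
  qed
  have AE: "AE x in ?M. x \<in> shift_space d"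
  proof -
    have "AE x in ?M. x k \<in> alphabet d" for k
    proof (rule AE_I)
      show "emeasure ?M {x. x k \<notin> alphabet d} = 0" by (rule null)
      have "closed ((\<lambda>x :: nat \<Rightarrow> nat. x k) -` alphabet d)"
        by (rule closed_vimage) (auto intro: finite_imp_closed)
      then have "open (- ((\<lambda>x :: nat \<Rightarrow> nat. x k) -` alphabet d))" by (rule open_Compl)
      then have "open {x :: nat \<Rightarrow> nat. x k \<notin> alphabet d}" by (simp add: Compl_eq vimage_def)
      then show "{x. x k \<notin> alphabet d} \<in> sets ?M" unfolding setsM by (rule borel_open)
    qed auto
    then show ?thesis unfolding shift_space_def mem_Collect_eq AE_all_countable by blast
  qed
  define \<nu> where "\<nu> = restrict_space ?M (shift_space d)"
  show ?thesis
  proof (rule that[of \<nu>], rule bernoulli.intro)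
    show "i \<in> alphabet d \<Longrightarrow> 0 \<le> q i" for i by (rule q)
    show "(\<Sum>i\<in>alphabet d. q i) = 1" by (rule q1)
    show "sets \<nu> = sets (shift_sigma d)" unfolding \<nu>_def sets_restrict_space setsM ..
    show "prob_space \<nu>"
      unfolding \<nu>_def by (rule prob_space_restrict_space[OF Sig P.emeasure_eq_1_AE[OF Sig AE]])
    fix w assume w: "set w \<subseteq> alphabet d"
    have mem: "{x. \<forall>k\<in>{..<length w}. x k \<in> {w ! k}} \<in> sets ?M"
      unfolding setsM using open_agree[of "length w" "\<lambda>k. w ! k"]
      by (intro borel_open) (simp add: Ball_def)
    have "emeasure \<nu> (cylinder d w) = emeasure ?M (cylinder d w)"
      unfolding \<nu>_def using Sig by (intro emeasure_restrict_space) (auto simp: cylinder_def spM)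
    also have "\<dots> = emeasure ?M {x. \<forall>k\<in>{..<length w}. x k \<in> {w ! k}}"
    proof (rule emeasure_eq_AE)
      show "AE x in ?M. x \<in> cylinder d w \<longleftrightarrow> x \<in> {x. \<forall>k\<in>{..<length w}. x k \<in> {w ! k}}"
        using AE by eventually_elim (auto simp: cylinder_def)
      show "cylinder d w \<in> sets ?M"
        unfolding cylinder_eq_Int_open using sets.Int[OF Sig mem] by (simp add: Ball_def)
    qed (rule mem)
    also have "\<dots> = (\<Prod>k<length w. ennreal (q (w ! k)))"
      unfolding rect[OF finite_lessThan] using w
      by (intro prod.cong refl) (auto simp: emeasure_pmf_single pmfQ q'_def subsetD[OF w nth_mem])
    also have "\<dots> = ennreal (\<Prod>k<length w. q (w ! k))"
      by (intro prod_ennreal q subsetD[OF w nth_mem]) auto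
    also have "(\<Prod>k<length w. q (w ! k)) = prod_list (map q w)"
      by (simp add: prod.list_conv_set_nth atLeast0LessThan)
    finally have "emeasure \<nu> (cylinder d w) = ennreal (prod_list (map q w))" .
    moreover have "0 \<le> prod_list (map q w)" using w q by (intro prod_list_nonneg) auto
    ultimately show "measure \<nu> (cylinder d w) = prod_list (map q w)"
      by (simp add: measure_def)
  qed
qed

section \<open>Gibbs measures\<close>

lemma is_gibbs_measureD:
  assumes "is_gibbs_measure d \<Phi> u \<mu>"
  shows "prob_space \<mu>" "sets \<mu> = sets (shift_sigma d)" "distr \<mu> \<mu> shift = \<mu>"
  using assms unfolding is_gibbs_measure_def by blast+

context ratio_ifs
begin

abbreviation gibbs_factor :: "real \<Rightarrow> nat \<Rightarrow> (nat \<Rightarrow> nat) \<Rightarrow> real" where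
  "gibbs_factor u n x \<equiv> exp (u * birkhoff n (geom_potential \<Phi>) x - real n * pressure_fun d \<Phi> u)"

definition weight :: "real \<Rightarrow> nat \<Rightarrow> real" where
  "weight u i = exp (u * \<rho> i) / partition_sum u"

lemma weight_pos: "0 < weight u i"
  unfolding weight_def using partition_sum_pos by simp

lemma sum_weight: "(\<Sum>i\<in>alphabet d. weight u i) = 1"
  unfolding weight_def using partition_sum_pos[of u]
  by (simp add: partition_sum_def flip: sum_divide_distrib)

lemma prod_weight: "prod_list (map (weight u) w) = exp (u * sum_list (map \<rho> w) - length w * ln (partition_sum u))"
proof (induction w)
  case (Cons i w)
  have "weight u i = exp (u * \<rho> i - ln (partition_sum u))"
    unfolding weight_def exp_diff using partition_sum_pos[of u] by simp
  then show ?case using Cons by (simp add: algebra_simps flip: exp_add)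
qed simp

lemma bernoulli_weight_exists:
  obtains \<nu> where "bernoulli d (weight u) \<nu>"
  using bernoulli_measure_exists[of d "weight u"] weight_pos[of u] sum_weight[of u]
  by (auto simp: less_imp_le)

lemma gibbs_weight_bounds:
  obtains c where "c \<ge> 1"
    "\<And>n w x. w \<in> words d n \<Longrightarrow> x \<in> cylinder d w \<Longrightarrow>
      comparable c (gibbs_factor u n x) (prod_list (map (weight u) w))"
proof -
  obtain K where K: "K > 0" "\<And>x n. x \<in> shift_space d \<Longrightarrow>
    \<bar>birkhoff n (geom_potential \<Phi>) x - letter_sum \<rho> n x\<bar> \<le> K" using birkhoff_letter_sum by metis
  show ?thesis
  proof (rule that[of "exp (\<bar>u\<bar> * K)"])
    show "1 \<le> exp (\<bar>u\<bar> * K)" using K(1) by simp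
    fix n w x assume w: "w \<in> words d n" and x: "x \<in> cylinder d w"
    have xs: "x \<in> shift_space d" using x by (simp add: cylinder_def)
    have len: "length w = n" using w by (simp add: words_def)
    have "\<bar>u * birkhoff n (geom_potential \<Phi>) x - u * sum_list (map \<rho> w)\<bar> =
        \<bar>u\<bar> * \<bar>birkhoff n (geom_potential \<Phi>) x - letter_sum \<rho> n x\<bar>"
      unfolding letter_sum_cylinder[OF w x] by (simp flip: abs_mult right_diff_distrib)
    also have "\<dots> \<le> \<bar>u\<bar> * K" by (intro mult_left_mono K xs) auto
    finally have le: "\<bar>u * birkhoff n (geom_potential \<Phi>) x - u * sum_list (map \<rho> w)\<bar> \<le> \<bar>u\<bar> * K" .
    show "comparable (exp (\<bar>u\<bar> * K)) (gibbs_factor u n x) (prod_list (map (weight u) w))"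
      unfolding prod_weight pressure_fun_eq len exp_add[symmetric] exp_le_cancel_iff
      using le by linarith
  qed
qed

lemma gibbs_exists: "\<exists>\<nu>. is_gibbs_measure d \<Phi> u \<nu>"
proof -
  obtain \<nu> where "bernoulli d (weight u) \<nu>" using bernoulli_weight_exists .
  then interpret bernoulli d "weight u" \<nu> .
  obtain c where c: "c \<ge> 1"
    "\<And>n w x. w \<in> words d n \<Longrightarrow> x \<in> cylinder d w \<Longrightarrow>
      comparable c (gibbs_factor u n x) (prod_list (map (weight u) w))"
    using gibbs_weight_bounds[of u] by metis
  have "is_gibbs_measure d \<Phi> u \<nu>"
    unfolding is_gibbs_measure_def Let_def
  proof (intro conjI exI[of _ c] ballI allI)
    fix n w x assume w: "w \<in> words d n" and x: "x \<in> cylinder d w"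
    have m: "measure \<nu> (cylinder d w) = prod_list (map (weight u) w)"
      using cyl_\<nu> w by (simp add: words_def)
    show "gibbs_factor u n x / c
        \<le> measure \<nu> (cylinder d w)"
      unfolding m using c(1) c(2)[OF w x] by (simp add: field_simps)
    show "measure \<nu> (cylinder d w)
        \<le> c * gibbs_factor u n x"
      unfolding m using c(2)[OF w x] by blast
  qed (use prob_\<nu> sets_\<nu> c(1) shift_invariant in auto)
  then show ?thesis by blast
qed

text \<open>The Gibbs bounds say that the cylinder weights are comparable to Bernoulli weights; for an
  invariant measure this forces equality.\<close>

lemma gibbs_cylinder:
  assumes \<mu>: "is_gibbs_measure d \<Phi> u \<mu>" and w: "set w \<subseteq> alphabet d"
  shows "measure \<mu> (cylinder d w) = prod_list (map (weight u) w)"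
proof -
  note \<mu>1 = is_gibbs_measureD(1)[OF \<mu>] and \<mu>2 = is_gibbs_measureD(2)[OF \<mu>]
    and \<mu>3 = is_gibbs_measureD(3)[OF \<mu>]
  interpret prob_space \<mu> by fact
  obtain c1 where c1: "c1 \<ge> 1" "\<And>n w x. w \<in> words d n \<Longrightarrow> x \<in> cylinder d w \<Longrightarrow>
      gibbs_factor u n x / c1 \<le> measure \<mu> (cylinder d w) \<and> measure \<mu> (cylinder d w) \<le> c1 * gibbs_factor u n x"
    using \<mu> unfolding is_gibbs_measure_def Let_def by blast
  obtain c2 where c2: "c2 \<ge> 1" "\<And>n w x. w \<in> words d n \<Longrightarrow> x \<in> cylinder d w \<Longrightarrow>
      comparable c2 (gibbs_factor u n x) (prod_list (map (weight u) w))"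
    using gibbs_weight_bounds[of u] by metis
  show ?thesis
  proof (rule invariant_weights_eq_bernoulli[of d "\<lambda>w. measure \<mu> (cylinder d w)"
        "\<lambda>w. prod_list (map (weight u) w)" "c1 * c2" w "length w"])
    fix n v assume v: "v \<in> words d n"
    obtain x where x: "x \<in> cylinder d v" using cylinder_nonempty[OF v] by blast
    have "0 < gibbs_factor u n x / c1" using c1(1) by simp
    then show "0 < measure \<mu> (cylinder d v)" using c1(2)[OF v x] by linarith
    have "measure \<mu> (cylinder d v) \<le> c1 * gibbs_factor u n x" using c1(2)[OF v x] by blast
    also have "\<dots> \<le> c1 * (c2 * prod_list (map (weight u) v))"
      using c2(2)[OF v x] c1(1) by (intro mult_left_mono) auto
    finally show "measure \<mu> (cylinder d v) \<le> c1 * c2 * prod_list (map (weight u) v)" by simp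
  next
    show "measure \<mu> (cylinder d []) = 1"
      using prob_space sets_eq_imp_space_eq[OF \<mu>2] by (simp add: cylinder_Nil)
    show "(\<Sum>w\<in>words d n. prod_list (map (weight u) w)) = 1" for n
      unfolding sum_words_prod sum_weight by simp
    show "0 < prod_list (map (weight u) v)" for v unfolding prod_weight by simp
  next
    show "(\<Sum>v\<in>words d n. measure \<mu> (cylinder d (v' @ v))) = measure \<mu> (cylinder d v')" for n v'
      by (rule measure_cylinder_append[OF finite_measure_axioms \<mu>2])
    show "(\<Sum>v'\<in>words d n. measure \<mu> (cylinder d (v' @ v))) = measure \<mu> (cylinder d v)" for n v
      by (rule measure_cylinder_prepend[OF finite_measure_axioms \<mu>2 \<mu>3])
    show "w \<in> words d (length w)" using w by (simp add: words_def)
    show "prod_list (map (weight u) (v @ v')) =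
        prod_list (map (weight u) v) * prod_list (map (weight u) v')" for v v' by simp
  qed
qed

lemma gibbs_measure_is_gibbs: "is_gibbs_measure d \<Phi> u (gibbs_measure d \<Phi> u)"
proof -
  obtain \<nu> where \<nu>: "is_gibbs_measure d \<Phi> u \<nu>" using gibbs_exists by blast
  have "\<mu> = \<nu>" if "is_gibbs_measure d \<Phi> u \<mu>" for \<mu>
    by (rule measure_eq_on_cylinders[OF is_gibbs_measureD(1,2)[OF that] is_gibbs_measureD(1,2)[OF \<nu>]])
      (simp add: gibbs_cylinder[OF that] gibbs_cylinder[OF \<nu>])
  then show ?thesis unfolding gibbs_measure_def using \<nu> by (rule theI[rotated])
qed

end

text \<open>The weight of the cylinder of a single letter is \<open>exp (u * \<rho> i) / partition_sum u\<close>. Equal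
  pressures cancel the denominators, and \<open>u \<noteq> 0\<close> allows to solve for \<open>\<rho> i\<close>.\<close>

lemma gibbs_equal_iff:
  assumes "ratio_ifs d \<Phi> \<rho>" "ratio_ifs d \<Psi> \<tau>"
  shows "(\<exists>u. u \<noteq> 0 \<and> gibbs_equal_upto_perm d \<Phi> u \<Psi> u \<and> pressure_fun d \<Phi> u = pressure_fun d \<Psi> u) \<longleftrightarrow>
    (\<exists>p. p permutes alphabet d \<and> (\<forall>i\<in>alphabet d. \<rho> i = \<tau> (p i)))"
proof -
  interpret P: ratio_ifs d \<Phi> \<rho> by fact
  interpret Q: ratio_ifs d \<Psi> \<tau> by fact
  show ?thesis
  proof
    assume "\<exists>u. u \<noteq> 0 \<and> gibbs_equal_upto_perm d \<Phi> u \<Psi> u \<and> pressure_fun d \<Phi> u = pressure_fun d \<Psi> u"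
    then obtain u p where u: "u \<noteq> 0" "pressure_fun d \<Phi> u = pressure_fun d \<Psi> u"
      and p: "p permutes alphabet d" "gibbs_measure d \<Phi> u = gibbs_measure d (permute_gens p \<Psi>) u"
      unfolding gibbs_equal_upto_perm_def by blast
    interpret R: ratio_ifs d "permute_gens p \<Psi>" "\<lambda>i. \<tau> (p i)"
      by (rule ratio_ifs_permute_gens[OF p(1) assms(2)])
    have "R.partition_sum u = Q.partition_sum u"
      unfolding R.partition_sum_def Q.partition_sum_def
      using sum.permute[OF p(1), of "\<lambda>i. exp (u * \<tau> i)"] by (simp add: comp_def)
    then have Z: "R.partition_sum u = P.partition_sum u"
      using u(2) P.partition_sum_pos[of u] Q.partition_sum_pos[of u]
      unfolding P.pressure_fun_eq Q.pressure_fun_eq by simp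
    have "\<rho> i = \<tau> (p i)" if i: "i \<in> alphabet d" for i
    proof -
      have "P.weight u i = R.weight u i"
        using P.gibbs_cylinder[OF P.gibbs_measure_is_gibbs, of "[i]" u]
          R.gibbs_cylinder[OF R.gibbs_measure_is_gibbs, of "[i]" u] i p(2) by simp
      then show ?thesis
        unfolding P.weight_def R.weight_def Z using P.partition_sum_pos[of u] u(1) by simp
    qed
    then show "\<exists>p. p permutes alphabet d \<and> (\<forall>i\<in>alphabet d. \<rho> i = \<tau> (p i))" using p(1) by blast
  next
    assume ex: "\<exists>p. p permutes alphabet d \<and> (\<forall>i\<in>alphabet d. \<rho> i = \<tau> (p i))"
    then obtain p where p: "p permutes alphabet d" "\<forall>i\<in>alphabet d. \<rho> i = \<tau> (p i)" by blast
    interpret R: ratio_ifs d "permute_gens p \<Psi>" "\<lambda>i. \<tau> (p i)"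
      by (rule ratio_ifs_permute_gens[OF p(1) assms(2)])
    have press: "pressure_fun d \<Phi> = pressure_fun d \<Psi>" using pressure_fun_eq_iff[OF assms] ex by blast
    have Z: "P.partition_sum 1 = R.partition_sum 1"
      unfolding P.partition_sum_def R.partition_sum_def using p(2) by (intro sum.cong) auto
    have wt: "P.weight 1 i = R.weight 1 i" if "i \<in> alphabet d" for i
      unfolding P.weight_def R.weight_def Z using p(2) that by simp
    have "gibbs_measure d \<Phi> 1 = gibbs_measure d (permute_gens p \<Psi>) 1"
    proof (rule measure_eq_on_cylinders[OF
          is_gibbs_measureD(1,2)[OF P.gibbs_measure_is_gibbs]
          is_gibbs_measureD(1,2)[OF R.gibbs_measure_is_gibbs]])
      fix w assume w: "set w \<subseteq> alphabet d"
      then have "map (P.weight 1) w = map (R.weight 1) w" using wt by auto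
      then show "measure (gibbs_measure d \<Phi> 1) (cylinder d w) =
          measure (gibbs_measure d (permute_gens p \<Psi>) 1) (cylinder d w)"
        using P.gibbs_cylinder[OF P.gibbs_measure_is_gibbs w, of 1]
          R.gibbs_cylinder[OF R.gibbs_measure_is_gibbs w, of 1] by metis
    qed
    then show "\<exists>u. u \<noteq> 0 \<and> gibbs_equal_upto_perm d \<Phi> u \<Psi> u \<and> pressure_fun d \<Phi> u = pressure_fun d \<Psi> u"
      unfolding gibbs_equal_upto_perm_def using press p(1) by (intro exI[of _ 1]) auto
  qed
qed

section \<open>Sets of Hausdorff measure zero\<close>

lemma hausdorff_null_cover:
  assumes "hausdorff_measure s A = 0" "\<epsilon> > 0"
  obtains V where "A \<subseteq> (\<Union>k::nat. V k)" "\<And>k. bounded (V k)"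
    "(\<Sum>k. ennreal (diameter (V k) powr s)) < ennreal \<epsilon>"
proof -
  have "hausdorff_premeasure s 1 A \<le> hausdorff_measure s A"
    unfolding hausdorff_measure_def by (intro SUP_upper) auto
  then have "hausdorff_premeasure s 1 A < ennreal \<epsilon>" using assms by simp
  then show ?thesis unfolding hausdorff_premeasure_def Inf_less_iff using that by blast
qed

text \<open>A cover with a small total only has sets of small diameter, so it is admissible for the
  premeasure at a given scale \<open>\<delta>\<close> as soon as the total is at most \<open>\<delta> powr s\<close>.\<close>

lemma hausdorff_null_coverI:
  assumes "s > 0"
    and cover: "\<And>\<epsilon>. \<epsilon> > 0 \<Longrightarrow> \<exists>V. A \<subseteq> (\<Union>k::nat. V k) \<and> (\<forall>k. bounded (V k)) \<and>
        (\<Sum>k. ennreal (diameter (V k) powr s)) \<le> ennreal \<epsilon>"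
  shows "hausdorff_measure s A = 0"
proof -
  have "hausdorff_premeasure s \<delta> A \<le> ennreal \<eta>" if "\<delta> > 0" "\<eta> > 0" for \<delta> \<eta>
  proof -
    define \<epsilon> where "\<epsilon> = min \<eta> (\<delta> powr s)"
    have "\<epsilon> > 0" using that by (simp add: \<epsilon>_def)
    then obtain V where V: "A \<subseteq> (\<Union>k::nat. V k)" "\<And>k. bounded (V k)"
      "(\<Sum>k. ennreal (diameter (V k) powr s)) \<le> ennreal \<epsilon>" using cover by blast
    have "diameter (V k) \<le> \<delta>" for k
    proof (rule ccontr)
      assume "\<not> diameter (V k) \<le> \<delta>"
      then have "\<delta> powr s < diameter (V k) powr s"
        using \<open>s > 0\<close> that by (intro powr_less_mono2) auto
      then have "ennreal \<epsilon> < ennreal (diameter (V k) powr s)"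
        using \<open>\<epsilon> > 0\<close> by (intro ennreal_lessI) (auto simp: \<epsilon>_def)
      also have "\<dots> = (\<Sum>i\<in>{k}. ennreal (diameter (V i) powr s))" by simp
      also have "\<dots> \<le> (\<Sum>k. ennreal (diameter (V k) powr s))"
        by (rule sum_le_suminf) auto
      finally show False using V(3) by (meson not_le)
    qed
    then have "hausdorff_premeasure s \<delta> A \<le> (\<Sum>k. ennreal (diameter (V k) powr s))"
      unfolding hausdorff_premeasure_def using V(1,2)
      by (intro Inf_lower CollectI exI[of _ V]) blast
    also have "\<dots> \<le> ennreal \<epsilon>" by (rule V(3))
    also have "\<dots> \<le> ennreal \<eta>" by (intro ennreal_leI) (simp add: \<epsilon>_def)
    finally show ?thesis .
  qed
  note small = this
  have "hausdorff_premeasure s \<delta> A \<le> 0" if "\<delta> > 0" for \<delta>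
  proof (rule ennreal_le_epsilon)
    show "hausdorff_premeasure s \<delta> A \<le> 0 + ennreal \<eta>" if "\<eta> > 0" for \<eta>
      using small[OF \<open>\<delta> > 0\<close> that] by (simp only: add_0)
  qed
  then have "hausdorff_measure s A \<le> 0"
    unfolding hausdorff_measure_def by (intro SUP_least) (simp only: greaterThan_iff)
  then show ?thesis by (simp only: le_zero_eq)
qed

lemma hausdorff_null_lipschitz:
  fixes f g :: "'a \<Rightarrow> real"
  assumes "s > 0" "L > 0"
    and L: "\<And>x y. x \<in> S \<Longrightarrow> y \<in> S \<Longrightarrow> \<bar>g x - g y\<bar> \<le> L * \<bar>f x - f y\<bar>"
    and null: "hausdorff_measure s (f ` S) = 0"
  shows "hausdorff_measure s (g ` S) = 0"
proof (rule hausdorff_null_coverI[OF \<open>s > 0\<close>])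
  fix \<epsilon> :: real assume "\<epsilon> > 0"
  define \<epsilon>' where "\<epsilon>' = \<epsilon> / L powr s"
  have "\<epsilon>' > 0" using \<open>\<epsilon> > 0\<close> \<open>L > 0\<close> by (simp add: \<epsilon>'_def)
  then obtain V where V: "f ` S \<subseteq> (\<Union>k::nat. V k)" "\<And>k. bounded (V k)"
    "(\<Sum>k. ennreal (diameter (V k) powr s)) < ennreal \<epsilon>'"
    using hausdorff_null_cover[OF null] by metis
  define W where "W k = g ` {x \<in> S. f x \<in> V k}" for k
  have dist: "\<bar>p - q\<bar> \<le> L * diameter (V k)" if pq: "p \<in> W k" "q \<in> W k" for p q k
  proof -
    obtain x y where xy: "x \<in> S" "f x \<in> V k" "p = g x" "y \<in> S" "f y \<in> V k" "q = g y"
      using pq by (auto simp: W_def)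
    have "\<bar>f x - f y\<bar> \<le> diameter (V k)"
      using diameter_bounded_bound[OF V(2) xy(2,5)] by (simp add: dist_real_def)
    then have "L * \<bar>f x - f y\<bar> \<le> L * diameter (V k)" using \<open>L > 0\<close> by (intro mult_left_mono) auto
    then show ?thesis using L[OF xy(1,4)] xy by simp
  qed
  have bdW: "bounded (W k)" for k
    unfolding bounded_two_points dist_real_def using dist by blast
  have diamW: "diameter (W k) \<le> L * diameter (V k)" for k
    by (rule diameter_le) (use dist diameter_ge_0[OF V(2)] \<open>L > 0\<close> in auto)
  have "(\<Sum>k. ennreal (diameter (W k) powr s)) \<le> (\<Sum>k. ennreal (L powr s) * ennreal (diameter (V k) powr s))"
  proof (rule suminf_le)
    fix k
    have "diameter (W k) powr s \<le> (L * diameter (V k)) powr s"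
      using diamW \<open>s > 0\<close> diameter_ge_0[OF bdW] by (intro powr_mono2) auto
    also have "\<dots> = L powr s * diameter (V k) powr s"
      using \<open>L > 0\<close> diameter_ge_0[OF V(2)] by (intro powr_mult) 
    finally show "ennreal (diameter (W k) powr s) \<le> ennreal (L powr s) * ennreal (diameter (V k) powr s)"
      by (simp add: ennreal_mult[symmetric] ennreal_leI)
  qed auto
  also have "\<dots> = ennreal (L powr s) * (\<Sum>k. ennreal (diameter (V k) powr s))"
    by (rule ennreal_suminf_cmult)
  also have "\<dots> \<le> ennreal (L powr s) * ennreal \<epsilon>'" using V(3) by (intro mult_left_mono) auto
  also have "\<dots> = ennreal \<epsilon>" using \<open>L > 0\<close> \<open>\<epsilon>' > 0\<close>
    by (simp add: ennreal_mult[symmetric] \<epsilon>'_def)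
  finally have le: "(\<Sum>k. ennreal (diameter (W k) powr s)) \<le> ennreal \<epsilon>" .
  have "g ` S \<subseteq> (\<Union>k. W k)" using V(1) by (fastforce simp: W_def)
  then show "\<exists>V. g ` S \<subseteq> (\<Union>k::nat. V k) \<and> (\<forall>k. bounded (V k)) \<and>
      (\<Sum>k. ennreal (diameter (V k) powr s)) \<le> ennreal \<epsilon>"
    using bdW le by blast
qed

lemma hausdorff_dim_bilipschitz:
  fixes f g :: "'a \<Rightarrow> real"
  assumes "L > 0"
    and L: "\<And>x y. x \<in> S \<Longrightarrow> y \<in> S \<Longrightarrow> comparable L \<bar>g x - g y\<bar> \<bar>f x - f y\<bar>"
  shows "hausdorff_dim (f ` S) = hausdorff_dim (g ` S)"
proof -
  have "hausdorff_measure s (f ` S) = 0 \<longleftrightarrow> hausdorff_measure s (g ` S) = 0" if "s > 0" for s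
    using hausdorff_null_lipschitz[OF that \<open>L > 0\<close>, of S g f]
      hausdorff_null_lipschitz[OF that \<open>L > 0\<close>, of S f g] L by blast
  then have "{ennreal s | s. s > 0 \<and> hausdorff_measure s (f ` S) = 0} =
      {ennreal s | s. s > 0 \<and> hausdorff_measure s (g ` S) = 0}" by blast
  then show ?thesis unfolding hausdorff_dim_def by (rule arg_cong)
qed

section \<open>Level sets\<close>

definition level_set :: "nat \<Rightarrow> (nat \<Rightarrow> real) \<Rightarrow> real \<Rightarrow> (nat \<Rightarrow> nat) set" where
  "level_set d \<rho> \<alpha> = {x \<in> shift_space d. (\<lambda>n. letter_sum \<rho> n x / (- real n)) \<longlonglongrightarrow> \<alpha>}"

context ratio_ifs
begin

lemma lyapunov_spectrum_eq:
  "lyapunov_spectrum d \<Phi> \<alpha> = hausdorff_dim (coding \<Phi> ` level_set d \<rho> \<alpha>)"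
proof -
  obtain K where K: "K > 0" "\<And>x n. x \<in> shift_space d \<Longrightarrow>
    \<bar>birkhoff n (geom_potential \<Phi>) x - letter_sum \<rho> n x\<bar> \<le> K" using birkhoff_letter_sum by metis
  have "(\<lambda>n. birkhoff n (geom_potential \<Phi>) x / (- real n)) \<longlonglongrightarrow> \<alpha> \<longleftrightarrow>
      (\<lambda>n. letter_sum \<rho> n x / (- real n)) \<longlonglongrightarrow> \<alpha>" if x: "x \<in> shift_space d" for x
  proof -
    have "(\<lambda>n. birkhoff n (geom_potential \<Phi>) x / (- real n) - letter_sum \<rho> n x / (- real n)) \<longlonglongrightarrow> 0"
    proof (rule Lim_null_comparison)
      show "\<forall>\<^sub>F n in sequentially. norm (birkhoff n (geom_potential \<Phi>) x / (- real n) -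
          letter_sum \<rho> n x / (- real n)) \<le> K / real n"
      proof (intro always_eventually allI)
        fix n
        have "norm (birkhoff n (geom_potential \<Phi>) x / (- real n) - letter_sum \<rho> n x / (- real n)) =
            \<bar>birkhoff n (geom_potential \<Phi>) x - letter_sum \<rho> n x\<bar> / real n"
          by (simp add: abs_minus_commute flip: diff_divide_distrib)
        also have "\<dots> \<le> K / real n" by (intro divide_right_mono K x) auto
        finally show "norm (birkhoff n (geom_potential \<Phi>) x / (- real n) -
          letter_sum \<rho> n x / (- real n)) \<le> K / real n" .
      qed
      show "(\<lambda>n. K / real n) \<longlonglongrightarrow> 0" by (rule lim_const_over_n)
    qed
    then show ?thesis by (rule Lim_transform_eq)
  qed
  then have "{x \<in> shift_space d. (\<lambda>n. birkhoff n (geom_potential \<Phi>) x / (- real n)) \<longlonglongrightarrow> \<alpha>} =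
      level_set d \<rho> \<alpha>" unfolding level_set_def by blast
  then show ?thesis unfolding lyapunov_spectrum_def by simp
qed

end

text \<open>The map \<open>x \<mapsto> p \<circ> x\<close> is a bijection of the shift space that carries the coding and the
  Birkhoff sums of the permuted system to those of \<open>\<Psi>\<close>.\<close>

lemma lyapunov_spectrum_permute_gens:
  assumes p: "p permutes alphabet d"
  shows "lyapunov_spectrum d (permute_gens p \<Psi>) = lyapunov_spectrum d \<Psi>"
proof
  fix \<alpha>
  let ?P = "\<lambda>y. (\<lambda>n. birkhoff n (geom_potential \<Psi>) y / (- real n)) \<longlonglongrightarrow> \<alpha>"
  have "y \<in> (\<lambda>x. p \<circ> x) ` {x \<in> shift_space d. ?P (p \<circ> x)}" if y: "y \<in> shift_space d" "?P y" for y
  proof -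
    have "p \<circ> (inv p \<circ> y) = y" using permutes_inv_o(1)[OF p] by (simp flip: comp_assoc)
    moreover have "inv p \<circ> y \<in> shift_space d"
      by (rule permuted_in_shift_space[OF permutes_inv[OF p] y(1)])
    ultimately show ?thesis using y(2) by (intro image_eqI[of _ _ "inv p \<circ> y"]) auto
  qed
  then have "(\<lambda>x. p \<circ> x) ` {x \<in> shift_space d. ?P (p \<circ> x)} = {y \<in> shift_space d. ?P y}"
    using permuted_in_shift_space[OF p] by blast
  then have "coding \<Psi> ` {y \<in> shift_space d. ?P y} =
      (\<lambda>x. coding \<Psi> (p \<circ> x)) ` {x \<in> shift_space d. ?P (p \<circ> x)}"
    by (metis (no_types, lifting) image_cong image_image)
  then show "lyapunov_spectrum d (permute_gens p \<Psi>) \<alpha> = lyapunov_spectrum d \<Psi> \<alpha>"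
    unfolding lyapunov_spectrum_def birkhoff_permute_gens coding_permute_gens by simp
qed

lemma lyapunov_spectrum_cong:
  assumes "ratio_ifs d \<Phi> \<rho>" "ratio_ifs d \<Psi> \<tau>" and eq: "\<forall>i\<in>alphabet d. \<rho> i = \<tau> i"
  shows "lyapunov_spectrum d \<Phi> = lyapunov_spectrum d \<Psi>"
proof
  fix \<alpha>
  interpret P: ratio_ifs d \<Phi> \<rho> by fact
  interpret Q: ratio_ifs d \<Psi> \<tau> by fact
  have level: "level_set d \<tau> \<alpha> = level_set d \<rho> \<alpha>"
    unfolding level_set_def by (auto simp: letter_sum_cong[OF eq])
  have "equivalent d \<Phi> \<Psi>" using equivalent_iff_ratios_eq[OF assms(1,2)] eq by blast
  then obtain L where "L > 0" "\<And>x y. x \<in> shift_space d \<Longrightarrow> y \<in> shift_space d \<Longrightarrow>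
       comparable L (code_dist \<Psi> x y) (code_dist \<Phi> x y)"
    unfolding equivalent_iff_coding_bilipschitz[OF P.d2 P.CS Q.CS] by blast
  then show "lyapunov_spectrum d \<Phi> \<alpha> = lyapunov_spectrum d \<Psi> \<alpha>"
    unfolding P.lyapunov_spectrum_eq Q.lyapunov_spectrum_eq level
    by (intro hausdorff_dim_bilipschitz) (auto simp: level_set_def)
qed

section \<open>Upper bound for the spectrum\<close>

context ratio_ifs
begin

lemma letter_sum_antimono:
  assumes "x \<in> shift_space d" "n \<le> m"
  shows "letter_sum \<rho> m x \<le> letter_sum \<rho> n x"
  unfolding letter_sum_def
  by (rule sum_mono2[of "{..<m}" "{..<n}" "\<lambda>k. - \<rho> (x k)", unfolded sum_negf neg_le_iff_le])
    (use assms ratio_neg[OF letter_in_alphabet[OF assms(1)]] in \<open>auto simp: less_imp_le\<close>)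

lemma coding_cylinder_diameter:
  obtains K where "K > 0"
    "\<And>w n. w \<in> words d n \<Longrightarrow> bounded (coding \<Phi> ` cylinder d w) \<and>
      diameter (coding \<Phi> ` cylinder d w) \<le> K * exp (sum_list (map \<rho> w))"
proof -
  obtain K where "controls_distances d \<Phi> K (letter_sum \<rho>)"
    using ratio_metric by blast
  note K = controls_distancesD[OF this]
  show ?thesis
  proof (rule that[OF K(1)])
    fix w n assume w: "w \<in> words d n"
    have "code_dist \<Phi> x y \<le> K * exp (sum_list (map \<rho> w))"
      if x: "x \<in> cylinder d w" and y: "y \<in> cylinder d w" for x y
    proof (cases "x = y")
      case False
      then obtain m where m: "\<forall>k<m. x k = y k" "x m \<noteq> y m" using first_difference by blast
      have xs: "x \<in> shift_space d" "y \<in> shift_space d" using x y by (auto simp: cylinder_def)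
      have "n \<le> m" using m(2) x y w by (auto simp: cylinder_def words_def not_less[symmetric])
      then have "exp (letter_sum \<rho> m x) \<le> exp (sum_list (map \<rho> w))"
        using letter_sum_antimono[OF xs(1)] letter_sum_cylinder[OF w x, of \<rho>] by (metis exp_le_cancel_iff)
      then have "K * exp (letter_sum \<rho> m x) \<le> K * exp (sum_list (map \<rho> w))"
        using K(1) by (intro mult_left_mono) auto
      then show ?thesis using K(2)[OF xs m] by simp
    qed (use K(1) in simp)
    then have *: "\<bar>p - q\<bar> \<le> K * exp (sum_list (map \<rho> w))"
      if "p \<in> coding \<Phi> ` cylinder d w" "q \<in> coding \<Phi> ` cylinder d w" for p q
      using that by blast
    have "bounded (coding \<Phi> ` cylinder d w)"
      unfolding bounded_two_points dist_real_def using * by blast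
    moreover have "diameter (coding \<Phi> ` cylinder d w) \<le> K * exp (sum_list (map \<rho> w))"
      by (rule diameter_le) (use * K(1) in auto)
    ultimately show "bounded (coding \<Phi> ` cylinder d w) \<and>
      diameter (coding \<Phi> ` cylinder d w) \<le> K * exp (sum_list (map \<rho> w))" ..
  qed
qed

text \<open>The level set is covered by all long words whose averaged letter sum is close to \<open>-\<alpha>\<close>. Writing
  the \<open>t\<close>-th power of the diameter as \<open>e\<^bsup>u\<rho>(w)\<^esup> e\<^bsup>(t-u)\<rho>(w)\<^esup>\<close> and using \<open>\<rho>(w) \<approx> -n\<alpha>\<close> in the second
  factor, the words of length \<open>n\<close> contribute at most \<open>exp (n (P(u) + u\<alpha> - t\<alpha> + small))\<close>.\<close>

lemma level_set_null:
  assumes "t > 0" and t: "ln (partition_sum u) + u * \<alpha> < t * \<alpha>"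
  shows "hausdorff_measure t (coding \<Phi> ` level_set d \<rho> \<alpha>) = 0"
proof (rule hausdorff_null_coverI[OF \<open>t > 0\<close>])
  fix \<epsilon>0 :: real assume "\<epsilon>0 > 0"
  obtain K where K: "K > 0" "\<And>w n. w \<in> words d n \<Longrightarrow> bounded (coding \<Phi> ` cylinder d w)"
    "\<And>w n. w \<in> words d n \<Longrightarrow> diameter (coding \<Phi> ` cylinder d w) \<le> K * exp (sum_list (map \<rho> w))"
    using coding_cylinder_diameter by metis
  define \<eta> where "\<eta> = t * \<alpha> - ln (partition_sum u) - u * \<alpha>"
  have "\<eta> > 0" using t by (simp add: \<eta>_def)
  define \<epsilon> where "\<epsilon> = \<eta> / (2 * (\<bar>t - u\<bar> + 1))"
  have "\<epsilon> > 0" using \<open>\<eta> > 0\<close> unfolding \<epsilon>_def by (intro divide_pos_pos mult_pos_pos add_nonneg_pos) auto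
  have \<epsilon>: "\<bar>t - u\<bar> * \<epsilon> \<le> \<eta> / 2"
  proof -
    have "\<bar>t - u\<bar> * \<epsilon> \<le> (\<bar>t - u\<bar> + 1) * \<epsilon>" using \<open>\<epsilon> > 0\<close> by (intro mult_right_mono) auto
    also have "\<dots> = \<eta> / 2" 
    proof -
      have "c * (\<eta> / (2 * c)) = \<eta> / 2" if "c > 0" for c :: real using that by simp
      then show ?thesis unfolding \<epsilon>_def by (smt (verit) abs_ge_zero)
    qed
    finally show ?thesis .
  qed
  define G where "G n = {w \<in> words d n. \<bar>sum_list (map \<rho> w) + n * \<alpha>\<bar> \<le> \<epsilon> * n}" for n
  have finG: "finite (G n)" for n
    by (rule finite_subset[OF _ finite_words[of d n]]) (auto simp: G_def)
  define r where "r = exp (- \<eta> / 2)"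
  have r: "0 < r" "r < 1" using \<open>\<eta> > 0\<close> by (auto simp: r_def)
  have Gsum: "(\<Sum>w\<in>G n. exp (t * sum_list (map \<rho> w))) \<le> r ^ n" for n
  proof -
    let ?c = "exp (- (t - u) * (n * \<alpha>) + n * (\<eta> / 2))"
    have "exp (t * sum_list (map \<rho> w)) \<le> exp (u * sum_list (map \<rho> w)) * ?c" if "w \<in> G n" for w
    proof -
      have "\<bar>(t - u) * (sum_list (map \<rho> w) + n * \<alpha>)\<bar> \<le> \<bar>t - u\<bar> * (\<epsilon> * n)"
        unfolding abs_mult using that by (intro mult_left_mono) (auto simp: G_def)
      also have "\<dots> \<le> n * (\<eta> / 2)" using mult_right_mono[OF \<epsilon>, of "real n"] by (simp add: mult_ac)
      finally have "(t - u) * (sum_list (map \<rho> w) + n * \<alpha>) \<le> n * (\<eta> / 2)" by linarith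
      then show ?thesis unfolding exp_add[symmetric] exp_le_cancel_iff by (simp add: algebra_simps)
    qed
    then have "(\<Sum>w\<in>G n. exp (t * sum_list (map \<rho> w))) \<le> (\<Sum>w\<in>G n. exp (u * sum_list (map \<rho> w)) * ?c)"
      by (intro sum_mono)
    also have "\<dots> \<le> (\<Sum>w\<in>words d n. exp (u * sum_list (map \<rho> w)) * ?c)"
      by (intro sum_mono2 finite_words) (auto simp: G_def)
    also have "\<dots> = partition_sum u ^ n * ?c"
      using sum_words_exp[of "\<lambda>i. u * \<rho> i" d n]
      unfolding sum_list_const_mult_map partition_sum_def by (simp flip: sum_distrib_right)
    also have "partition_sum u ^ n = exp (n * ln (partition_sum u))"
      using partition_sum_pos[of u] by (simp add: exp_of_nat_mult)
    also have "exp (n * ln (partition_sum u)) * ?c = exp (n * (- \<eta> / 2))"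
    proof -
      have P: "ln (partition_sum u) = t * \<alpha> - u * \<alpha> - \<eta>" by (simp add: \<eta>_def)
      show ?thesis unfolding exp_add[symmetric] P by (simp add: algebra_simps)
    qed
    also have "\<dots> = r ^ n" unfolding r_def by (rule exp_of_nat_mult)
    finally show ?thesis .
  qed
  have "(\<lambda>M. K powr t * (r ^ M / (1 - r))) \<longlonglongrightarrow> K powr t * (0 / (1 - r))"
    using r by (intro tendsto_intros) auto
  then have "\<forall>\<^sub>F M in sequentially. K powr t * (r ^ M / (1 - r)) < \<epsilon>0"
    using \<open>\<epsilon>0 > 0\<close> by (intro order_tendstoD(2)) auto
  then obtain M where M: "K powr t * (r ^ M / (1 - r)) < \<epsilon>0" by (auto simp: eventually_sequentially)
  define good where "good w \<longleftrightarrow> M \<le> length w \<and> w \<in> G (length w)" for w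
  define V where "V k = (if good (list_decode k) then coding \<Phi> ` cylinder d (list_decode k) else {})" for k
  have goodw: "w \<in> words d (length w)" if "good w" for w using that by (auto simp: good_def G_def)
  have bV: "bounded (V k)" for k using K(2)[OF goodw] by (simp add: V_def)
  have cover: "coding \<Phi> ` level_set d \<rho> \<alpha> \<subseteq> (\<Union>k. V k)"
  proof
    fix p assume "p \<in> coding \<Phi> ` level_set d \<rho> \<alpha>"
    then obtain x where x: "x \<in> shift_space d" "p = coding \<Phi> x"
      "(\<lambda>n. letter_sum \<rho> n x / (- real n)) \<longlonglongrightarrow> \<alpha>" by (auto simp: level_set_def)
    have "\<forall>\<^sub>F n in sequentially. dist (letter_sum \<rho> n x / (- real n)) \<alpha> < \<epsilon>"
      using tendstoD[OF x(3) \<open>\<epsilon> > 0\<close>] .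
    then have "\<forall>\<^sub>F n in sequentially. dist (letter_sum \<rho> n x / (- real n)) \<alpha> < \<epsilon> \<and> n \<ge> max M 1"
      using eventually_ge_at_top[of "max M 1"] by eventually_elim auto
    then obtain n where n: "dist (letter_sum \<rho> n x / (- real n)) \<alpha> < \<epsilon>" "n \<ge> M" "n \<ge> 1"
      using eventually_happens[of _ sequentially] by fastforce
    let ?w = "prefix x n"
    have "letter_sum \<rho> n x + n * \<alpha> = - real n * (letter_sum \<rho> n x / (- real n) - \<alpha>)"
      using n(3) by (simp add: field_simps)
    then have "\<bar>letter_sum \<rho> n x + n * \<alpha>\<bar> = n * \<bar>letter_sum \<rho> n x / (- real n) - \<alpha>\<bar>"
      by (simp add: abs_mult)
    also have "\<dots> \<le> n * \<epsilon>" using n(1) by (intro mult_left_mono) (auto simp: dist_real_def)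
    finally have "good ?w"
      using n(2) prefix_in_words[OF x(1), of n]
      unfolding good_def G_def letter_sum_prefix by (simp add: mult.commute)
    moreover have "x \<in> cylinder d ?w" using x(1) by (simp add: mem_cylinder_iff)
    ultimately have "p \<in> V (list_encode ?w)" using x(2) by (simp add: V_def)
    then show "p \<in> (\<Union>k. V k)" by blast
  qed
  have partial: "(\<Sum>k<N. diameter (V k) powr t) \<le> K powr t * (r ^ M / (1 - r))" for N
  proof -
    let ?g = "\<lambda>w. K powr t * exp (t * sum_list (map \<rho> w))"
    let ?I = "{k \<in> {..<N}. good (list_decode k)}"
    define B where "B = Suc (Max (insert M ((\<lambda>k. length (list_decode k)) ` {..<N})))"
    have B: "length (list_decode k) < B" if "k < N" for k
      unfolding B_def using that by (intro le_imp_less_Suc Max_ge) auto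
    have diam_le: "diameter (V k) powr t \<le> ?g (list_decode k)" if "good (list_decode k)" for k
    proof -
      have V: "V k = coding \<Phi> ` cylinder d (list_decode k)" using that by (simp add: V_def)
      have "diameter (V k) powr t \<le> (K * exp (sum_list (map \<rho> (list_decode k)))) powr t"
        using \<open>t > 0\<close> diameter_ge_0[OF bV, of k] K(3)[OF goodw[OF that]]
        by (intro powr_mono2) (simp_all add: V)
      also have "\<dots> = ?g (list_decode k)"
        using K(1) by (simp add: powr_mult exp_powr_real mult.commute)
      finally show ?thesis .
    qed
    have "(\<Sum>k<N. diameter (V k) powr t) = (\<Sum>k\<in>?I. diameter (V k) powr t)"
      by (rule sum.mono_neutral_right) (auto simp: V_def)
    also have "\<dots> \<le> (\<Sum>k\<in>?I. ?g (list_decode k))" using diam_le by (intro sum_mono) auto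
    also have "\<dots> \<le> (\<Sum>k\<in>list_encode ` (\<Union>n\<in>{M..<B}. G n). ?g (list_decode k))"
    proof (rule sum_mono2)
      show "finite (list_encode ` (\<Union>n\<in>{M..<B}. G n))"
        using finG by blast
      show "?I \<subseteq> list_encode ` (\<Union>n\<in>{M..<B}. G n)"
      proof
        fix k assume k: "k \<in> ?I"
        then have "list_decode k \<in> (\<Union>n\<in>{M..<B}. G n)" using B by (auto simp: good_def)
        moreover have "k = list_encode (list_decode k)"
          by simp
        ultimately show "k \<in> list_encode ` (\<Union>n\<in>{M..<B}. G n)" by blast
      qed
    qed (use K(1) in auto)
    also have "\<dots> = (\<Sum>w\<in>(\<Union>n\<in>{M..<B}. G n). ?g w)"
      by (subst sum.reindex[OF inj_list_encode]) simp
    also have "\<dots> = (\<Sum>n\<in>{M..<B}. \<Sum>w\<in>G n. ?g w)"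
    proof (rule sum.UNION_disjoint)
      show "\<forall>n\<in>{M..<B}. finite (G n)" using finG by blast
      show "\<forall>n\<in>{M..<B}. \<forall>m\<in>{M..<B}. n \<noteq> m \<longrightarrow> G n \<inter> G m = {}" by (auto simp: G_def words_def)
    qed simp
    also have "\<dots> \<le> (\<Sum>n\<in>{M..<B}. K powr t * r ^ n)"
      unfolding sum_distrib_left[symmetric] using Gsum K(1) by (intro sum_mono mult_left_mono) auto
    also have "\<dots> = K powr t * (\<Sum>n\<in>{M..<B}. r ^ n)" by (simp add: sum_distrib_left)
    also have "(\<Sum>n\<in>{M..<B}. r ^ n) = r ^ M * (\<Sum>n<B - M. r ^ n)"
      unfolding sum.atLeastLessThan_shift_0[of _ M B]
      by (simp add: power_add sum_distrib_left atLeast0LessThan)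
    also have "K powr t * (r ^ M * (\<Sum>n<B - M. r ^ n)) \<le> K powr t * (r ^ M * (1 / (1 - r)))"
      using r by (intro mult_left_mono) (auto simp: sum_gp_strict divide_right_mono)
    also have "\<dots> = K powr t * (r ^ M / (1 - r))" by simp
    finally show ?thesis .
  qed
  have "(\<Sum>k. ennreal (diameter (V k) powr t)) \<le> ennreal \<epsilon>0"
    unfolding suminf_eq_SUP
  proof (rule SUP_least)
    fix N
    have "(\<Sum>k<N. ennreal (diameter (V k) powr t)) = ennreal (\<Sum>k<N. diameter (V k) powr t)"
      by (intro sum_ennreal) auto
    also have "\<dots> \<le> ennreal \<epsilon>0" using partial[of N] M by (intro ennreal_leI) linarith
    finally show "(\<Sum>k<N. ennreal (diameter (V k) powr t)) \<le> ennreal \<epsilon>0" .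
  qed
  then show "\<exists>V. coding \<Phi> ` level_set d \<rho> \<alpha> \<subseteq> (\<Union>k::nat. V k) \<and> (\<forall>k. bounded (V k)) \<and>
      (\<Sum>k. ennreal (diameter (V k) powr t)) \<le> ennreal \<epsilon>0"
    using cover bV by blast
qed

end

section \<open>The law of large numbers for Bernoulli measures\<close>

lemma prefix_event_eq:
  "{x \<in> shift_space d. P (prefix x n)} = (\<Union>w\<in>{w \<in> words d n. P w}. cylinder d w)"
proof
  show "{x \<in> shift_space d. P (prefix x n)} \<subseteq> (\<Union>w\<in>{w \<in> words d n. P w}. cylinder d w)"
  proof
    fix x assume "x \<in> {x \<in> shift_space d. P (prefix x n)}"
    then show "x \<in> (\<Union>w\<in>{w \<in> words d n. P w}. cylinder d w)"
      by (intro UN_I[of "prefix x n"]) (simp_all add: prefix_in_words mem_cylinder_iff)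
  qed
  show "(\<Union>w\<in>{w \<in> words d n. P w}. cylinder d w) \<subseteq> {x \<in> shift_space d. P (prefix x n)}"
  proof
    fix x assume "x \<in> (\<Union>w\<in>{w \<in> words d n. P w}. cylinder d w)"
    then obtain w where w: "w \<in> words d n" "P w" "x \<in> cylinder d w" by blast
    then have "prefix x n = w" "x \<in> shift_space d" by (auto simp: mem_cylinder_iff words_def)
    then show "x \<in> {x \<in> shift_space d. P (prefix x n)}" using w(2) by simp
  qed
qed

lemma prefix_event_sets:
  assumes "sets \<nu> = sets (shift_sigma d)"
  shows "{x \<in> shift_space d. P (prefix x n)} \<in> sets \<nu>"
  unfolding prefix_event_eq
  by (intro sets.finite_UN cylinder_in_sets[OF assms]) (simp add: finite_words)

lemma prefix_event_measure:
  assumes "finite_measure \<nu>" "sets \<nu> = sets (shift_sigma d)"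
  shows "measure \<nu> {x \<in> shift_space d. P (prefix x n)} =
    (\<Sum>w\<in>{w \<in> words d n. P w}. measure \<nu> (cylinder d w))"
proof -
  interpret finite_measure \<nu> by fact
  show ?thesis
    unfolding prefix_event_eq
  proof (rule finite_measure_finite_Union)
    show "disjoint_family_on (cylinder d) {w \<in> words d n. P w}"
      unfolding disjoint_family_on_def
      by (intro ballI impI cylinder_disjoint) (auto simp: words_def)
  qed (simp_all add: finite_words image_subset_iff cylinder_in_sets[OF assms(2)])
qed

context bernoulli
begin

text \<open>Chernoff's bound. The moment generating function of \<open>b - \<beta> - \<epsilon>\<close> has value \<open>1\<close> and slope
  \<open>-\<epsilon>\<close> at \<open>0\<close>, so it is less than \<open>1\<close> somewhere to the right of \<open>0\<close>.\<close>

lemma large_deviation: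
  fixes b :: "nat \<Rightarrow> real" and \<beta> :: real
  defines "\<beta> \<equiv> (\<Sum>i\<in>alphabet d. q i * b i)"
  assumes "\<epsilon> > 0"
  obtains r where "0 \<le> r" "r < 1"
    "\<And>n. measure \<nu> {x \<in> shift_space d. n * (\<beta> + \<epsilon>) \<le> letter_sum b n x} \<le> r ^ n"
proof -
  define g where "g h = (\<Sum>i\<in>alphabet d. q i * exp (h * (b i - \<beta> - \<epsilon>)))" for h
  have "(g has_real_derivative (\<Sum>i\<in>alphabet d. q i * (b i - \<beta> - \<epsilon>))) (at 0)"
    unfolding g_def
  proof (rule DERIV_sum)
    show "((\<lambda>h. q i * exp (h * (b i - \<beta> - \<epsilon>))) has_real_derivative q i * (b i - \<beta> - \<epsilon>)) (at 0)" for i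
    proof -
      have "((\<lambda>h. a * exp (h * c)) has_real_derivative a * c) (at 0)" for a c :: real
        by (auto intro!: derivative_eq_intros)
      then show ?thesis .
    qed
  qed
  moreover have "(\<Sum>i\<in>alphabet d. q i * (b i - \<beta> - \<epsilon>)) = \<beta> - (\<Sum>i\<in>alphabet d. q i) * (\<beta> + \<epsilon>)"
    unfolding sum_distrib_right \<beta>_def sum_subtractf[symmetric] by (intro sum.cong) (auto simp: algebra_simps)
  ultimately have "(g has_real_derivative - \<epsilon>) (at 0)" by (simp add: q_sum)
  then obtain h0 where h0: "h0 > 0" "\<forall>h>0. h < h0 \<longrightarrow> g (0 + h) < g 0"
    using DERIV_neg_dec_right[of g "- \<epsilon>" 0] \<open>\<epsilon> > 0\<close> by auto
  define h where "h = h0 / 2"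
  have "h > 0" using h0 by (simp add: h_def)
  have gh: "g h < 1"
    using h0 by (auto simp: h_def g_def q_sum dest: spec[of _ "h0 / 2"])
  show ?thesis
  proof (rule that[of "g h"])
    show "0 \<le> g h" unfolding g_def using q_nonneg by (intro sum_nonneg) auto
    show "g h < 1" by (rule gh)
    fix n :: nat
    let ?P = "\<lambda>w. n * (\<beta> + \<epsilon>) \<le> sum_list (map b w)"
    have "measure \<nu> {x \<in> shift_space d. n * (\<beta> + \<epsilon>) \<le> letter_sum b n x} =
        (\<Sum>w\<in>{w \<in> words d n. ?P w}. measure \<nu> (cylinder d w))"
      unfolding letter_sum_prefix by (rule prefix_event_measure[OF finite_measure_axioms sets_\<nu>])
    also have "\<dots> \<le> (\<Sum>w\<in>{w \<in> words d n. ?P w}. prod_list (map (\<lambda>i. q i * exp (h * (b i - \<beta> - \<epsilon>))) w))"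
    proof (rule sum_mono)
      fix w assume w: "w \<in> {w \<in> words d n. ?P w}"
      then have ws: "set w \<subseteq> alphabet d" "length w = n" by (auto simp: words_def)
      have eq: "prod_list (map (\<lambda>i. q i * exp (h * (b i - \<beta> - \<epsilon>))) v) =
          prod_list (map q v) * exp (h * (sum_list (map b v) - length v * (\<beta> + \<epsilon>)))" for v
        by (induction v) (simp_all add: algebra_simps flip: exp_add)
      have "1 \<le> exp (h * (sum_list (map b w) - length w * (\<beta> + \<epsilon>)))"
        using w ws \<open>h > 0\<close> by simp
      moreover have "0 \<le> prod_list (map q w)" using ws q_nonneg by (intro prod_list_nonneg) auto
      ultimately show "measure \<nu> (cylinder d w) \<le>
          prod_list (map (\<lambda>i. q i * exp (h * (b i - \<beta> - \<epsilon>))) w)"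
        unfolding eq cyl_\<nu>[OF ws(1)] by (simp add: mult_le_cancel_left1)
    qed
    also have "\<dots> \<le> (\<Sum>w\<in>words d n. prod_list (map (\<lambda>i. q i * exp (h * (b i - \<beta> - \<epsilon>))) w))"
    proof (rule sum_mono2[OF finite_words])
      fix w assume "w \<in> words d n - {w \<in> words d n. ?P w}"
      then show "0 \<le> prod_list (map (\<lambda>i. q i * exp (h * (b i - \<beta> - \<epsilon>))) w)"
        using q_nonneg by (intro prod_list_nonneg) (auto simp: words_def)
    qed blast
    also have "\<dots> = g h ^ n" unfolding g_def by (rule sum_words_prod)
    finally show "measure \<nu> {x \<in> shift_space d. n * (\<beta> + \<epsilon>) \<le> letter_sum b n x} \<le> g h ^ n" .
  qed
qed

lemma AE_eventually_letter_sum_less: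
  fixes b :: "nat \<Rightarrow> real" and \<beta> :: real
  defines "\<beta> \<equiv> (\<Sum>i\<in>alphabet d. q i * b i)"
  assumes "\<epsilon> > 0"
  shows "AE x in \<nu>. \<forall>\<^sub>F n in sequentially. letter_sum b n x < n * (\<beta> + \<epsilon>)"
proof -
  obtain r where r: "0 \<le> r" "r < 1"
    "\<And>n. measure \<nu> {x \<in> shift_space d. n * (\<beta> + \<epsilon>) \<le> letter_sum b n x} \<le> r ^ n"
    by (rule large_deviation[OF \<open>\<epsilon> > 0\<close>, of b, folded \<beta>_def]) (rule that)
  let ?A = "\<lambda>n. {x \<in> shift_space d. n * (\<beta> + \<epsilon>) \<le> letter_sum b n x}"
  have "AE x in \<nu>. \<forall>\<^sub>F n in sequentially. x \<in> space \<nu> - ?A n"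
  proof (rule borel_cantelli_AE1)
    show "?A n \<in> sets \<nu>" for n
      unfolding letter_sum_prefix by (rule prefix_event_sets[OF sets_\<nu>])
    show "emeasure \<nu> (?A n) < \<infinity>" for n by (simp add: emeasure_eq_measure)
    show "summable (\<lambda>n. measure \<nu> (?A n))"
      by (rule summable_comparison_test'[OF summable_geometric[of r]]) (use r in auto)
  qed
  then show ?thesis
  proof eventually_elim
    case (elim x)
    then show ?case by eventually_elim (auto simp: space_\<nu>)
  qed
qed

lemma law_of_large_numbers:
  fixes b :: "nat \<Rightarrow> real" and \<beta> :: real
  defines "\<beta> \<equiv> (\<Sum>i\<in>alphabet d. q i * b i)"
  shows "AE x in \<nu>. (\<lambda>n. letter_sum b n x / real n) \<longlonglongrightarrow> \<beta>"
proof -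
  have neg: "letter_sum (\<lambda>i. - b i) n x = - letter_sum b n x" for n x
    by (simp add: letter_sum_def sum_negf)
  have "AE x in \<nu>. \<forall>j. \<forall>\<^sub>F n in sequentially. letter_sum b n x < n * (\<beta> + inverse (Suc j))"
    unfolding AE_all_countable \<beta>_def by (intro allI AE_eventually_letter_sum_less) auto
  moreover have "AE x in \<nu>. \<forall>j. \<forall>\<^sub>F n in sequentially. - letter_sum b n x < n * (- \<beta> + inverse (Suc j))"
    unfolding AE_all_countable
  proof
    fix j
    show "AE x in \<nu>. \<forall>\<^sub>F n in sequentially. - letter_sum b n x < n * (- \<beta> + inverse (Suc j))"
      using AE_eventually_letter_sum_less[of "inverse (Suc j)" "\<lambda>i. - b i"]
      by (simp add: neg \<beta>_def sum_negf)
  qed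
  ultimately show ?thesis
  proof eventually_elim
    case (elim x)
    show ?case
    proof (rule tendstoI)
      fix e :: real assume "e > 0"
      then obtain j where j: "inverse (real (Suc j)) < e" using reals_Archimedean by blast
      from elim(1)[rule_format, of j] elim(2)[rule_format, of j] eventually_gt_at_top[of 0]
      show "\<forall>\<^sub>F n in sequentially. dist (letter_sum b n x / real n) \<beta> < e"
      proof eventually_elim
        case (elim n)
        then have "letter_sum b n x / n < \<beta> + inverse (Suc j)"
          "\<beta> - inverse (Suc j) < letter_sum b n x / n"
          by (simp_all add: field_simps)
        then show ?case using j unfolding dist_real_def by linarith
      qed
    qed
  qed
qed

end

section \<open>Lower bound for the spectrum\<close>

context ratio_ifs
begin

text \<open>The almost sure Lyapunov exponent under the Bernoulli measure with weights \<open>weight u\<close>, equal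
  to minus the derivative of the pressure at \<open>u\<close>.\<close>

definition exponent :: "real \<Rightarrow> real" where
  "exponent u = - (\<Sum>i\<in>alphabet d. weight u i * \<rho> i)"

lemma exponent_pos: "exponent u > 0"
proof -
  have "(\<Sum>i\<in>alphabet d. weight u i * (- \<rho> i)) > 0"
    using weight_pos[of u] ratio_neg one_two_in_alphabet by (intro sum_pos mult_pos_pos) auto
  then show ?thesis by (simp add: exponent_def sum_negf)
qed

text \<open>The quantity is the entropy of the probability vector \<open>weight u\<close>. It is positive because the
  vector has at least two positive entries.\<close>

lemma entropy_pos: "ln (partition_sum u) + u * exponent u > 0"
proof -
  have lt1: "weight u i < 1" if i: "i \<in> alphabet d" for i
  proof -
    obtain j where j: "j \<in> alphabet d" "j \<noteq> i" using other_letter .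
    have "weight u i + weight u j = (\<Sum>k\<in>{i, j}. weight u k)" using j by simp
    also have "\<dots> \<le> (\<Sum>k\<in>alphabet d. weight u k)"
      using i j weight_pos[of u] by (intro sum_mono2) (auto simp: less_imp_le)
    finally show ?thesis using weight_pos[of u j] sum_weight[of u] by simp
  qed
  have lnw: "ln (weight u i) = u * \<rho> i - ln (partition_sum u)" for i
    unfolding weight_def using partition_sum_pos[of u] by (simp add: ln_div)
  have "0 < (\<Sum>i\<in>alphabet d. weight u i * (- ln (weight u i)))"
    using weight_pos[of u] lt1 one_two_in_alphabet by (intro sum_pos mult_pos_pos) auto
  also have "\<dots> = (\<Sum>i\<in>alphabet d. weight u i * ln (partition_sum u) - u * (weight u i * \<rho> i))"
    unfolding lnw by (intro sum.cong) (auto simp: algebra_simps)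
  also have "\<dots> = ln (partition_sum u) + u * exponent u"
    unfolding sum_subtractf exponent_def
    by (simp add: sum_weight flip: sum_distrib_left sum_distrib_right)
  finally show ?thesis .
qed

lemma AE_level_set:
  assumes "bernoulli d (weight u) \<nu>"
  shows "AE x in \<nu>. x \<in> level_set d \<rho> (exponent u)"
proof -
  interpret bernoulli d "weight u" \<nu> by fact
  show ?thesis using law_of_large_numbers[of \<rho>] AE_space
  proof eventually_elim
    case (elim x)
    from tendsto_minus[OF elim(1)] elim(2) show ?case
      by (simp add: level_set_def exponent_def space_\<nu>)
  qed
qed

text \<open>A covering set \<open>V\<close> that contains the coding point of \<open>x\<close> only contains points whose codes
  agree with \<open>x\<close> as long as the cylinders around \<open>x\<close> are wider than a multiple of the diameter of \<open>V\<close>. If \<open>\<nu>\<close> is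
  bounded on these cylinders by the \<open>t\<close>-th power of their width, \<open>\<nu>\<close> of the set of codes is bounded
  by a multiple of \<open>diameter V powr t\<close>.\<close>

lemma codes_in_small_set:
  assumes ber: "bernoulli d (weight u) \<nu>" and "t > 0" and ctrl: "controls_distances d \<Phi> K (letter_sum \<rho>)"
    and x: "x \<in> shift_space d"
    and N: "\<And>n. n \<ge> N \<Longrightarrow> prod_list (map (weight u) (prefix x n)) \<le> exp (t * letter_sum \<rho> n x)"
    and V: "bounded V" "coding \<Phi> x \<in> V" and small: "K * diameter V < exp (letter_sum \<rho> N x)"
  shows "\<exists>B\<in>sets \<nu>. {y \<in> shift_space d. coding \<Phi> y \<in> V} \<subseteq> B \<and>
    measure \<nu> B \<le> (K * diameter V) powr t"
proof -
  interpret bernoulli d "weight u" \<nu> by fact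
  note K = controls_distancesD[OF ctrl]
  let ?\<delta> = "diameter V"
  have \<delta>0: "0 \<le> ?\<delta>" using V(1) by (rule diameter_ge_0)
  have agree: "exp (letter_sum \<rho> n x) \<le> K * ?\<delta>"
    if y: "y \<in> shift_space d" "coding \<Phi> y \<in> V" and n: "\<forall>k<n. x k = y k" "x n \<noteq> y n" for y n
  proof -
    have "exp (letter_sum \<rho> n x) \<le> K * code_dist \<Phi> x y" using K(2)[OF x y(1) n] by blast
    also have "\<dots> \<le> K * ?\<delta>"
      using diameter_bounded_bound[OF V(1) V(2) y(2)] K(1)
      by (intro mult_left_mono) (auto simp: dist_real_def)
    finally show ?thesis .
  qed
  have cyl: "measure \<nu> (cylinder d (prefix x n)) \<le> exp (t * letter_sum \<rho> n x)" if "n \<ge> N" for n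
    using N[OF that] unfolding cyl_\<nu>[OF set_prefix_subset[OF x]] .
  obtain m where m: "\<And>i. i \<in> alphabet d \<Longrightarrow> \<rho> i \<le> m" "m < 0"
  proof
    show "\<rho> i \<le> Max (\<rho> ` alphabet d)" if "i \<in> alphabet d" for i using that by simp
    show "Max (\<rho> ` alphabet d) < 0" using one_two_in_alphabet ratio_neg by (subst Max_less_iff) auto
  qed
  have ls: "letter_sum \<rho> n x \<le> n * m" for n
    unfolding letter_sum_def using sum_mono[of "{..<n}" "\<lambda>k. \<rho> (x k)" "\<lambda>_. m"]
      m(1) letter_in_alphabet[OF x] by simp
  have to0: "(\<lambda>n. exp (c * (real n * m))) \<longlonglongrightarrow> 0" if "c > 0" for c
  proof -
    have "exp (c * (real n * m)) = exp (c * m) ^ n" for n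
      by (simp add: mult_ac flip: exp_of_nat_mult)
    moreover have "(\<lambda>n. exp (c * m) ^ n) \<longlonglongrightarrow> 0"
      using that m(2) by (intro LIMSEQ_power_zero) (auto simp: mult_less_0_iff)
    ultimately show ?thesis by simp
  qed
  show ?thesis
  proof (cases "?\<delta> = 0")
    case True
    have "{x} = (\<Inter>n\<in>UNIV. cylinder d (prefix x n))"
    proof (intro equalityI subsetI)
      fix y assume "y \<in> (\<Inter>n\<in>UNIV. cylinder d (prefix x n))"
      then have "y \<in> cylinder d (prefix x (Suc k))" for k by blast
      then have "y k = x k" for k
        by (auto simp: cylinder_def simp del: upt_Suc dest!: spec[of _ k] meta_spec[of _ k])
      then show "y \<in> {x}" by auto
    qed (use x in \<open>auto simp: cylinder_def\<close>)
    moreover have "(\<Inter>n\<in>UNIV. cylinder d (prefix x n)) \<in> sets \<nu>"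
      using cylinder_in_sets[OF sets_\<nu>] by (intro sets.countable_INT) auto
    ultimately have sing: "{x} \<in> sets \<nu>" by simp
    have "measure \<nu> {x} \<le> 0"
    proof (rule LIMSEQ_le_const[OF to0[OF \<open>t > 0\<close>]])
      have "measure \<nu> {x} \<le> exp (t * (real n * m))" if "n \<ge> N" for n
      proof -
        have "measure \<nu> {x} \<le> measure \<nu> (cylinder d (prefix x n))"
          using x by (intro finite_measure_mono cylinder_in_sets[OF sets_\<nu>]) (simp add: mem_cylinder_iff)
        also have "\<dots> \<le> exp (t * letter_sum \<rho> n x)" by (rule cyl[OF that])
        also have "\<dots> \<le> exp (t * (real n * m))" using ls[of n] \<open>t > 0\<close> by simp
        finally show ?thesis .
      qed
      then show "\<exists>N. \<forall>n\<ge>N. measure \<nu> {x} \<le> exp (t * (real n * m))" by blast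
    qed
    moreover have "{y \<in> shift_space d. coding \<Phi> y \<in> V} \<subseteq> {x}"
    proof
      fix y assume y: "y \<in> {y \<in> shift_space d. coding \<Phi> y \<in> V}"
      show "y \<in> {x}"
      proof (rule ccontr)
        assume "y \<notin> {x}"
        then obtain n where "\<forall>k<n. x k = y k" "x n \<noteq> y n" using first_difference[of x y] by auto
        then have "exp (letter_sum \<rho> n x) \<le> 0" using agree[of y n] y True by simp
        then show False by simp
      qed
    qed
    ultimately show ?thesis using True sing by (intro bexI[of _ "{x}"]) auto
  next
    case False
    then have "?\<delta> > 0" using \<delta>0 by simp
    have "\<exists>n. exp (letter_sum \<rho> n x) \<le> K * ?\<delta>"
    proof -
      have "\<forall>\<^sub>F n in sequentially. exp (1 * (real n * m)) < K * ?\<delta>"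
        using \<open>?\<delta> > 0\<close> K(1) by (intro order_tendstoD(2)[OF to0]) auto
      then obtain n where "exp (real n * m) < K * ?\<delta>" by (auto simp: eventually_sequentially)
      moreover have "exp (letter_sum \<rho> n x) \<le> exp (real n * m)" using ls by simp
      ultimately show ?thesis by (intro exI[of _ n]) linarith
    qed
    define n where "n = (LEAST n. exp (letter_sum \<rho> n x) \<le> K * ?\<delta>)"
    have n: "exp (letter_sum \<rho> n x) \<le> K * ?\<delta>"
      unfolding n_def by (rule LeastI_ex) fact
    have "n \<ge> N"
    proof (rule ccontr)
      assume "\<not> n \<ge> N"
      then have "exp (letter_sum \<rho> N x) \<le> exp (letter_sum \<rho> n x)"
        using letter_sum_antimono[OF x] by simp
      then show False using n small by linarith
    qed
    have sub: "{y \<in> shift_space d. coding \<Phi> y \<in> V} \<subseteq> cylinder d (prefix x n)"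
    proof
      fix y assume y: "y \<in> {y \<in> shift_space d. coding \<Phi> y \<in> V}"
      have "\<forall>k<n. y k = x k"
      proof (cases "x = y")
        case False
        then obtain j where j: "\<forall>k<j. x k = y k" "x j \<noteq> y j" using first_difference by blast
        have "n \<le> j" unfolding n_def by (rule Least_le) (use agree[OF _ _ j] y in blast)
        then show ?thesis using j(1) by auto
      qed simp
      then show "y \<in> cylinder d (prefix x n)" using y by (simp add: cylinder_def)
    qed
    have "measure \<nu> (cylinder d (prefix x n)) \<le> exp (t * letter_sum \<rho> n x)" by (rule cyl) fact
    also have "\<dots> = exp (letter_sum \<rho> n x) powr t" by (simp add: exp_powr_real mult.commute)
    also have "\<dots> \<le> (K * ?\<delta>) powr t" using n \<open>t > 0\<close> by (intro powr_mono2) auto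
    finally show ?thesis using sub cylinder_in_sets[OF sets_\<nu>] by blast
  qed
qed

text \<open>The mass distribution principle. The Bernoulli measure with weights \<open>weight u\<close> is carried by
  the level set, and there its cylinder weights \<open>exp (u \<rho>(w) - n P(u))\<close> are eventually at most
  \<open>exp (t \<rho>(w))\<close>, since \<open>\<rho>(w) \<approx> - n * exponent u\<close>. On the set \<open>E N\<close>, where this bound holds from length
  \<open>N\<close> on, the total of any cover bounds the measure from above; so it cannot be arbitrarily small.\<close>

lemma level_set_not_null:
  assumes "t > 0" and t: "t * exponent u < ln (partition_sum u) + u * exponent u"
  shows "hausdorff_measure t (coding \<Phi> ` level_set d \<rho> (exponent u)) \<noteq> 0"
proof
  let ?L = "level_set d \<rho> (exponent u)"
  assume null: "hausdorff_measure t (coding \<Phi> ` ?L) = 0"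
  obtain \<nu> where ber: "bernoulli d (weight u) \<nu>" using bernoulli_weight_exists .
  interpret bernoulli d "weight u" \<nu> by fact
  obtain K where ctrl: "controls_distances d \<Phi> K (letter_sum \<rho>)"
    using ratio_metric by blast
  note K = controls_distancesD[OF ctrl]
  let ?P = "\<lambda>n x. prod_list (map (weight u) (prefix x n)) \<le> exp (t * letter_sum \<rho> n x)"
  define E where "E N = {x \<in> shift_space d. \<forall>n\<ge>N. ?P n x}" for N
  have E_sets: "E N \<in> sets \<nu>" for N
  proof -
    have "E N = (\<Inter>n\<in>{N..}. {x \<in> shift_space d. ?P n x})" by (auto simp: E_def)
    moreover have "{x \<in> shift_space d. ?P n x} \<in> sets \<nu>" for n
      unfolding letter_sum_prefix by (rule prefix_event_sets[OF sets_\<nu>])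
    ultimately show ?thesis by (auto intro!: sets.countable_INT)
  qed
  have L_E: "x \<in> (\<Union>N. E N)" if x: "x \<in> ?L" for x
  proof -
    have xs: "x \<in> shift_space d" and lim: "(\<lambda>n. letter_sum \<rho> n x / (- real n)) \<longlonglongrightarrow> exponent u"
      using x by (auto simp: level_set_def)
    have "(\<lambda>n. (t - u) * (letter_sum \<rho> n x / (- real n))) \<longlonglongrightarrow> (t - u) * exponent u"
      by (intro tendsto_intros lim)
    moreover have "(t - u) * exponent u < ln (partition_sum u)" using t by (simp add: algebra_simps)
    ultimately have "\<forall>\<^sub>F n in sequentially. (t - u) * (letter_sum \<rho> n x / (- real n)) < ln (partition_sum u)"
      by (rule order_tendstoD(2))
    then have "\<forall>\<^sub>F n in sequentially. ?P n x"
      using eventually_gt_at_top[of 0]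
    proof eventually_elim
      case (elim n)
      then have "(u - t) * letter_sum \<rho> n x < n * ln (partition_sum u)" by (simp add: field_simps)
      then show ?case unfolding prod_weight by (simp add: letter_sum_prefix algebra_simps)
    qed
    then show ?thesis using xs by (auto simp: E_def eventually_sequentially)
  qed
  have "\<exists>N. measure \<nu> (E N) > 0"
  proof (rule ccontr)
    assume "\<nexists>N. measure \<nu> (E N) > 0"
    then have "emeasure \<nu> (E N) = 0" for N
      by (simp add: emeasure_eq_measure not_less measure_le_0_iff)
    then have "AE x in \<nu>. x \<notin> E N" for N
      using E_sets by (intro AE_not_in) (simp add: null_sets_def)
    then have "AE x in \<nu>. \<forall>N. x \<notin> E N" unfolding AE_all_countable by blast
    moreover note AE_level_set[OF ber]
    ultimately have "AE x in \<nu>. False"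
    proof eventually_elim
      case (elim x)
      then show ?case using L_E[of x] by blast
    qed
    then show False by simp
  qed
  then obtain N where N: "measure \<nu> (E N) > 0" by blast
  obtain m where m: "\<And>i. i \<in> alphabet d \<Longrightarrow> m \<le> \<rho> i"
  proof
    show "Min (\<rho> ` alphabet d) \<le> \<rho> i" if "i \<in> alphabet d" for i using that by simp
  qed
  have lsN: "N * m \<le> letter_sum \<rho> N x" if "x \<in> shift_space d" for x
    unfolding letter_sum_def using sum_mono[of "{..<N}" "\<lambda>_. m" "\<lambda>k. \<rho> (x k)"]
      m letter_in_alphabet[OF that] by simp
  \<comment> \<open>The first bound keeps the covering sets narrower than the cylinders of length \<open>N\<close>, the second
    one makes the measure of the cover at most half of that of \<open>E N\<close>.\<close>
  define \<epsilon> where "\<epsilon> = min ((exp (N * m) / K) powr t) (measure \<nu> (E N) / (2 * K powr t))"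
  have "\<epsilon> > 0" using N K(1) by (simp add: \<epsilon>_def)
  then obtain V where V: "coding \<Phi> ` ?L \<subseteq> (\<Union>k::nat. V k)" "\<And>k. bounded (V k)"
    "(\<Sum>k. ennreal (diameter (V k) powr t)) < ennreal \<epsilon>"
    using hausdorff_null_cover[OF null] by metis
  have small: "K * diameter (V k) < exp (N * m)" for k
  proof -
    have "ennreal (diameter (V k) powr t) = (\<Sum>i\<in>{k}. ennreal (diameter (V i) powr t))" by simp
    also have "\<dots> \<le> (\<Sum>i. ennreal (diameter (V i) powr t))"
      by (rule sum_le_suminf) auto
    also have "\<dots> < ennreal \<epsilon>" by (rule V(3))
    finally have "diameter (V k) powr t < \<epsilon>" by (simp add: ennreal_less_iff)
    also have "\<dots> \<le> (exp (N * m) / K) powr t" by (simp add: \<epsilon>_def)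
    finally have "diameter (V k) < exp (N * m) / K"
      using \<open>t > 0\<close> K(1) diameter_ge_0[OF V(2)]
      by (metis linorder_not_less powr_mono2 less_imp_le divide_pos_pos exp_gt_zero)
    then show ?thesis using K(1) by (simp add: field_simps)
  qed
  have "\<exists>B\<in>sets \<nu>. {y \<in> E N \<inter> ?L. coding \<Phi> y \<in> V k} \<subseteq> B \<and>
      measure \<nu> B \<le> (K * diameter (V k)) powr t" for k
  proof (cases "\<exists>x\<in>E N. coding \<Phi> x \<in> V k")
    case True
    then obtain x where x: "x \<in> E N" "coding \<Phi> x \<in> V k" by blast
    have xs: "x \<in> shift_space d" using x by (simp add: E_def)
    have "\<exists>B\<in>sets \<nu>. {y \<in> shift_space d. coding \<Phi> y \<in> V k} \<subseteq> B \<and>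
        measure \<nu> B \<le> (K * diameter (V k)) powr t"
    proof (rule codes_in_small_set[OF ber \<open>t > 0\<close> ctrl xs _ V(2) x(2)])
      show "?P n x" if "n \<ge> N" for n using x(1) that by (simp add: E_def)
      have "exp (N * m) \<le> exp (letter_sum \<rho> N x)" using lsN[OF xs] by simp
      then show "K * diameter (V k) < exp (letter_sum \<rho> N x)" using small[of k] by linarith
    qed
    then show ?thesis by (auto simp: E_def)
  next
    case False
    then show ?thesis by (intro bexI[of _ "{}"]) auto
  qed
  then have "\<forall>k. \<exists>B. B \<in> sets \<nu> \<and> {y \<in> E N \<inter> ?L. coding \<Phi> y \<in> V k} \<subseteq> B \<and>
      measure \<nu> B \<le> (K * diameter (V k)) powr t"
    unfolding Bex_def by (rule allI)
  from choice[OF this] obtain B where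
    "\<forall>k. B k \<in> sets \<nu> \<and> {y \<in> E N \<inter> ?L. coding \<Phi> y \<in> V k} \<subseteq> B k \<and>
      measure \<nu> (B k) \<le> (K * diameter (V k)) powr t" by (elim exE)
  then have B: "B k \<in> sets \<nu>" "{y \<in> E N \<inter> ?L. coding \<Phi> y \<in> V k} \<subseteq> B k"
    "measure \<nu> (B k) \<le> (K * diameter (V k)) powr t" for k
    by (simp_all only:)
  have "emeasure \<nu> (E N) \<le> emeasure \<nu> (\<Union>k. B k)"
  proof (rule emeasure_mono_AE)
    show "AE x in \<nu>. x \<in> E N \<longrightarrow> x \<in> (\<Union>k. B k)"
      using AE_level_set[OF ber]
    proof eventually_elim
      case (elim x)
      then show ?case using V(1) B(2) by blast
    qed
    show "(\<Union>k. B k) \<in> sets \<nu>" using B(1) by blast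
  qed
  also have "\<dots> \<le> (\<Sum>k. emeasure \<nu> (B k))"
    by (rule emeasure_subadditive_countably) (use B(1) in blast)
  also have "\<dots> \<le> (\<Sum>k. ennreal (K powr t) * ennreal (diameter (V k) powr t))"
  proof (rule suminf_le)
    fix k
    have "measure \<nu> (B k) \<le> K powr t * diameter (V k) powr t"
      using B(3)[of k] K(1) diameter_ge_0[OF V(2), of k] by (simp add: powr_mult)
    then show "emeasure \<nu> (B k) \<le> ennreal (K powr t) * ennreal (diameter (V k) powr t)"
      by (simp add: emeasure_eq_measure ennreal_mult[symmetric] ennreal_leI)
  qed auto
  also have "\<dots> = ennreal (K powr t) * (\<Sum>k. ennreal (diameter (V k) powr t))"
    by (rule ennreal_suminf_cmult)
  also have "\<dots> \<le> ennreal (K powr t) * ennreal \<epsilon>" using V(3) by (intro mult_left_mono) auto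
  also have "\<dots> = ennreal (K powr t * \<epsilon>)" using \<open>\<epsilon> > 0\<close> by (simp add: ennreal_mult)
  finally have "measure \<nu> (E N) \<le> K powr t * \<epsilon>"
    using \<open>\<epsilon> > 0\<close> by (simp add: emeasure_eq_measure)
  also have "\<dots> \<le> K powr t * (measure \<nu> (E N) / (2 * K powr t))"
    by (intro mult_left_mono) (auto simp: \<epsilon>_def)
  also have "\<dots> = measure \<nu> (E N) / 2" using K(1) by simp
  finally show False using N by simp
qed

lemma lyapunov_spectrum_le:
  assumes "t > 0" "pressure_fun d \<Phi> u + u * \<alpha> < t * \<alpha>"
  shows "lyapunov_spectrum d \<Phi> \<alpha> \<le> ennreal t"
  unfolding lyapunov_spectrum_eq hausdorff_dim_def
  using level_set_null[OF assms(1), of u \<alpha>] assms unfolding pressure_fun_eq by (intro Inf_lower) blast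

lemma lyapunov_spectrum_ge:
  "ennreal ((pressure_fun d \<Phi> u + u * exponent u) / exponent u) \<le> lyapunov_spectrum d \<Phi> (exponent u)"
  unfolding lyapunov_spectrum_eq hausdorff_dim_def pressure_fun_eq
proof (rule Inf_greatest, safe)
  fix s :: real assume s: "s > 0" "hausdorff_measure s (coding \<Phi> ` level_set d \<rho> (exponent u)) = 0"
  then have "\<not> s * exponent u < ln (partition_sum u) + u * exponent u"
    using level_set_not_null by blast
  then show "ennreal ((ln (partition_sum u) + u * exponent u) / exponent u) \<le> ennreal s"
    using exponent_pos[of u] by (intro ennreal_leI) (simp add: field_simps)
qed

end

text \<open>The lower bound at \<open>\<alpha> = exponent u\<close> for one system, combined with the upper bound at the same
  \<open>\<alpha>\<close> and \<open>u\<close> for the other, compares the pressures at \<open>u\<close>.\<close>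

lemma lyapunov_spectrum_eq_imp_pressure_le:
  assumes "ratio_ifs d \<Phi> \<rho>" "ratio_ifs d \<Psi> \<tau>" and eq: "lyapunov_spectrum d \<Phi> = lyapunov_spectrum d \<Psi>"
  shows "pressure_fun d \<Phi> u \<le> pressure_fun d \<Psi> u"
proof (rule ccontr)
  interpret P: ratio_ifs d \<Phi> \<rho> by fact
  interpret Q: ratio_ifs d \<Psi> \<tau> by fact
  let ?\<alpha> = "P.exponent u"
  let ?s = "(pressure_fun d \<Phi> u + u * ?\<alpha>) / ?\<alpha>" and ?s' = "(pressure_fun d \<Psi> u + u * ?\<alpha>) / ?\<alpha>"
  assume "\<not> pressure_fun d \<Phi> u \<le> pressure_fun d \<Psi> u"
  then have "?s' < ?s" using P.exponent_pos[of u] by (intro divide_strict_right_mono) auto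
  moreover have "0 < ?s"
    using P.exponent_pos[of u] P.entropy_pos[of u] unfolding P.pressure_fun_eq by simp
  ultimately obtain t where t: "max 0 ?s' < t" "t < ?s" using dense[of "max 0 ?s'" ?s] by auto
  have "pressure_fun d \<Psi> u + u * ?\<alpha> < t * ?\<alpha>"
    using t(1) P.exponent_pos[of u] by (simp add: pos_divide_less_eq)
  then have "lyapunov_spectrum d \<Psi> ?\<alpha> \<le> ennreal t" using t(1) by (intro Q.lyapunov_spectrum_le) auto
  moreover have "ennreal ?s \<le> lyapunov_spectrum d \<Psi> ?\<alpha>"
    using P.lyapunov_spectrum_ge[of u] unfolding eq .
  ultimately have "ennreal ?s \<le> ennreal t" by (rule order_trans[rotated])
  then show False using t by (simp add: ennreal_le_iff)
qed

lemma lyapunov_spectrum_eq_iff: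
  assumes "ratio_ifs d \<Phi> \<rho>" "ratio_ifs d \<Psi> \<tau>"
  shows "lyapunov_spectrum d \<Phi> = lyapunov_spectrum d \<Psi> \<longleftrightarrow>
    (\<exists>p. p permutes alphabet d \<and> (\<forall>i\<in>alphabet d. \<rho> i = \<tau> (p i)))"
proof
  assume eq: "lyapunov_spectrum d \<Phi> = lyapunov_spectrum d \<Psi>"
  have "pressure_fun d \<Phi> = pressure_fun d \<Psi>"
    using lyapunov_spectrum_eq_imp_pressure_le[OF assms eq]
      lyapunov_spectrum_eq_imp_pressure_le[OF assms(2,1) eq[symmetric]]
    by (intro ext antisym)
  then show "\<exists>p. p permutes alphabet d \<and> (\<forall>i\<in>alphabet d. \<rho> i = \<tau> (p i))"
    using pressure_fun_eq_iff[OF assms] by blast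
next
  assume "\<exists>p. p permutes alphabet d \<and> (\<forall>i\<in>alphabet d. \<rho> i = \<tau> (p i))"
  then obtain p where p: "p permutes alphabet d" "\<forall>i\<in>alphabet d. \<rho> i = \<tau> (p i)" by blast
  show "lyapunov_spectrum d \<Phi> = lyapunov_spectrum d \<Psi>"
    using lyapunov_spectrum_cong[OF assms(1) ratio_ifs_permute_gens[OF p(1) assms(2)] p(2)]
    unfolding lyapunov_spectrum_permute_gens[OF p(1)] .
qed

section \<open>The equivalences\<close>

theorem theorem4p3:
  fixes d :: nat and \<Phi> \<Psi> :: ifs
  assumes "d \<ge> 2"
    and "\<Phi> \<in> EAS d" and "\<Psi> \<in> EAS d"
    and "\<not> degenerate d \<Phi>" and "\<not> degenerate d \<Psi>"
  shows "((\<exists>u::real. u \<noteq> 0 \<and> gibbs_equal_upto_perm d \<Phi> u \<Psi> u \<and>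
              pressure_fun d \<Phi> u = pressure_fun d \<Psi> u)
            \<longleftrightarrow> equivalent_upto_perm d \<Phi> \<Psi>) \<and>
         (equivalent_upto_perm d \<Phi> \<Psi>
            \<longleftrightarrow> potentials_cohomologous_upto_perm d \<Phi> \<Psi>) \<and>
         (potentials_cohomologous_upto_perm d \<Phi> \<Psi>
            \<longleftrightarrow> pressure_fun d \<Phi> = pressure_fun d \<Psi>) \<and>
         (pressure_fun d \<Phi> = pressure_fun d \<Psi>
            \<longleftrightarrow> lyapunov_spectrum d \<Phi> = lyapunov_spectrum d \<Psi>)"
proof -
  obtain \<rho> \<tau> where "ratio_ifs d \<Phi> \<rho>" "ratio_ifs d \<Psi> \<tau>"
    using EAS_ratios[OF assms(1)] assms(2,3) by blast
  note ratios = this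
  show ?thesis
    unfolding gibbs_equal_iff[OF ratios] equivalent_upto_perm_iff[OF ratios]
      potentials_cohomologous_upto_perm_iff[OF ratios] pressure_fun_eq_iff[OF ratios]
      lyapunov_spectrum_eq_iff[OF ratios] by simp
qed

end
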